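(* The reduced discrete problem (R) admits at least one solution $(\mathbf u_h,T_h)\in\mathbf W_h\times S_h^0$.
   Context: Let $d\in\{2,3\}$, $\Omega\subset\mathbb R^d$ a polygonal/polyhedral domain, $\Omega_f\subset\Omega$ a polygonal/polyhedral subdomain, $\Omega_s=\Omega\setminus\Omega_f$. Let $\mathcal T_h^f,\mathcal T_h^s$ be shape-regular simplicial triangulations of $\Omega_f,\Omega_s$ with $\mathcal T_h=\mathcal T_h^f\cup\mathcal T_h^s$ a shape-regular simplicial triangulation of $\Omega$; $\varepsilon_h^f,\varepsilon_h$ the sets of edges/faces of elements of $\mathcal T_h^f,\mathcal T_h$. $h_K=\mathrm{diam}\,K$, $\mathbf n_K$ outward unit normal, $\tau|_{\partial K}=h_K^{-1}$. $P_j(D)$: polynomials of degree $\le j$. $Q_j^b$: $L^2(e)$-projection onto $P_j(e)$ (componentwise: $\mathbf Q_j^b$). $(\cdot,\cdot)_{\mathcal T}=\sum_{K\in\mathcal T}(\cdot,\cdot)_K$, $\langle\cdot,\cdot\rangle_{\partial\mathcal T}=\sum_{K\in\mathcal T}\langle\cdot,\cdot\rangle_{\partial K}$. Weak gradient: $\nabla_{w,r}v|_K\in[P_r(K)]^d$, $(\nabla_{w,r}v,\boldsymbol\tau)_K=-(v_0,\nabla\cdot\boldsymbol\tau)_K+\langle v_b,\boldsymbol\tau\cdot\mathbf n_K\rangle_{\partial K}$ for all $\boldsymbol\tau\in[P_r(K)]^d$ (row by row for vector pairs). Weak divergence: $\nabla_{w,r}\cdot\mathbf v|_K\in P_r(K)$,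 $(\nabla_{w,r}\cdot\mathbf v,\varphi)_K=-(\mathbf v_0,\nabla\varphi)_K+\langle\mathbf v_b\cdot\mathbf n_K,\varphi\rangle_{\partial K}$ for all $\varphi\in P_r(K)$ (row by row for matrix pairs). Products of pairs componentwise: $\mathbf u\otimes\mathbf w=\{\mathbf u_0\otimes\mathbf w_0,\mathbf u_b\otimes\mathbf w_b\}$, $\mathbf us=\{\mathbf u_0s_0,\mathbf u_bs_b\}$. Fix integers $k\ge1$, $l\in\{k-1,k\}$, $m$ with $k-1\le m\le l$. $\mathbf V_h^0=\{\mathbf v=\{\mathbf v_0,\mathbf v_b\}:\mathbf v_0|_K\in[P_k(K)]^d\,\forall K\in\mathcal T_h^f,\ \mathbf v_b|_e\in[P_l(e)]^d\,\forall e\in\varepsilon_h^f,\ \mathbf v_b=0\text{ on }\partial\Omega_f\}$ (extended by zero to $\Omega_s$ in forms over $\mathcal T_h$); $Q_h^0=\{q=\{q_0,q_b\}:q_0|_K\in P_{k-1}(K)\,\forall K\in\mathcal T_h^f,\ q_b|_e\in P_k(e)\,\forall e\in\varepsilon_h^f,\ \int_{\Omega_f}q_0=0\}$; $S_h^0=\{s=\{s_0,s_b\}:s_0|_K\in P_k(K)\,\forall K\in\mathcal T_h,\ s_b|_e\in P_l(e)\,\forall e\in\varepsilon_h,\ s_b=0\text{ on }\partial\Omega\}$. $\mathrm{Pr},\kappa,Ra>0$, $\mathbf j=(0,1)^T$ or $(0,0,1)^T$, $\mathbf f\in[L^2(\Omega_f)]^d$, $g\in L^2(\Omega)$. Forms: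 $a_h(\mathbf u,\mathbf v)=\mathrm{Pr}(\nabla_{w,m}\mathbf u,\nabla_{w,m}\mathbf v)_{\mathcal T_h^f}+\mathrm{Pr}\langle\tau(\mathbf Q_l^b\mathbf u_0-\mathbf u_b),\mathbf Q_l^b\mathbf v_0-\mathbf v_b\rangle_{\partial\mathcal T_h^f}$; $b_h(\mathbf v,q)=(\nabla_{w,k}q,\mathbf v_0)_{\mathcal T_h^f}$; $d_h(T,\mathbf v)=\mathrm{Pr}\,Ra(\mathbf jT_0,\mathbf v_0)_{\Omega_f}$; $\bar a_h(T,s)=\kappa(\nabla_{w,m}T,\nabla_{w,m}s)_{\mathcal T_h}+\kappa\langle\tau(Q_l^bT_0-T_b),Q_l^bs_0-s_b\rangle_{\partial\mathcal T_h}$; $c_h(\mathbf w;\mathbf u,\mathbf v)=\frac12(\nabla_{w,k}\cdot(\mathbf u\otimes\mathbf w),\mathbf v_0)_{\mathcal T_h^f}-\frac12(\nabla_{w,k}\cdot(\mathbf v\otimes\mathbf w),\mathbf u_0)_{\mathcal T_h^f}$; $\bar c_h(\mathbf w;T,s)=\frac12(\nabla_{w,k}\cdot(\mathbf wT),s_0)_{\mathcal T_h}-\frac12(\nabla_{w,k}\cdot(\mathbf ws),T_0)_{\mathcal T_h}$; $A_h(\mathbf w;\mathbf u,\mathbf v)=a_h(\mathbf u,\mathbf v)+c_h(\mathbf w;\mathbf u,\mathbf v)$, $\bar A_h(\mathbf w;T,s)=\bar a_h(T,s)+\bar c_h(\mathbf w;T,s)$. $\mathbf W_h=\{\mathbf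 w\in\mathbf V_h^0:b_h(\mathbf w,q)=0\ \forall q\in Q_h^0\}$. (R): find $(\mathbf u_h,T_h)\in\mathbf W_h\times S_h^0$ with $A_h(\mathbf u_h;\mathbf u_h,\mathbf v)-d_h(T_h,\mathbf v)=(\mathbf f,\mathbf v_0)_{\Omega_f}$ for all $\mathbf v\in\mathbf W_h$ and $\bar A_h(\mathbf u_h;T_h,s)=(g,s_0)_\Omega$ for all $s\in S_h^0$. *)

theory Defs
  imports "HOL-Analysis.Analysis"
begin

text \<open>A (closed) simplex is represented by its vertex set V; the element is convex hull V.\<close>

definition simplex_verts :: "(real^'n::finite) set \<Rightarrow> bool" where
  "simplex_verts V \<longleftrightarrow> finite V \<and> card V = CARD('n) + 1 \<and> \<not> affine_dependent V"

definition simplicial_triangulation :: "(real^'n::finite) set set \<Rightarrow> bool" where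
  "simplicial_triangulation T \<longleftrightarrow> finite T \<and> (\<forall>V\<in>T. simplex_verts V) \<and>
     (\<forall>V\<in>T. \<forall>W\<in>T. convex hull V \<inter> convex hull W = convex hull (V \<inter> W))"

definition region :: "(real^'n::finite) set set \<Rightarrow> (real^'n) set" where
  "region T = interior (\<Union>V\<in>T. convex hull V)"

definition faces :: "(real^'n::finite) set \<Rightarrow> (real^'n) set set" where
  "faces V = {V - {p} | p. p \<in> V}"

definition mesh_faces :: "(real^'n::finite) set set \<Rightarrow> (real^'n) set set" where
  "mesh_faces T = (\<Union>V\<in>T. faces V)"

definition onormal :: "(real^'n::finite) set \<Rightarrow> (real^'n) set \<Rightarrow> real^'n" where
  "onormal V e = (THE n. norm n = 1 \<and> (\<forall>p\<in>e. \<forall>q\<in>e. n \<bullet> (p - q) = 0) \<and>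
                        (\<forall>p\<in>e. \<forall>q\<in>V - e. n \<bullet> (q - p) < 0))"

definition hK :: "(real^'n::finite) set \<Rightarrow> real" where
  "hK V = diameter (convex hull V)"

definition eint :: "(real^'n::finite) set \<Rightarrow> (real^'n \<Rightarrow> real) \<Rightarrow> real" where
  "eint V f = integral (convex hull V) f"

text \<open>Integral over the flat face e (w.r.t. (d-1)-dimensional surface measure), written
  via Cavalieri/Fubini as the d-dimensional Lebesgue integral over the unit-height right
  prism over e of the function extended constantly along the unit normal n.\<close>
definition fint :: "(real^'n::finite) set \<Rightarrow> (real^'n) set \<Rightarrow> (real^'n \<Rightarrow> real) \<Rightarrow> real" where
  "fint V e f =
     (let n = onormal V e; p0 = (SOME p. p \<in> e) in
      integral {y + t *\<^sub>R n | y t. y \<in> convex hull e \<and> t \<in> {0..1}}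
               (\<lambda>x. f (x - ((x - p0) \<bullet> n) *\<^sub>R n)))"

definition monomial :: "('n::finite \<Rightarrow> nat) \<Rightarrow> real^'n \<Rightarrow> real" where
  "monomial \<alpha> x = (\<Prod>i\<in>UNIV. (x $ i) ^ (\<alpha> i))"

definition multi_indices :: "nat \<Rightarrow> ('n::finite \<Rightarrow> nat) set" where
  "multi_indices r = {\<alpha>. sum \<alpha> UNIV \<le> r}"

definition polys :: "nat \<Rightarrow> (real^'n::finite \<Rightarrow> real) set" where
  "polys r = {p. \<exists>c. p = (\<lambda>x. \<Sum>\<alpha>\<in>multi_indices r. c \<alpha> * monomial \<alpha> x)}"

definition vpolys :: "nat \<Rightarrow> (real^'n::finite \<Rightarrow> real^'n) set" where
  "vpolys r = {p. \<forall>i. (\<lambda>x. p x $ i) \<in> polys r}"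

definition partial :: "'n::finite \<Rightarrow> (real^'n \<Rightarrow> real) \<Rightarrow> real^'n \<Rightarrow> real" where
  "partial i f x = deriv (\<lambda>t. f (x + t *\<^sub>R axis i 1)) 0"

definition grad :: "(real^'n::finite \<Rightarrow> real) \<Rightarrow> real^'n \<Rightarrow> real^'n" where
  "grad f x = (\<chi> i. partial i f x)"

definition divg :: "(real^'n::finite \<Rightarrow> real^'n) \<Rightarrow> real^'n \<Rightarrow> real" where
  "divg \<tau> x = (\<Sum>i\<in>UNIV. partial i (\<lambda>y. \<tau> y $ i) x)"

definition wgrad :: "nat \<Rightarrow> (real^'n::finite) set \<Rightarrow> (real^'n \<Rightarrow> real) \<Rightarrow>
     ((real^'n) set \<Rightarrow> real^'n \<Rightarrow> real) \<Rightarrow> real^'n \<Rightarrow> real^'n" where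
  "wgrad r V v0 vb = (THE \<sigma>. \<sigma> \<in> vpolys r \<and>
     (\<forall>\<tau>\<in>vpolys r. eint V (\<lambda>x. \<sigma> x \<bullet> \<tau> x) =
        - eint V (\<lambda>x. v0 x * divg \<tau> x)
        + (\<Sum>e\<in>faces V. fint V e (\<lambda>x. vb e x * (\<tau> x \<bullet> onormal V e)))))"

definition wdiv :: "nat \<Rightarrow> (real^'n::finite) set \<Rightarrow> (real^'n \<Rightarrow> real^'n) \<Rightarrow>
     ((real^'n) set \<Rightarrow> real^'n \<Rightarrow> real^'n) \<Rightarrow> real^'n \<Rightarrow> real" where
  "wdiv r V w0 wb = (THE \<phi>. \<phi> \<in> polys r \<and>
     (\<forall>\<psi>\<in>polys r. eint V (\<lambda>x. \<phi> x * \<psi> x) =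
        - eint V (\<lambda>x. w0 x \<bullet> grad \<psi> x)
        + (\<Sum>e\<in>faces V. fint V e (\<lambda>x. (wb e x \<bullet> onormal V e) * \<psi> x))))"

text \<open>Q_l^b: L^2(e)-projection onto P_l(e); the result is represented by its values on e
  (and set to 0 off e).\<close>
definition qproj :: "nat \<Rightarrow> (real^'n::finite) set \<Rightarrow> (real^'n) set \<Rightarrow>
     (real^'n \<Rightarrow> real) \<Rightarrow> real^'n \<Rightarrow> real" where
  "qproj l V e f = (THE g. (\<exists>q\<in>polys l. \<forall>x\<in>convex hull e. g x = q x) \<and>
      (\<forall>x. x \<notin> convex hull e \<longrightarrow> g x = 0) \<and>
      (\<forall>p\<in>polys l. fint V e (\<lambda>x. (f x - g x) * p x) = 0))"

definition stab :: "nat \<Rightarrow> (real^'n::finite) set \<Rightarrow> (real^'n \<Rightarrow> real) \<Rightarrow>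
     ((real^'n) set \<Rightarrow> real^'n \<Rightarrow> real) \<Rightarrow> (real^'n \<Rightarrow> real) \<Rightarrow>
     ((real^'n) set \<Rightarrow> real^'n \<Rightarrow> real) \<Rightarrow> real" where
  "stab l V u0 ub v0 vb = (\<Sum>e\<in>faces V. (1 / hK V) *
      fint V e (\<lambda>x. (qproj l V e u0 x - ub e x) * (qproj l V e v0 x - vb e x)))"

text \<open>A scalar weak function is a pair (s0, sb): s0 K is the polynomial on element K,
  sb e the polynomial on face e. Vector weak functions analogously.\<close>
type_synonym 'n sfun = "((real^'n) set \<Rightarrow> real^'n \<Rightarrow> real) \<times> ((real^'n) set \<Rightarrow> real^'n \<Rightarrow> real)"
type_synonym 'n vfun = "((real^'n) set \<Rightarrow> real^'n \<Rightarrow> real^'n) \<times> ((real^'n) set \<Rightarrow> real^'n \<Rightarrow> real^'n)"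

text \<open>V_h^0 (extended by zero to Omega_s).\<close>
definition Vh0 :: "nat \<Rightarrow> nat \<Rightarrow> (real^'n::finite) set set \<Rightarrow> 'n vfun set" where
  "Vh0 k l Tf = {(v0, vb).
     (\<forall>V\<in>Tf. v0 V \<in> vpolys k) \<and> (\<forall>V. V \<notin> Tf \<longrightarrow> v0 V = (\<lambda>_. 0)) \<and>
     (\<forall>e\<in>mesh_faces Tf. vb e \<in> vpolys l) \<and> (\<forall>e. e \<notin> mesh_faces Tf \<longrightarrow> vb e = (\<lambda>_. 0)) \<and>
     (\<forall>e\<in>mesh_faces Tf. convex hull e \<subseteq> frontier (region Tf) \<longrightarrow>
         (\<forall>x\<in>convex hull e. vb e x = 0))}"

definition Qh0 :: "nat \<Rightarrow> (real^'n::finite) set set \<Rightarrow> 'n sfun set" where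
  "Qh0 k Tf = {(q0, qb).
     (\<forall>V\<in>Tf. q0 V \<in> polys (k - 1)) \<and> (\<forall>e\<in>mesh_faces Tf. qb e \<in> polys k) \<and>
     (\<Sum>V\<in>Tf. eint V (q0 V)) = 0}"

definition Sh0 :: "nat \<Rightarrow> nat \<Rightarrow> (real^'n::finite) set set \<Rightarrow> 'n sfun set" where
  "Sh0 k l T = {(s0, sb).
     (\<forall>V\<in>T. s0 V \<in> polys k) \<and> (\<forall>e\<in>mesh_faces T. sb e \<in> polys l) \<and>
     (\<forall>e\<in>mesh_faces T. convex hull e \<subseteq> frontier (region T) \<longrightarrow>
         (\<forall>x\<in>convex hull e. sb e x = 0))}"

definition vcomp :: "'n::finite \<Rightarrow> 'n vfun \<Rightarrow> 'n sfun" where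
  "vcomp i v = ((\<lambda>V x. fst v V x $ i), (\<lambda>e x. snd v e x $ i))"

definition ah :: "nat \<Rightarrow> nat \<Rightarrow> real \<Rightarrow> (real^'n::finite) set set \<Rightarrow> 'n vfun \<Rightarrow> 'n vfun \<Rightarrow> real" where
  "ah m l Pr Tf u v =
     Pr * (\<Sum>V\<in>Tf. \<Sum>i\<in>UNIV. eint V (\<lambda>x.
        wgrad m V (fst (vcomp i u) V) (snd (vcomp i u)) x \<bullet>
        wgrad m V (fst (vcomp i v) V) (snd (vcomp i v)) x))
   + Pr * (\<Sum>V\<in>Tf. \<Sum>i\<in>UNIV.
        stab l V (fst (vcomp i u) V) (snd (vcomp i u)) (fst (vcomp i v) V) (snd (vcomp i v)))"

definition bh :: "nat \<Rightarrow> (real^'n::finite) set set \<Rightarrow> 'n vfun \<Rightarrow> 'n sfun \<Rightarrow> real" where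
  "bh k Tf v q = (\<Sum>V\<in>Tf. eint V (\<lambda>x. wgrad k V (fst q V) (snd q) x \<bullet> fst v V x))"

definition dh :: "'n::finite \<Rightarrow> real \<Rightarrow> real \<Rightarrow> (real^'n) set set \<Rightarrow> 'n sfun \<Rightarrow> 'n vfun \<Rightarrow> real" where
  "dh jd Pr Ra Tf T v = Pr * Ra * (\<Sum>V\<in>Tf. eint V (\<lambda>x. fst T V x * (fst v V x $ jd)))"

definition abar :: "nat \<Rightarrow> nat \<Rightarrow> real \<Rightarrow> (real^'n::finite) set set \<Rightarrow> 'n sfun \<Rightarrow> 'n sfun \<Rightarrow> real" where
  "abar m l \<kappa> Th T s =
     \<kappa> * (\<Sum>V\<in>Th. eint V (\<lambda>x. wgrad m V (fst T V) (snd T) x \<bullet> wgrad m V (fst s V) (snd s) x))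
   + \<kappa> * (\<Sum>V\<in>Th. stab l V (fst T V) (snd T) (fst s V) (snd s))"

definition wdiv_tensor :: "nat \<Rightarrow> (real^'n::finite) set \<Rightarrow> 'n vfun \<Rightarrow> 'n vfun \<Rightarrow> real^'n \<Rightarrow> real^'n" where
  "wdiv_tensor k V u w x = (\<chi> i. wdiv k V (\<lambda>y. (fst u V y $ i) *\<^sub>R fst w V y)
                                         (\<lambda>e y. (snd u e y $ i) *\<^sub>R snd w e y) x)"

definition ch :: "nat \<Rightarrow> (real^'n::finite) set set \<Rightarrow> 'n vfun \<Rightarrow> 'n vfun \<Rightarrow> 'n vfun \<Rightarrow> real" where
  "ch k Tf w u v =
     (1/2) * (\<Sum>V\<in>Tf. eint V (\<lambda>x. wdiv_tensor k V u w x \<bullet> fst v V x))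
   - (1/2) * (\<Sum>V\<in>Tf. eint V (\<lambda>x. wdiv_tensor k V v w x \<bullet> fst u V x))"

definition wdiv_scal :: "nat \<Rightarrow> (real^'n::finite) set \<Rightarrow> 'n vfun \<Rightarrow> 'n sfun \<Rightarrow> real^'n \<Rightarrow> real" where
  "wdiv_scal k V w s x = wdiv k V (\<lambda>y. fst s V y *\<^sub>R fst w V y) (\<lambda>e y. snd s e y *\<^sub>R snd w e y) x"

definition cbar :: "nat \<Rightarrow> (real^'n::finite) set set \<Rightarrow> 'n vfun \<Rightarrow> 'n sfun \<Rightarrow> 'n sfun \<Rightarrow> real" where
  "cbar k Th w T s =
     (1/2) * (\<Sum>V\<in>Th. eint V (\<lambda>x. wdiv_scal k V w T x * fst s V x))
   - (1/2) * (\<Sum>V\<in>Th. eint V (\<lambda>x. wdiv_scal k V w s x * fst T V x))"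

definition Ah :: "nat \<Rightarrow> nat \<Rightarrow> nat \<Rightarrow> real \<Rightarrow> (real^'n::finite) set set \<Rightarrow> 'n vfun \<Rightarrow> 'n vfun \<Rightarrow> 'n vfun \<Rightarrow> real" where
  "Ah k l m Pr Tf w u v = ah m l Pr Tf u v + ch k Tf w u v"

definition Abar :: "nat \<Rightarrow> nat \<Rightarrow> nat \<Rightarrow> real \<Rightarrow> (real^'n::finite) set set \<Rightarrow> 'n vfun \<Rightarrow> 'n sfun \<Rightarrow> 'n sfun \<Rightarrow> real" where
  "Abar k l m \<kappa> Th w T s = abar m l \<kappa> Th T s + cbar k Th w T s"

definition Wh :: "nat \<Rightarrow> nat \<Rightarrow> (real^'n::finite) set set \<Rightarrow> 'n vfun set" where
  "Wh k l Tf = {w \<in> Vh0 k l Tf. \<forall>q\<in>Qh0 k Tf. bh k Tf w q = 0}"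

definition L2_on :: "(real^'n::finite) set \<Rightarrow> (real^'n \<Rightarrow> 'b::euclidean_space) \<Rightarrow> bool" where
  "L2_on D f \<longleftrightarrow> f measurable_on D \<and> (\<lambda>x. norm (f x) ^ 2) integrable_on D"

end

theory Submission
  imports Defs "HOL-Homology.Homology" "HOL-Library.Function_Algebras" "HOL-Computational_Algebra.Polynomial"
begin

text \<open>Skew symmetry of the convection terms makes the weighted energy of (u, T) an a priori bound:
  tested with its own argument, the nonlinear system is positive on a large sphere, and a continuous map of
  R^N with this property has a zero because spheres are not contractible. The substance is coercivity
  of the energy. If the energy of s vanishes, integration by parts on each simplex shows that s is constant on each
  element, with matching face values. A nonzero constant c is impossible: the flux of the field x out of all elements
  where s = c cancels in pairs across shared faces, but equals d times the volume of these elements.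
  Integration by parts is derived from Tonelli's theorem along the edges of a simplex.\<close>

text \<open>The discrete spaces consist of functions on all of space, indexed by arbitrary sets.
  They carry no convenient norm, and face components that differ only off their face are different
  vectors. So the energy is handled as a semidefinite form on a finitely generated space:
  orthonormal systems are taken modulo its kernel, all other terms vanish when tested with the
  kernel, and topology enters only through the N coordinates. Buoyancy has no sign. With finitely
  many coordinates, its vanishing on both kernels already bounds it by a constant M times the
  product of the energy norms, which takes the place of a discrete Poincare inequality. M need not
  be small, but buoyancy enters the momentum equation alone, so multiplying the temperature equation
  by M^2 + 1 leaves the solutions unchanged and makes the coupled form coercive. Weak gradient, weak
  divergence and face projection are definite descriptions. Each is a Riesz representative in a
  space of polynomials, which is why definiteness of the element and face integrals is needed before
  anything can be said about them.\<close>

instantiation "fun" :: (type, real_vector) real_vector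
begin

definition "c *\<^sub>R f = (\<lambda>x. c *\<^sub>R f x)"

instance
  by standard (simp_all add: scaleR_fun_def fun_eq_iff scaleR_right_distrib scaleR_left_distrib)

end

lemma scaleR_fun_apply [simp]: "(c *\<^sub>R f) x = c *\<^sub>R f x"
  by (simp add: scaleR_fun_def)

lemma sum_fun_apply: "(\<Sum>i\<in>I. f i) x = (\<Sum>i\<in>I. f i x :: 'a::comm_monoid_add)"
  by (induction I rule: infinite_finite_induct) auto

section \<open>Zeros of coercive maps\<close>

text \<open>Division by the Euclidean norm, which never vanishes on the cylinder, turns a homotopy
  of vector-valued maps into one of the sphere into itself. Coordinates beyond n are set to 0
  because the sphere sits in \<open>nat \<Rightarrow> real\<close>.\<close>

lemma homotopic_normalized:
  fixes f :: "real \<times> (nat \<Rightarrow> real) \<Rightarrow> nat \<Rightarrow> real"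
  assumes cont: "\<And>i. i \<le> n \<Longrightarrow> continuous_on UNIV (\<lambda>z. f z i)"
    and ne: "\<And>t x. t \<in> {0..1} \<Longrightarrow> x \<in> S \<Longrightarrow> (\<Sum>i\<le>n. (f (t,x) i)\<^sup>2) > 0"
    and S: "S = {x. (\<Sum>i\<le>n. (x i)\<^sup>2) = 1 \<and> (\<forall>i>n. x i = 0)}"
  defines "N \<equiv> \<lambda>z i. if i \<le> n then f z i / sqrt (\<Sum>i\<le>n. (f z i)\<^sup>2) else 0"
  shows "homotopic_with_canon (\<lambda>_. True) S S (\<lambda>x. N (0,x)) (\<lambda>x. N (1,x))"
proof -
  have "continuous_on ({0..1} \<times> S) N"
  proof (rule continuous_on_coordinatewise_then_product)
    fix i
    have c: "continuous_on ({0..1} \<times> S) (\<lambda>z. f z i)" if "i \<le> n" for i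
      using cont[OF that] continuous_on_subset by blast
    show "continuous_on ({0..1} \<times> S) (\<lambda>z. N z i)"
    proof (cases "i \<le> n")
      case True
      have "sqrt (\<Sum>i\<le>n. (f z i)\<^sup>2) \<noteq> 0" if "z \<in> {0..1} \<times> S" for z
        using ne[of "fst z" "snd z"] that by auto
      then show ?thesis
        unfolding N_def using True by (auto intro!: continuous_intros c)
    next
      case False
      then show ?thesis by (simp add: N_def)
    qed
  qed
  moreover have "N (t,x) \<in> S" if "t \<in> {0..1}" "x \<in> S" for t x
  proof -
    have p: "(\<Sum>i\<le>n. (f (t,x) i)\<^sup>2) > 0" using ne that by auto
    then have "(\<Sum>i\<le>n. (N (t,x) i)\<^sup>2) = (\<Sum>i\<le>n. (f (t,x) i)\<^sup>2 / (\<Sum>i\<le>n. (f (t,x) i)\<^sup>2))"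
      by (intro sum.cong) (auto simp: N_def power_divide)
    also have "\<dots> = 1" using p by (simp flip: sum_divide_distrib)
    finally show ?thesis by (auto simp: S N_def)
  qed
  ultimately show ?thesis
    unfolding homotopic_with_def
    by (intro exI[of _ N]) (auto simp: prod_topology_subtopology_eu image_subset_iff)
qed

text \<open>The finite-dimensional lemma behind Galerkin existence proofs. Vectors of R^N are
  sequences padded with zeros, the model in which \<open>nsphere\<close> is defined.\<close>

lemma coercive_map_has_zero:
  fixes F :: "nat \<Rightarrow> (nat \<Rightarrow> real) \<Rightarrow> real"
  assumes cont: "\<And>i. i < N \<Longrightarrow> continuous_on UNIV (F i)" and R: "R > 0"
    and pos: "\<And>x. (\<forall>i\<ge>N. x i = 0) \<Longrightarrow> (\<Sum>i<N. (x i)\<^sup>2) = R\<^sup>2 \<Longrightarrow> (\<Sum>i<N. F i x * x i) > 0"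
  shows "\<exists>x. (\<forall>i\<ge>N. x i = 0) \<and> (\<forall>i<N. F i x = 0)"
proof (cases N)
  case 0
  then show ?thesis by (intro exI[of _ "\<lambda>_. 0"]) auto
next
  case (Suc n)
  \<comment> \<open>The unit sphere of R^N with N = Suc n is \<open>nsphere n\<close>, whose
    coordinates run from 0 to n inclusive; for N = 0 there is no sphere and nothing to
    solve.\<close>
  have lt: "{..<N} = {..n}" using Suc by auto
  define S where "S = {x::nat\<Rightarrow>real. (\<Sum>i\<le>n. (x i)\<^sup>2) = 1 \<and> (\<forall>i>n. x i = 0)}"
  have nS: "nsphere n = top_of_set S"
    unfolding nsphere Euclidean_space_def S_def subtopology_subtopology euclidean_product_topology
    by (rule arg_cong[where f="subtopology euclidean"]) (auto simp: Suc_le_eq)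
  show ?thesis
  proof (rule ccontr)
    assume "\<not> ?thesis"
    then have nz: "\<exists>i\<le>n. F i x \<noteq> 0" if "\<forall>i>n. x i = 0" for x
      using that Suc by (metis Suc_le_eq less_Suc_eq_le)
    define f where "f = (\<lambda>(t::real,x::nat\<Rightarrow>real) i. (1 - t) * x i + t * F i (\<lambda>j. R * x j))"
    define g where "g = (\<lambda>(t::real,x::nat\<Rightarrow>real) i. F i (\<lambda>j. (1 - t) * R * x j))"
    have cF: "continuous_on UNIV (\<lambda>z. F i (h z))" if "i \<le> n" "\<And>j. continuous_on UNIV (\<lambda>z. h z j)"
      for i and h :: "real \<times> (nat \<Rightarrow> real) \<Rightarrow> nat \<Rightarrow> real"
      using continuous_on_compose2[OF cont[of i] continuous_on_coordinatewise_then_product[OF that(2)]]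
        that(1) Suc by auto
    have cc: "continuous_on UNIV (\<lambda>z::real \<times> (nat \<Rightarrow> real). snd z j)" for j
      using continuous_on_compose2[OF continuous_on_product_coordinates[of j] continuous_on_snd[OF continuous_on_id[of UNIV]]]
      by auto
    have cf: "continuous_on UNIV (\<lambda>z. f z i)" if "i \<le> n" for i
      unfolding f_def case_prod_unfold
      by (intro continuous_intros cF that cc)
    have cg: "continuous_on UNIV (\<lambda>z. g z i)" if "i \<le> n" for i
      unfolding g_def case_prod_unfold
      by (intro continuous_intros cF that cc)
    have sqpos: "(\<Sum>i\<le>n. (h i)\<^sup>2) > 0" if ex: "\<exists>i\<le>n. h i \<noteq> 0" for h :: "nat \<Rightarrow> real"
    proof -
      obtain i where i: "i \<le> n" "h i \<noteq> 0" using ex by blast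
      then have "0 < (h i)\<^sup>2" by simp
      also have "\<dots> \<le> (\<Sum>i\<le>n. (h i)\<^sup>2)" using i by (intro member_le_sum) auto
      finally show ?thesis .
    qed
    have fne: "(\<Sum>i\<le>n. (f (t,x) i)\<^sup>2) > 0" if t: "t \<in> {0..1}" and x: "x \<in> S" for t x
    proof (rule sqpos, rule ccontr)
      assume "\<not> (\<exists>i\<le>n. f (t, x) i \<noteq> 0)"
      then have "(\<Sum>i\<le>n. f (t, x) i * x i) = 0" by auto
      moreover have "(\<Sum>i\<le>n. f (t, x) i * x i) =
          (\<Sum>i\<le>n. (1 - t) * (x i)\<^sup>2 + t * (F i (\<lambda>j. R * x j) * x i))"
        unfolding f_def by (intro sum.cong) (auto simp: algebra_simps power2_eq_square)
      then have "(\<Sum>i\<le>n. f (t, x) i * x i) =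
          (1 - t) * (\<Sum>i\<le>n. (x i)\<^sup>2) + t * (\<Sum>i\<le>n. F i (\<lambda>j. R * x j) * x i)"
        by (simp only: sum.distrib sum_distrib_left)
      moreover have "(\<Sum>i\<le>n. F i (\<lambda>j. R * x j) * x i) > 0"
      proof -
        have "(\<Sum>i<N. (R * x i)\<^sup>2) = R\<^sup>2 * (\<Sum>i\<le>n. (x i)\<^sup>2)"
          unfolding lt by (simp add: power_mult_distrib sum_distrib_left)
        then have "(\<Sum>i<N. F i (\<lambda>j. R * x j) * (R * x i)) > 0"
          using x Suc by (intro pos) (auto simp: S_def)
        also have "(\<Sum>i<N. F i (\<lambda>j. R * x j) * (R * x i)) = R * (\<Sum>i\<le>n. F i (\<lambda>j. R * x j) * x i)"
          unfolding lt by (simp add: sum_distrib_left mult_ac)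
        finally show ?thesis using R by (simp add: zero_less_mult_iff)
      qed
      moreover have "(\<Sum>i\<le>n. (x i)\<^sup>2) = 1" using x by (simp add: S_def)
      ultimately obtain p where p: "(1 - t) + t * p = 0" "p > 0" by fastforce
      show False
      proof (cases "t = 0")
        case True with p show ?thesis by simp
      next
        case False
        then have "t * p > 0" using t p by simp
        then show ?thesis using t p by simp
      qed
    qed
    \<comment> \<open>The absence of zeros is used on the whole ball of radius R here, not only on
      its boundary.\<close>
    have gne: "(\<Sum>i\<le>n. (g (t,x) i)\<^sup>2) > 0" if t: "t \<in> {0..1}" and x: "x \<in> S" for t x
      unfolding g_def using nz[of "\<lambda>j. (1 - t) * R * x j"] x by (intro sqpos) (auto simp: S_def)
    (* x is deformed to F (R x) / |F (R x)| along a segment avoiding 0 as F (R x) . x > 0, and then to a constant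
       by shrinking the radius. *)
    let ?N = "\<lambda>f (z::real \<times> (nat \<Rightarrow> real)) i. if i \<le> n then f z i / sqrt (\<Sum>i\<le>n. (f z i)\<^sup>2) else 0"
    have h1: "homotopic_with_canon (\<lambda>_. True) S S (\<lambda>x. ?N f (0,x)) (\<lambda>x. ?N f (1,x))"
      by (rule homotopic_normalized[OF cf fne S_def])
    have h2: "homotopic_with_canon (\<lambda>_. True) S S (\<lambda>x. ?N g (0,x)) (\<lambda>x. ?N g (1,x))"
      by (rule homotopic_normalized[OF cg gne S_def])
    have e1: "?N f (0,x) = id x" if "x \<in> S" for x
      using that by (auto simp: f_def S_def fun_eq_iff)
    have e2: "?N f (1,x) = ?N g (0,x)" for x
      by (auto simp: f_def g_def fun_eq_iff)
    have e3: "(\<lambda>x. ?N g (1,x)) = (\<lambda>x. ?N g (1,\<lambda>_. 0))"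
      by (auto simp: g_def fun_eq_iff)
    have "homotopic_with_canon (\<lambda>_. True) S S (\<lambda>x. ?N f (0,x)) (\<lambda>x. ?N g (1,x))"
      using homotopic_with_trans[OF h1[unfolded e2] h2] .
    then have "homotopic_with_canon (\<lambda>_. True) S S id (\<lambda>x. ?N g (1,x))"
      by (rule homotopic_with_eq) (use e1 in auto)
    then have "contractible_space (nsphere n)"
      unfolding nS contractible_space_def by (subst (asm) e3) blast
    then show False using non_contractible_space_nsphere by blast
  qed
qed

section \<open>Symmetric forms on finitely generated subspaces\<close>

text \<open>Linearity relative to a set: operators defined by \<open>THE\<close> are shown to be
  linear only for continuous arguments, so a global notion would not apply to them.\<close>

definition lin_on :: "'a::real_vector set \<Rightarrow> ('a \<Rightarrow> 'b::real_vector) \<Rightarrow> bool" where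
  "lin_on W f \<longleftrightarrow> (\<forall>x\<in>W. \<forall>y\<in>W. f (x + y) = f x + f y) \<and> (\<forall>x\<in>W. \<forall>c. f (c *\<^sub>R x) = c *\<^sub>R f x)"

definition bilin_on :: "'a::real_vector set \<Rightarrow> 'b::real_vector set \<Rightarrow> ('a \<Rightarrow> 'b \<Rightarrow> 'c::real_vector) \<Rightarrow> bool" where
  "bilin_on W W' f \<longleftrightarrow> (\<forall>y\<in>W'. lin_on W (\<lambda>x. f x y)) \<and> (\<forall>x\<in>W. lin_on W' (f x))"

lemma lin_onI:
  "(\<And>x y. x \<in> W \<Longrightarrow> y \<in> W \<Longrightarrow> f (x + y) = f x + f y) \<Longrightarrow>
   (\<And>c x. x \<in> W \<Longrightarrow> f (c *\<^sub>R x) = c *\<^sub>R f x) \<Longrightarrow> lin_on W f"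
  by (auto simp: lin_on_def)

lemma lin_onD:
  assumes "lin_on W f"
  shows "x \<in> W \<Longrightarrow> y \<in> W \<Longrightarrow> f (x + y) = f x + f y" "x \<in> W \<Longrightarrow> f (c *\<^sub>R x) = c *\<^sub>R f x"
  using assms by (auto simp: lin_on_def)

lemma lin_on_subset: "lin_on W f \<Longrightarrow> U \<subseteq> W \<Longrightarrow> lin_on U f"
  by (simp add: lin_on_def subset_iff)

lemma bilin_on_subset: "bilin_on W W' f \<Longrightarrow> U \<subseteq> W \<Longrightarrow> U' \<subseteq> W' \<Longrightarrow> bilin_on U U' f"
  by (auto simp: bilin_on_def lin_on_def subset_iff)

lemma bilin_onD:
  assumes "bilin_on W W' f"
  shows "y \<in> W' \<Longrightarrow> lin_on W (\<lambda>x. f x y)" "x \<in> W \<Longrightarrow> lin_on W' (f x)"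
  using assms by (auto simp: bilin_on_def)

lemma lin_on_zero: "lin_on W f \<Longrightarrow> subspace W \<Longrightarrow> f 0 = 0"
  using lin_onD(2)[of W f 0 0] subspace_0[of W] by auto

lemma lin_on_diff: "lin_on W f \<Longrightarrow> subspace W \<Longrightarrow> x \<in> W \<Longrightarrow> y \<in> W \<Longrightarrow> f (x - y) = f x - f y"
  using lin_onD(1)[of W f x "(-1) *\<^sub>R y"] lin_onD(2)[of W f y "-1"] subspace_scale[of W y "-1"] by auto

lemma lin_on_sum:
  assumes "lin_on W f" "subspace W" "\<And>i. i \<in> I \<Longrightarrow> g i \<in> W"
  shows "f (\<Sum>i\<in>I. c i *\<^sub>R g i) = (\<Sum>i\<in>I. c i *\<^sub>R f (g i))"
proof -
  have "(\<Sum>i\<in>I. c i *\<^sub>R g i) \<in> W \<and> f (\<Sum>i\<in>I. c i *\<^sub>R g i) = (\<Sum>i\<in>I. c i *\<^sub>R f (g i))"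
    using assms(3)
  proof (induction I rule: infinite_finite_induct)
    case (insert i I)
    then show ?case using assms(1,2)
      by (simp add: lin_onD subspace_add subspace_scale)
  qed (use assms in \<open>auto simp: lin_on_zero subspace_0\<close>)
  then show ?thesis by blast
qed

lemma lin_on_compose: "lin_on W' f \<Longrightarrow> lin_on W g \<Longrightarrow> (\<And>x. x \<in> W \<Longrightarrow> g x \<in> W') \<Longrightarrow> lin_on W (\<lambda>x. f (g x))"
  by (simp add: lin_on_def)

lemma lin_on_add: "lin_on W f \<Longrightarrow> lin_on W g \<Longrightarrow> lin_on W (\<lambda>x. f x + g x)"
  by (simp add: lin_on_def algebra_simps)

lemma lin_on_cmult: "lin_on W f \<Longrightarrow> lin_on W (\<lambda>x. c * f x)" for f :: "'a::real_vector \<Rightarrow> real"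
  by (simp add: lin_on_def algebra_simps)

lemma lin_on_uminus: "lin_on W f \<Longrightarrow> lin_on W (\<lambda>x. - f x)"
  by (simp add: lin_on_def)

lemma lin_on_sum': "(\<And>i. i \<in> I \<Longrightarrow> lin_on W (f i)) \<Longrightarrow> lin_on W (\<lambda>x. \<Sum>i\<in>I. f i x)"
  by (auto simp: lin_on_def sum.distrib scaleR_sum_right intro!: sum.cong)

lemma bilin_on_compose:
  "bilin_on U U' f \<Longrightarrow> lin_on W g \<Longrightarrow> lin_on W' h \<Longrightarrow> (\<And>x. x \<in> W \<Longrightarrow> g x \<in> U) \<Longrightarrow> (\<And>x. x \<in> W' \<Longrightarrow> h x \<in> U') \<Longrightarrow>
   bilin_on W W' (\<lambda>x y. f (g x) (h y))"
  by (auto simp: bilin_on_def intro: lin_on_compose[of U _ W g] lin_on_compose[of U' _ W' h])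

lemma bilin_on_add: "bilin_on W W' f \<Longrightarrow> bilin_on W W' g \<Longrightarrow> bilin_on W W' (\<lambda>x y. f x y + g x y)"
  by (simp add: bilin_on_def lin_on_add)

lemma bilin_on_cmult: "bilin_on W W' f \<Longrightarrow> bilin_on W W' (\<lambda>x y. c * f x y)" for f :: "'a::real_vector \<Rightarrow> 'b::real_vector \<Rightarrow> real"
  by (simp add: bilin_on_def lin_on_cmult)

lemma bilin_on_sum: "(\<And>i. i \<in> I \<Longrightarrow> bilin_on W W' (f i)) \<Longrightarrow> bilin_on W W' (\<lambda>x y. \<Sum>i\<in>I. f i x y)"
  by (simp add: bilin_on_def lin_on_sum')

lemma lin_on_fst: "lin_on W fst" and lin_on_snd: "lin_on W snd"
  by (simp_all add: lin_on_def)

lemma lin_on_apply: "lin_on W f \<Longrightarrow> lin_on W (\<lambda>s. f s x)"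
  by (simp add: lin_on_def)

lemma bilin_on_symI:
  assumes "\<And>x y. a x y = a y x" "\<And>y. y \<in> W \<Longrightarrow> lin_on W (\<lambda>x. a x y)"
  shows "bilin_on W W a"
  unfolding bilin_on_def
proof (intro conjI ballI)
  show "lin_on W (a x)" if "x \<in> W" for x
    using assms(2)[OF that] unfolding assms(1)[of _ x] .
qed (rule assms(2))

locale psd_form =
  fixes W :: "'a::real_vector set" and a :: "'a \<Rightarrow> 'a \<Rightarrow> real"
  assumes sub: "subspace W" and bil: "bilin_on W W a"
    and sym: "\<And>x y. x \<in> W \<Longrightarrow> y \<in> W \<Longrightarrow> a x y = a y x"
    and psd: "\<And>x. x \<in> W \<Longrightarrow> a x x \<ge> 0"
begin

lemma add_l: "x \<in> W \<Longrightarrow> y \<in> W \<Longrightarrow> z \<in> W \<Longrightarrow> a (x + y) z = a x z + a y z"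
  using lin_onD(1)[OF bilin_onD(1)[OF bil, of z], of x y] by simp

lemma add_r: "x \<in> W \<Longrightarrow> y \<in> W \<Longrightarrow> z \<in> W \<Longrightarrow> a z (x + y) = a z x + a z y"
  using lin_onD(1)[OF bilin_onD(2)[OF bil, of z], of x y] by simp

lemma scale_l: "x \<in> W \<Longrightarrow> z \<in> W \<Longrightarrow> a (c *\<^sub>R x) z = c * a x z"
  using lin_onD(2)[OF bilin_onD(1)[OF bil, of z], of x c] by simp

lemma scale_r: "x \<in> W \<Longrightarrow> z \<in> W \<Longrightarrow> a z (c *\<^sub>R x) = c * a z x"
  using lin_onD(2)[OF bilin_onD(2)[OF bil, of z], of x c] by simp

lemma diff_l: "x \<in> W \<Longrightarrow> y \<in> W \<Longrightarrow> z \<in> W \<Longrightarrow> a (x - y) z = a x z - a y z"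
  using lin_on_diff[OF bilin_onD(1)[OF bil, of z] sub, of x y] by simp

lemma sum_l: "(\<And>i. i \<in> I \<Longrightarrow> g i \<in> W) \<Longrightarrow> z \<in> W \<Longrightarrow> a (\<Sum>i\<in>I. c i *\<^sub>R g i) z = (\<Sum>i\<in>I. c i * a (g i) z)"
  using lin_on_sum[OF bilin_onD(1)[OF bil, of z] sub, of I g c] by simp

lemma sum_mem: "(\<And>i. i \<in> I \<Longrightarrow> g i \<in> W) \<Longrightarrow> (\<Sum>i\<in>I. c i *\<^sub>R g i) \<in> W"
  by (intro subspace_sum sub subspace_scale)

text \<open>When \<open>a x x = 0\<close>, the energy of t x + y is affine in t; being nonnegative
  for every t, it has slope zero.\<close>

lemma null_orth:
  assumes x: "x \<in> W" "a x x = 0" and y: "y \<in> W"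
  shows "a x y = 0"
proof (rule ccontr)
  assume n: "a x y \<noteq> 0"
  \<comment> \<open>The parameter at which this affine function takes the value -1.\<close>
  define t where "t = - (a y y + 1) / (2 * a x y)"
  have "0 \<le> a (t *\<^sub>R x + y) (t *\<^sub>R x + y)"
    using x y sub by (intro psd) (simp add: subspace_add subspace_scale)
  also have "\<dots> = t * t * a x x + 2 * t * a x y + a y y"
    using x(1) y sub by (simp add: add_l add_r scale_l scale_r sym[of y x] subspace_scale subspace_add algebra_simps)
  also have "\<dots> = -1" using n x by (simp add: t_def field_simps)
  finally show False by simp
qed

end

locale fin_psd_form = psd_form +
  assumes fin_gen: "\<exists>S. finite S \<and> W \<subseteq> span S"
begin

text \<open>An orthonormal basis of the quotient of W by the kernel of \<open>a\<close>, expressed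
  through representatives: expansions are exact up to a vector of zero energy.\<close>

definition onb :: "'a set \<Rightarrow> bool" where
  "onb B \<longleftrightarrow> finite B \<and> B \<subseteq> W \<and> (\<forall>b\<in>B. \<forall>c\<in>B. a b c = (if b = c then 1 else 0)) \<and>
     (\<forall>w\<in>W. \<exists>r\<in>W. a r r = 0 \<and> w = (\<Sum>b\<in>B. a w b *\<^sub>R b) + r)"

lemma onbD:
  assumes "onb B"
  shows "finite B" "B \<subseteq> W" "b \<in> B \<Longrightarrow> c \<in> B \<Longrightarrow> a b c = (if b = c then 1 else 0)"
    "w \<in> W \<Longrightarrow> \<exists>r\<in>W. a r r = 0 \<and> w = (\<Sum>b\<in>B. a w b *\<^sub>R b) + r"
  using assms unfolding onb_def by blast+

text \<open>Orthonormal vectors are independent, so their number is bounded by the number of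
  generators and a system of maximal size exists. A remainder of positive energy could be normalized
  and added to it, so all remainders have zero energy.\<close>

lemma onb_exists: "\<exists>B. onb B"
proof -
  obtain S where S: "finite S" "W \<subseteq> span S" using fin_gen by blast
  define ON where "ON B \<longleftrightarrow> finite B \<and> B \<subseteq> W \<and> (\<forall>b\<in>B. \<forall>c\<in>B. a b c = (if b = c then 1 else 0))" for B
  have coord: "a (\<Sum>b\<in>B. u b *\<^sub>R b) c = u c" if B: "ON B" and c: "c \<in> B" for B u c
  proof -
    have "a (\<Sum>b\<in>B. u b *\<^sub>R b) c = (\<Sum>b\<in>B. u b * a b c)" using B c by (intro sum_l) (auto simp: ON_def)
    also have "\<dots> = u c"
      using B c by (simp add: ON_def if_distrib[of "(*) _"] sum.delta cong: if_cong)
    finally show ?thesis .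
  qed
  have bound: "card B \<le> card S" if B: "ON B" for B
  proof -
    have "independent B"
    proof
      assume "dependent B"
      then obtain u v where u: "v \<in> B" "u v \<noteq> 0" "(\<Sum>b\<in>B. u b *\<^sub>R b) = 0"
        using dependent_finite[of B] B by (auto simp: ON_def)
      then have "v \<in> W" using B by (auto simp: ON_def)
      then show False using coord[OF B u(1), of u] u lin_on_zero[OF bilin_onD(1)[OF bil] sub] by simp
    qed
    then show ?thesis using independent_span_bound[OF S(1)] B S(2) by (auto simp: ON_def)
  qed
  have "ON {}" by (simp add: ON_def)
  then obtain B where B: "ON B" "\<And>C. ON C \<Longrightarrow> card C \<le> card B"
    using ex_has_greatest_nat[of ON "{}" card "Suc (card S)"] bound by (auto simp: less_Suc_eq_le)
  have BW: "finite B" "B \<subseteq> W" using B by (auto simp: ON_def)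
  have "\<exists>r\<in>W. a r r = 0 \<and> w = (\<Sum>b\<in>B. a w b *\<^sub>R b) + r" if w: "w \<in> W" for w
  proof (intro bexI conjI)
    define r where "r = w - (\<Sum>b\<in>B. a w b *\<^sub>R b)"
    have sW: "(\<Sum>b\<in>B. a w b *\<^sub>R b) \<in> W" using BW by (intro sum_mem) auto
    then show r: "r \<in> W" unfolding r_def by (intro subspace_diff sub w)
    have orth: "a r c = 0" "a c r = 0" if c: "c \<in> B" for c
    proof -
      have "c \<in> W" using BW c by auto
      then show "a r c = 0" unfolding r_def using diff_l[OF w sW] coord[OF B(1) c] by simp
      then show "a c r = 0" using sym[OF \<open>c \<in> W\<close> r] by simp
    qed
    show "a r r = 0"
    proof (rule ccontr)
      assume "a r r \<noteq> 0"
      then have rp: "a r r > 0" using psd[OF r] by simp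
      define e where "e = (1 / sqrt (a r r)) *\<^sub>R r"
      have eW: "e \<in> W" using r sub by (simp add: e_def subspace_scale)
      have ee: "a e e = 1" unfolding e_def using r rp eW[unfolded e_def] by (simp add: scale_l scale_r field_simps)
      have eB: "a e c = 0" "a c e = 0" if "c \<in> B" for c
        using orth[OF that] r BW that by (auto simp: e_def scale_l scale_r subset_iff)
      have "e \<notin> B" using ee eB by force
      moreover have "ON (insert e B)" using B(1) eW ee eB unfolding ON_def by auto
      ultimately show False using B(2)[of "insert e B"] BW by simp
    qed
    show "w = (\<Sum>b\<in>B. a w b *\<^sub>R b) + r" by (simp add: r_def)
  qed
  then show ?thesis using B(1) unfolding onb_def ON_def by blast
qed

text \<open>Definiteness kills the remainders of \<open>onb\<close>, so the vector with coordinates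
  \<open>L b\<close> represents L. Uniqueness matters as much as existence: it gives a meaning to
  the descriptions that define the weak operators.\<close>

lemma riesz:
  assumes L: "lin_on W L" and def: "\<And>y. y \<in> W \<Longrightarrow> a y y = 0 \<Longrightarrow> y = 0"
  shows "\<exists>!u. u \<in> W \<and> (\<forall>y\<in>W. a u y = L y)"
proof -
  obtain B where obB: "onb B" using onb_exists by blast
  note B = onbD(1-3)[OF obB] and P = onbD(4)[OF obB]
  define u where "u = (\<Sum>b\<in>B. L b *\<^sub>R b)"
  have u: "u \<in> W" unfolding u_def using B by (intro sum_mem) auto
  have au: "a u y = L y" if y: "y \<in> W" for y
  proof -
    have "y = (\<Sum>b\<in>B. a y b *\<^sub>R b)" using P[OF y] def by force
    then have "L y = (\<Sum>b\<in>B. a y b * L b)"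
      using lin_on_sum[OF L sub, of B "\<lambda>b. b" "\<lambda>b. a y b"] B by auto
    also have "\<dots> = a u y"
      unfolding u_def using B y sym[of y] by (subst sum_l) (auto intro!: sum.cong)
    finally show ?thesis by simp
  qed
  show ?thesis
  proof (intro ex1I[of _ u] conjI ballI)
    fix v assume v: "v \<in> W \<and> (\<forall>y\<in>W. a v y = L y)"
    have "a (v - u) (v - u) = 0"
      using v u au subspace_diff[OF sub, of v u] by (subst diff_l) auto
    then show "v = u" using def[of "v - u"] v u subspace_diff[OF sub] by auto
  qed (use u au in auto)
qed

end

text \<open>Bessel's inequality for a single vector: the residual of the projection onto b has
  nonnegative energy.\<close>

lemma orthonormal_coordinate_bound:
  assumes "psd_form W a" "b \<in> W" "a b b = 1" "x \<in> W"
  shows "\<bar>a x b\<bar> \<le> sqrt (a x x)"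
proof -
  interpret psd_form W a by fact
  have "0 \<le> a (x - a x b *\<^sub>R b) (x - a x b *\<^sub>R b)"
    using assms by (intro psd subspace_diff sub subspace_scale)
  also have "\<dots> = a x x - (a x b)\<^sup>2"
  proof -
    have bW: "a x b *\<^sub>R b \<in> W" using assms sub subspace_scale by blast
    have "a (x - a x b *\<^sub>R b) z = a x z - a x b * a b z" if "z \<in> W" for z
      using assms that bW by (simp add: diff_l scale_l)
    moreover have "a z (x - a x b *\<^sub>R b) = a z x - a x b * a z b" if "z \<in> W" for z
      using lin_on_diff[OF bilin_onD(2)[OF bil that] sub assms(4) bW] assms that by (simp add: scale_r)
    ultimately show ?thesis
      using assms bW subspace_diff[OF sub assms(4) bW] sym[OF assms(2,4)] by (simp add: power2_eq_square)
  qed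
  finally show ?thesis using real_sqrt_le_mono[of "(a x b)\<^sup>2" "a x x"] by simp
qed

text \<open>A form that vanishes on both kernels is determined by its finitely many values on two
  orthonormal systems, and the sum of their absolute values serves as M.\<close>

lemma bilinear_form_bound:
  assumes a1: "fin_psd_form W1 a1" and a2: "fin_psd_form W2 a2" and D: "bilin_on W1 W2 (D :: _ \<Rightarrow> _ \<Rightarrow> real)"
    and n1: "\<And>x y. x \<in> W1 \<Longrightarrow> y \<in> W2 \<Longrightarrow> a1 x x = 0 \<Longrightarrow> D x y = 0"
    and n2: "\<And>x y. x \<in> W1 \<Longrightarrow> y \<in> W2 \<Longrightarrow> a2 y y = 0 \<Longrightarrow> D x y = 0"
  shows "\<exists>M. \<forall>x\<in>W1. \<forall>y\<in>W2. \<bar>D x y\<bar> \<le> M * (sqrt (a1 x x) * sqrt (a2 y y))"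
proof -
  interpret P: fin_psd_form W1 a1 by fact
  interpret Q: fin_psd_form W2 a2 by fact
  obtain B where obB: "P.onb B" using P.onb_exists by blast
  note B = P.onbD(1-3)[OF obB] and PB = P.onbD(4)[OF obB]
  obtain C where obC: "Q.onb C" using Q.onb_exists by blast
  note C = Q.onbD(1-3)[OF obC] and QC = Q.onbD(4)[OF obC]
  have "\<bar>D x y\<bar> \<le> (\<Sum>b\<in>B. \<Sum>c\<in>C. \<bar>D b c\<bar>) * (sqrt (a1 x x) * sqrt (a2 y y))" if x: "x \<in> W1" and y: "y \<in> W2" for x y
  proof -
    obtain r where r: "r \<in> W1" "a1 r r = 0" "x = (\<Sum>b\<in>B. a1 x b *\<^sub>R b) + r" using PB x by blast
    obtain s where s: "s \<in> W2" "a2 s s = 0" "y = (\<Sum>c\<in>C. a2 y c *\<^sub>R c) + s" using QC y by blast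
    have "D x y = (\<Sum>b\<in>B. a1 x b * D b y)"
    proof -
      have "D x y = D (\<Sum>b\<in>B. a1 x b *\<^sub>R b) y + D r y"
        using lin_onD(1)[OF bilin_onD(1)[OF D y], of "\<Sum>b\<in>B. a1 x b *\<^sub>R b" r] r P.sum_mem[of B "\<lambda>b. b" "a1 x"] subsetD[OF B(2)] by simp
      also have "\<dots> = (\<Sum>b\<in>B. a1 x b * D b y)"
        using lin_on_sum[OF bilin_onD(1)[OF D y] P.sub, of B "\<lambda>b. b" "a1 x"] B r y n1 by auto
      finally show ?thesis .
    qed
    also have "\<dots> = (\<Sum>b\<in>B. \<Sum>c\<in>C. a1 x b * a2 y c * D b c)"
    proof (intro sum.cong refl)
      fix b assume "b \<in> B"
      then have b: "b \<in> W1" using B by auto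
      have "D b y = D b (\<Sum>c\<in>C. a2 y c *\<^sub>R c) + D b s"
        using lin_onD(1)[OF bilin_onD(2)[OF D b], of "\<Sum>c\<in>C. a2 y c *\<^sub>R c" s] s Q.sum_mem[of C "\<lambda>b. b" "a2 y"] subsetD[OF C(2)] by simp
      also have "\<dots> = (\<Sum>c\<in>C. a2 y c * D b c)"
        using lin_on_sum[OF bilin_onD(2)[OF D b] Q.sub, of C "\<lambda>b. b" "a2 y"] C s b n2 by auto
      finally show "a1 x b * D b y = (\<Sum>c\<in>C. a1 x b * a2 y c * D b c)"
        by (simp add: sum_distrib_left mult_ac)
    qed
    finally have "\<bar>D x y\<bar> \<le> (\<Sum>b\<in>B. \<Sum>c\<in>C. \<bar>a1 x b * a2 y c * D b c\<bar>)"
      by (auto intro: order_trans[OF sum_abs] sum_mono)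
    also have "\<dots> \<le> (\<Sum>b\<in>B. \<Sum>c\<in>C. \<bar>D b c\<bar> * (sqrt (a1 x x) * sqrt (a2 y y)))"
    proof (intro sum_mono)
      fix b c assume bc: "b \<in> B" "c \<in> C"
      have "\<bar>a1 x b\<bar> \<le> sqrt (a1 x x)"
        using orthonormal_coordinate_bound[OF P.psd_form_axioms] B bc x by auto
      moreover have "\<bar>a2 y c\<bar> \<le> sqrt (a2 y y)"
        using orthonormal_coordinate_bound[OF Q.psd_form_axioms] C bc y by auto
      ultimately have "\<bar>a1 x b\<bar> * \<bar>a2 y c\<bar> \<le> sqrt (a1 x x) * sqrt (a2 y y)"
        using P.psd[OF x] by (intro mult_mono) auto
      then have "\<bar>D b c\<bar> * (\<bar>a1 x b\<bar> * \<bar>a2 y c\<bar>) \<le> \<bar>D b c\<bar> * (sqrt (a1 x x) * sqrt (a2 y y))"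
        by (rule mult_left_mono) simp
      then show "\<bar>a1 x b * a2 y c * D b c\<bar> \<le> \<bar>D b c\<bar> * (sqrt (a1 x x) * sqrt (a2 y y))"
        by (simp add: abs_mult mult_ac)
    qed
    finally show ?thesis by (simp add: sum_distrib_right)
  qed
  then show ?thesis by blast
qed

text \<open>The abstract Galerkin problem. C is the skew convection term with its first argument as
  transporting field, D the lower-order coupling, which costs at most half of the energy. The last
  hypothesis makes the equation insensitive to kernel directions of the test function, so that an
  orthonormal system tests everything.\<close>

theorem coercive_trilinear_problem:
  fixes a D :: "'a::real_vector \<Rightarrow> 'a \<Rightarrow> real" and C :: "'a \<Rightarrow> 'a \<Rightarrow> 'a \<Rightarrow> real" and L :: "'a \<Rightarrow> real"
  assumes psd: "fin_psd_form W a"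
    and D: "bilin_on W W D" and L: "lin_on W L"
    and C1: "\<And>z. z \<in> W \<Longrightarrow> bilin_on W W (\<lambda>w y. C w z y)"
    and C2: "\<And>w. w \<in> W \<Longrightarrow> bilin_on W W (C w)"
    and skew: "\<And>w z. w \<in> W \<Longrightarrow> z \<in> W \<Longrightarrow> C w z z = 0"
    and coer: "\<And>z. z \<in> W \<Longrightarrow> a z z + D z z \<ge> a z z / 2"
    and null: "\<And>w z y. w \<in> W \<Longrightarrow> z \<in> W \<Longrightarrow> y \<in> W \<Longrightarrow> a y y = 0 \<Longrightarrow> D z y = 0 \<and> C w z y = 0 \<and> L y = 0"
  shows "\<exists>z\<in>W. \<forall>y\<in>W. a z y + D z y + C z z y = L y"
proof -
  interpret fin_psd_form W a by fact
  obtain B where obB: "onb B" using onb_exists by blast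
  note B = onbD(1-3)[OF obB] and P = onbD(4)[OF obB]
  obtain e where e: "bij_betw e {..<card B} B"
    using ex_bij_betw_nat_finite[OF B(1)] by (auto simp: atLeast0LessThan)
  define N where "N = card B"
  have eW: "e i \<in> W" "e i \<in> B" if "i < N" for i using e that B by (auto simp: bij_betw_def N_def)
  have ee: "a (e i) (e j) = (if i = j then 1 else 0)" if "i < N" "j < N" for i j
    using e that B(3)[OF eW(2) eW(2)] by (auto simp: bij_betw_def N_def inj_on_def)
  have sumB: "(\<Sum>b\<in>B. h b) = (\<Sum>i<N. h (e i))" for h :: "'a \<Rightarrow> 'a"
    using sum.reindex_bij_betw[OF e, of h] by (simp add: N_def)
  define z where "z x = (\<Sum>i<N. x i *\<^sub>R e i)" for x :: "nat \<Rightarrow> real"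
  have zW: "z x \<in> W" for x unfolding z_def using eW by (intro sum_mem) auto
  have lz: "f (z x) = (\<Sum>i<N. x i * f (e i))" if "lin_on W f" for f :: "'a \<Rightarrow> real" and x
    unfolding z_def using lin_on_sum[OF that sub, of "{..<N}" e x] eW by auto
  define G where "G x y = a (z x) y + D (z x) y + C (z x) (z x) y - L y" for x y
  have Gl: "lin_on W (\<lambda>y. G x y)" for x
    using zW[of x] bilin_onD(2)[OF bil zW] bilin_onD(2)[OF D zW] bilin_onD(2)[OF C2[OF zW] zW] L
    unfolding G_def lin_on_def by (auto simp: algebra_simps)
  have Gn: "G x y = 0" if "y \<in> W" "a y y = 0" for x y
    unfolding G_def using null[OF zW zW that] null_orth[OF that zW] sym[OF that(1) zW] by simp
  have cont: "continuous_on UNIV (\<lambda>x. G x (e i))" if i: "i < N" for i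
  proof -
    \<comment> \<open>In coordinates the residual is a polynomial of degree at most two, hence
      continuous although W itself has no topology.\<close>
    have "G x (e i) = (\<Sum>j<N. x j * a (e j) (e i)) + (\<Sum>j<N. x j * D (e j) (e i)) +
       (\<Sum>j<N. x j * (\<Sum>m<N. x m * C (e j) (e m) (e i))) - L (e i)" for x
    proof -
      have "C (z x) (z x) (e i) = (\<Sum>j<N. x j * C (e j) (z x) (e i))"
        using lz[OF bilin_onD(1)[OF C1[OF zW] eW(1)[OF i]]] by simp
      also have "\<dots> = (\<Sum>j<N. x j * (\<Sum>m<N. x m * C (e j) (e m) (e i)))"
        using lz[OF bilin_onD(1)[OF C2 eW(1)[OF i]]] eW by (intro sum.cong) auto
      finally show ?thesis unfolding G_def
        using lz[OF bilin_onD(1)[OF bil eW(1)[OF i]]] lz[OF bilin_onD(1)[OF D eW(1)[OF i]]] by simp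
    qed
    then show ?thesis by (simp) (intro continuous_intros continuous_on_product_coordinates)
  qed
  define \<Lambda> where "\<Lambda> = (\<Sum>i<N. \<bar>L (e i)\<bar>)"
  \<comment> \<open>On the sphere of radius R the residual paired with x is at least R^2/2 - R
    \<Lambda>, which equals R/2 for this choice.\<close>
  define R where "R = 2 * \<Lambda> + 1"
  have \<Lambda>: "\<Lambda> \<ge> 0" unfolding \<Lambda>_def by (simp add: sum_nonneg)
  have "\<exists>x. (\<forall>i\<ge>N. x i = 0) \<and> (\<forall>i<N. G x (e i) = 0)"
  proof (rule coercive_map_has_zero)
    show "R > 0" using \<Lambda> by (simp add: R_def)
    fix x :: "nat \<Rightarrow> real" assume x: "(\<Sum>i<N. (x i)\<^sup>2) = R\<^sup>2"
    have az: "a (z x) (z x) = R\<^sup>2"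
    proof -
      have "a (z x) (z x) = (\<Sum>i<N. x i * a (e i) (z x))"
        using lz[OF bilin_onD(1)[OF bil zW]] by simp
      also have "\<dots> = (\<Sum>i<N. x i * (\<Sum>j<N. x j * a (e i) (e j)))"
        using lz[OF bilin_onD(2)[OF bil]] eW by (intro sum.cong) auto
      also have "\<dots> = (\<Sum>i<N. x i * x i)"
        by (intro sum.cong refl) (simp add: ee if_distrib[of "(*) _"] sum.delta cong: if_cong)
      finally show ?thesis using x by (simp add: power2_eq_square)
    qed
    have xi: "\<bar>x i\<bar> \<le> R" if "i < N" for i
    proof -
      have "(x i)\<^sup>2 \<le> R\<^sup>2" unfolding x[symmetric] using that by (intro member_le_sum) auto
      then show ?thesis using \<open>R > 0\<close> by (simp add: abs_le_square_iff[symmetric])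
    qed
    have "L (z x) = (\<Sum>i<N. x i * L (e i))" by (rule lz[OF L])
    also have "\<dots> \<le> (\<Sum>i<N. R * \<bar>L (e i)\<bar>)"
    proof (rule sum_mono)
      fix i assume "i \<in> {..<N}"
      then have "\<bar>x i\<bar> * \<bar>L (e i)\<bar> \<le> R * \<bar>L (e i)\<bar>" by (intro mult_right_mono xi) auto
      then show "x i * L (e i) \<le> R * \<bar>L (e i)\<bar>"
        using abs_ge_self[of "x i * L (e i)"] by (simp add: abs_mult)
    qed
    also have "\<dots> = R * \<Lambda>" by (simp add: \<Lambda>_def sum_distrib_left)
    finally have Lz: "L (z x) \<le> R * \<Lambda>" .
    have "(\<Sum>i<N. G x (e i) * x i) = G x (z x)"
      using lz[OF Gl, of x x] by (simp add: mult.commute)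
    also have "\<dots> \<ge> R\<^sup>2 / 2 - R * \<Lambda>"
      unfolding G_def using coer[OF zW, of x] skew[OF zW zW, of x x] az Lz by simp
    also have "R\<^sup>2 / 2 - R * \<Lambda> = R / 2" by (simp add: R_def power2_eq_square field_simps)
    finally show "(\<Sum>i<N. G x (e i) * x i) > 0" using \<open>R > 0\<close> by simp
  qed (use cont in auto)
  then obtain x where x: "\<And>i. i < N \<Longrightarrow> G x (e i) = 0" by blast
  \<comment> \<open>The residual does not see the kernel remainder of y, so the N scalar equations
    suffice.\<close>
  have "G x y = 0" if y: "y \<in> W" for y
  proof -
    obtain r where r: "r \<in> W" "a r r = 0" "y = (\<Sum>b\<in>B. a y b *\<^sub>R b) + r" using P y by blast
    then have y': "y = z (\<lambda>i. a y (e i)) + r" by (simp add: sumB z_def)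
    have "G x y = G x (z (\<lambda>i. a y (e i))) + G x r"
      using lin_onD(1)[OF Gl zW r(1)] y' by metis
    also have "\<dots> = 0" using lz[OF Gl] x Gn r by simp
    finally show ?thesis .
  qed
  then show ?thesis using zW by (intro bexI[of _ "z x"]) (auto simp: G_def)
qed

section \<open>Barycentric coordinates and outer normals of a simplex\<close>

lemma simplex_vertsD:
  fixes V :: "(real^'n::finite) set"
  assumes "simplex_verts V"
  shows "finite V" "card V = CARD('n) + 1" "\<not> affine_dependent V" "affine hull V = UNIV"
proof -
  show *: "finite V" "card V = CARD('n) + 1" "\<not> affine_dependent V"
    using assms by (auto simp: simplex_verts_def)
  show "affine hull V = UNIV"
    using * by (intro affine_independent_span_eq) auto
qed

lemma simplex_affine_combination:
  assumes "simplex_verts V"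
  obtains c where "sum c V = 1" "(\<Sum>p\<in>V. c p *\<^sub>R p) = x"
  using simplex_vertsD[OF assms] affine_hull_finite[of V] by blast

text \<open>The vertices affinely span the space, so a functional constant on them is constant
  everywhere.\<close>

lemma simplex_inner_eq_imp_zero:
  assumes V: "simplex_verts V" and eq: "\<And>p. p \<in> V \<Longrightarrow> n \<bullet> p = b"
  shows "n = 0"
proof -
  have "affine hull V \<subseteq> {x. n \<bullet> x = b}"
    by (intro hull_minimal affine_hyperplane) (use eq in auto)
  then have "n \<bullet> x = b" for x using simplex_vertsD(4)[OF V] by auto
  then have "n \<bullet> n = n \<bullet> 0" by metis
  then show ?thesis by simp
qed

lemma simplex_face_nonempty:
  assumes "simplex_verts V" "q \<in> V"
  shows "V - {q} \<noteq> {}"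
proof
  assume "V - {q} = {}"
  then have "V = {q}" using assms by auto
  then show False using simplex_vertsD(2)[OF assms(1)] by simp
qed

text \<open>A face has d vertices, so their d - 1 differences leave room for a normal direction. The
  opposite vertex is off the plane of the face and therefore decides the sign.\<close>

lemma onormal_ex1:
  fixes V :: "(real^'n::finite) set"
  assumes V: "simplex_verts V" and q: "q \<in> V"
  defines "e \<equiv> V - {q}"
  shows "\<exists>!n. norm n = 1 \<and> (\<forall>p\<in>e. \<forall>q\<in>e. n \<bullet> (p - q) = 0) \<and> (\<forall>p\<in>e. \<forall>q\<in>V - e. n \<bullet> (q - p) < 0)"
proof -
  have Ve: "V - e = {q}" using q by (auto simp: e_def)
  obtain p where p: "p \<in> e" using simplex_face_nonempty[OF V q] by (auto simp: e_def)
  define D where "D = (\<lambda>x. x - p) ` (e - {p})"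
  have fe: "finite e" "card e = CARD('n)" using simplex_vertsD[OF V] q by (auto simp: e_def)
  have "dim D \<le> card D" using fe by (intro dim_le_card') (auto simp: D_def)
  also have "\<dots> \<le> card (e - {p})" unfolding D_def using fe by (intro card_image_le) auto
  also have "\<dots> < DIM(real^'n)" using fe p by (simp add: card_gt_0_iff)
  finally obtain n0 where n0: "n0 \<noteq> 0" "\<And>y. y \<in> span D \<Longrightarrow> orthogonal n0 y"
    using orthogonal_to_subspace_exists by blast
  have np: "n0 \<bullet> r = n0 \<bullet> p" if "r \<in> e" for r
  proof (cases "r = p")
    case False
    then have "r - p \<in> span D" using that by (auto simp: D_def intro!: span_base)
    then show ?thesis using n0(2)[of "r - p"] by (simp add: orthogonal_def inner_diff_right)
  qed simp
  have nq: "n0 \<bullet> q \<noteq> n0 \<bullet> p"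
  proof
    assume "n0 \<bullet> q = n0 \<bullet> p"
    then have "n0 \<bullet> r = n0 \<bullet> p" if "r \<in> V" for r using np that e_def by (cases "r = q") auto
    then show False using simplex_inner_eq_imp_zero[OF V] n0(1) by blast
  qed
  \<comment> \<open>The sign places the opposite vertex on the negative side, so that n points
    outward.\<close>
  define n where "n = (- sgn (n0 \<bullet> (q - p)) / norm n0) *\<^sub>R n0"
  have s: "sgn (n0 \<bullet> (q - p)) * (n0 \<bullet> (q - p)) > 0"
    using nq by (simp add: inner_diff_right sgn_mult_self_eq zero_less_mult_iff sgn_if)
  have nI: "norm n = 1" using n0 nq by (simp add: n_def inner_diff_right abs_sgn_eq)
  have nE: "n \<bullet> r = n \<bullet> p" if "r \<in> e" for r using np[OF that] by (simp add: n_def)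
  have nQ: "n \<bullet> (q - p) < 0"
    using s n0(1) by (simp add: n_def)
  show ?thesis
  proof (intro ex1I[of _ n] conjI ballI)
    fix n' assume n': "norm n' = 1 \<and> (\<forall>p\<in>e. \<forall>q\<in>e. n' \<bullet> (p - q) = 0) \<and> (\<forall>p\<in>e. \<forall>q\<in>V - e. n' \<bullet> (q - p) < 0)"
    \<comment> \<open>With this factor n' - c n has the same inner product with q as with the face
      vertices, so it is constant on all vertices and vanishes.\<close>
    define c where "c = (n' \<bullet> (q - p)) / (n \<bullet> (q - p))"
    have "n' \<bullet> (q - p) < 0" using n' p Ve by auto
    then have c: "c > 0" using nQ by (simp add: c_def divide_neg_neg)
    have "(n' - c *\<^sub>R n) \<bullet> r = (n' - c *\<^sub>R n) \<bullet> p" if "r \<in> V" for r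
    proof (cases "r = q")
      case True
      have "(n' - c *\<^sub>R n) \<bullet> (q - p) = 0"
        using nQ by (simp add: inner_diff_left c_def)
      then show ?thesis using True by (simp add: inner_diff_right)
    next
      case False
      then have re: "r \<in> e" using that by (simp add: e_def)
      then have "n' \<bullet> (r - p) = 0" using n' p by blast
      then show ?thesis using nE[OF re] by (simp add: inner_diff_left inner_diff_right)
    qed
    then have "n' - c *\<^sub>R n = 0" using simplex_inner_eq_imp_zero[OF V] by blast
    then have "n' = c *\<^sub>R n" by simp
    moreover have "c = 1" using n' nI c \<open>n' = c *\<^sub>R n\<close> by simp
    ultimately show "n' = n" by simp
  next
    show "n \<bullet> (r - r') = 0" if "r \<in> e" "r' \<in> e" for r r'
      using nE[OF that(1)] nE[OF that(2)] by (simp add: inner_diff_right)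
    show "n \<bullet> (r' - r) < 0" if "r \<in> e" "r' \<in> V - e" for r r'
      using nE[OF that(1)] that(2) Ve nQ by (simp add: inner_diff_right)
  qed (rule nI)
qed

abbreviation fnormal :: "(real^'n::finite) set \<Rightarrow> real^'n \<Rightarrow> real^'n" where
  "fnormal V q \<equiv> onormal V (V - {q})"

abbreviation fhull :: "(real^'n::finite) set \<Rightarrow> real^'n \<Rightarrow> (real^'n) set" where
  "fhull V q \<equiv> convex hull (V - {q})"

abbreviation fintq :: "(real^'n::finite) set \<Rightarrow> real^'n \<Rightarrow> (real^'n \<Rightarrow> real) \<Rightarrow> real" where
  "fintq V q \<equiv> fint V (V - {q})"

lemma
  assumes V: "simplex_verts V" and q: "q \<in> V"
  shows norm_onormal: "norm (fnormal V q) = 1"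
    and onormal_orth: "p \<in> V - {q} \<Longrightarrow> r \<in> V - {q} \<Longrightarrow> fnormal V q \<bullet> (p - r) = 0"
    and onormal_neg: "p \<in> V - {q} \<Longrightarrow> fnormal V q \<bullet> (q - p) < 0"
  using theI'[OF onormal_ex1[OF V q]] q unfolding onormal_def[symmetric] by blast+

lemma onormal_eqI:
  assumes V: "simplex_verts V" and q: "q \<in> V"
    and "norm n = 1" "\<And>p r. p \<in> V - {q} \<Longrightarrow> r \<in> V - {q} \<Longrightarrow> n \<bullet> (p - r) = 0"
    "\<And>p. p \<in> V - {q} \<Longrightarrow> n \<bullet> (q - p) < 0"
  shows "fnormal V q = n"
  unfolding onormal_def
proof (rule the1_equality[OF onormal_ex1[OF V q]], intro conjI ballI)
  fix p r assume "p \<in> V - {q}" "r \<in> V - (V - {q})"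
  then show "n \<bullet> (r - p) < 0" using assms(5)[of p] by auto
qed (use assms in auto)

text \<open>The barycentric coordinate of q as a relative height over the face opposite q. The
  explicit formula is affine on the whole space, also outside the simplex, and shows its gradient;
  which face vertex is chosen is immaterial because the face is orthogonal to the normal.\<close>

definition bary :: "(real^'n::finite) set \<Rightarrow> real^'n \<Rightarrow> real^'n \<Rightarrow> real" where
  "bary V q x = (let n = fnormal V q; p = (SOME p. p \<in> V - {q}) in (n \<bullet> (x - p)) / (n \<bullet> (q - p)))"

context
  fixes V :: "(real^'n::finite) set"
  assumes V: "simplex_verts V"
begin

lemma bary_eq:
  assumes q: "q \<in> V" and p: "p \<in> V - {q}"
  shows "bary V q x = (fnormal V q \<bullet> (x - p)) / (fnormal V q \<bullet> (q - p))"
proof -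
  define p' where "p' = (SOME p. p \<in> V - {q})"
  have p': "p' \<in> V - {q}" unfolding p'_def using p by (rule someI)
  have "fnormal V q \<bullet> p = fnormal V q \<bullet> p'"
    using onormal_orth[OF V q p p'] by (simp add: inner_diff_right)
  then show ?thesis unfolding bary_def Let_def p'_def[symmetric] by (simp add: inner_diff_right)
qed

lemma bary_shift:
  assumes "q \<in> V"
  shows "bary V q (x + s *\<^sub>R (y - z)) = bary V q x + s * (bary V q y - bary V q z)"
proof -
  obtain p where p: "p \<in> V - {q}" using simplex_face_nonempty[OF V assms] by auto
  show ?thesis
    unfolding bary_eq[OF assms p] by (simp add: inner_diff_right inner_add_right add_divide_distrib diff_divide_distrib right_diff_distrib)
qed

lemma bary_vertex:
  assumes "q \<in> V" "p \<in> V"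
  shows "bary V q p = (if p = q then 1 else 0)"
proof -
  obtain r where r: "r \<in> V - {q}" using simplex_face_nonempty[OF V assms(1)] by auto
  show ?thesis
    using onormal_neg[OF V assms(1) r] onormal_orth[OF V assms(1) _ r, of p] assms
    by (auto simp: bary_eq[OF assms(1) r])
qed

text \<open>The height is affine and is a Kronecker delta on the vertices, so it recovers the
  coefficients.\<close>

lemma bary_combination:
  assumes q: "q \<in> V" and c: "sum c V = 1"
  shows "bary V q (\<Sum>p\<in>V. c p *\<^sub>R p) = c q"
proof -
  obtain r where r: "r \<in> V - {q}" using simplex_face_nonempty[OF V q] by auto
  let ?n = "fnormal V q"
  have fV: "finite V" using simplex_vertsD[OF V] by simp
  have "(\<Sum>p\<in>V. c p *\<^sub>R p) - r = (\<Sum>p\<in>V. c p *\<^sub>R (p - r))"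
    using c by (simp add: scaleR_diff_right sum_subtractf flip: scaleR_sum_left)
  then have "bary V q (\<Sum>p\<in>V. c p *\<^sub>R p) = (\<Sum>p\<in>V. c p * bary V q p)"
    unfolding bary_eq[OF q r] by (simp add: inner_sum_right sum_divide_distrib)
  also have "\<dots> = (\<Sum>p\<in>V. if p = q then c p else 0)"
    using q by (intro sum.cong) (auto simp: bary_vertex)
  also have "\<dots> = c q" using q fV by simp
  finally show ?thesis .
qed

lemma bary_sum: "(\<Sum>q\<in>V. bary V q x) = 1" and bary_repr: "(\<Sum>q\<in>V. bary V q x *\<^sub>R q) = x"
proof -
  obtain c where c: "sum c V = 1" "(\<Sum>p\<in>V. c p *\<^sub>R p) = x" by (rule simplex_affine_combination[OF V])
  have "bary V q x = c q" if "q \<in> V" for q using bary_combination[OF that c(1)] c(2) by simp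
  then show "(\<Sum>q\<in>V. bary V q x) = 1" "(\<Sum>q\<in>V. bary V q x *\<^sub>R q) = x"
    using c by (simp_all cong: sum.cong)
qed

lemma continuous_bary [continuous_intros]: "continuous_on S f \<Longrightarrow> continuous_on S (\<lambda>x. bary V q (f x))"
  \<comment> \<open>For q outside V the denominator may be zero, and division by zero then makes the
    function constantly 0.\<close>
  by (cases "fnormal V q \<bullet> (q - (SOME p. p \<in> V - {q})) = 0")
    (auto simp: bary_def Let_def intro!: continuous_intros)

lemma borel_measurable_bary [measurable]: "bary V q \<in> borel_measurable borel"
  by (intro borel_measurable_continuous_onI continuous_bary continuous_on_id)

text \<open>Coefficients of a convex combination of U, extended by zero, are the barycentric
  coordinates. Membership in simplices and faces thereby becomes a system of linear conditions, the
  only form in which it is used below.\<close>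

lemma simplex_subset_hull:
  assumes "U \<subseteq> V"
  shows "convex hull U = {x. (\<forall>q\<in>V. bary V q x \<ge> 0) \<and> (\<forall>q\<in>V - U. bary V q x = 0)}"
proof (intro equalityI subsetI)
  have fV: "finite V" using simplex_vertsD[OF V] by simp
  have fU: "finite U" using assms fV finite_subset by blast
  fix x
  {
    assume "x \<in> convex hull U"
    then obtain u where u: "\<And>p. p \<in> U \<Longrightarrow> 0 \<le> u p" "sum u U = 1" "(\<Sum>p\<in>U. u p *\<^sub>R p) = x"
      using convex_hull_finite[OF fU] by auto
    define c where "c p = (if p \<in> U then u p else 0)" for p
    have "sum c V = 1" "(\<Sum>p\<in>V. c p *\<^sub>R p) = x"
      using u(2,3) sum.mono_neutral_right[OF fV assms, of c] sum.mono_neutral_right[OF fV assms, of "\<lambda>p. c p *\<^sub>R p"]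
      by (auto simp: c_def)
    then have "bary V q x = c q" if "q \<in> V" for q using bary_combination[OF that] by metis
    then show "x \<in> {x. (\<forall>q\<in>V. bary V q x \<ge> 0) \<and> (\<forall>q\<in>V - U. bary V q x = 0)}"
      using u by (auto simp: c_def)
  next
    assume x: "x \<in> {x. (\<forall>q\<in>V. bary V q x \<ge> 0) \<and> (\<forall>q\<in>V - U. bary V q x = 0)}"
    have "sum (\<lambda>q. bary V q x) U = 1" "(\<Sum>q\<in>U. bary V q x *\<^sub>R q) = x"
      using x bary_sum[of x] bary_repr[of x] sum.mono_neutral_right[OF fV assms, of "\<lambda>q. bary V q x"]
       sum.mono_neutral_right[OF fV assms, of "\<lambda>q. bary V q x *\<^sub>R q"] by auto
    then show "x \<in> convex hull U"
      using convex_hull_finite[OF fU] x assms by (auto intro!: exI[of _ "\<lambda>q. bary V q x"])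
  }
qed

lemma simplex_hull: "convex hull V = {x. \<forall>q\<in>V. bary V q x \<ge> 0}"
  using simplex_subset_hull[of V] by simp

lemma face_hull:
  assumes "q \<in> V"
  shows "fhull V q = {x. bary V q x = 0 \<and> (\<forall>p\<in>V - {q}. bary V p x \<ge> 0)}"
  using assms by (subst simplex_subset_hull) auto

lemma face_hull_inner:
  assumes q: "q \<in> V" and p: "p \<in> V - {q}" and y: "y \<in> fhull V q"
  shows "fnormal V q \<bullet> (y - p) = 0"
  using y onormal_neg[OF V q p] by (auto simp: face_hull[OF q] bary_eq[OF q p])

end

text \<open>Supplies a point in the relative interior of a face: all coordinates except that of p
  are strictly positive, and equal because a face has \<open>CARD('n)\<close> vertices.\<close>

lemma face_centroid:
  fixes V :: "(real^'n::finite) set"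
  assumes V: "simplex_verts V" and p: "p \<in> V"
  obtains x where "bary V p x = 0" "\<And>r. r \<in> V - {p} \<Longrightarrow> bary V r x = 1 / real CARD('n)"
    "x \<in> fhull V p"
proof -
  let ?e = "V - {p}"
  define c where "c r = (if r = p then 0 else 1 / real CARD('n))" for r
  define x where "x = (\<Sum>r\<in>V. c r *\<^sub>R r)"
  have ce: "card ?e = CARD('n)" using p simplex_vertsD[OF V] by simp
  have "sum c V = c p + sum c ?e" using p simplex_vertsD(1)[OF V] by (rule sum.remove[rotated])
  also have "sum c ?e = (\<Sum>r\<in>?e. 1 / real CARD('n))" by (intro sum.cong) (auto simp: c_def)
  finally have "sum c V = 1" using ce by (simp add: c_def)
  then have b: "bary V r x = c r" if "r \<in> V" for r unfolding x_def by (rule bary_combination[OF V that])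
  show thesis
    by (rule that[of x]) (use b p in \<open>auto simp: c_def face_hull[OF V p]\<close>)
qed

lemma faces_eq: "faces V = (\<lambda>q. V - {q}) ` V"
  by (auto simp: faces_def)

lemma sum_faces: "(\<Sum>e\<in>faces V. h e) = (\<Sum>q\<in>V. h (V - {q}))"
  unfolding faces_eq by (subst sum.reindex) (auto simp: inj_on_def)

section \<open>Integration along a direction and over faces\<close>

lemma nn_integral_translation:
  fixes f :: "'a::euclidean_space \<Rightarrow> ennreal"
  assumes [measurable]: "f \<in> borel_measurable borel"
  shows "(\<integral>\<^sup>+x. f (x + c) \<partial>lborel) = (\<integral>\<^sup>+x. f x \<partial>lborel)"
proof -
  have "(\<integral>\<^sup>+x. f x \<partial>lborel) = (\<integral>\<^sup>+x. f x \<partial>distr lborel borel ((+) c))"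
    by (simp add: lborel_distr_plus)
  also have "\<dots> = (\<integral>\<^sup>+x. f (c + x) \<partial>lborel)" by (subst nn_integral_distr) auto
  finally show ?thesis by (simp add: add.commute)
qed

text \<open>Translation invariance along w, averaged over all translations by Tonelli's theorem.\<close>
lemma nn_integral_along:
  fixes F :: "'a::euclidean_space \<Rightarrow> ennreal" and l :: "'a \<Rightarrow> real"
  assumes F [measurable]: "F \<in> borel_measurable borel" and l [measurable]: "l \<in> borel_measurable borel"
    and lw: "\<And>x s. l (x + s *\<^sub>R w) = l x + s"
  shows "(\<integral>\<^sup>+x. F x \<partial>lborel) =
     (\<integral>\<^sup>+x. indicator {0..1} (l x) * (\<integral>\<^sup>+s. F (x - l x *\<^sub>R w + s *\<^sub>R w) \<partial>lborel) \<partial>lborel)"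
proof -
  have [measurable]: "(\<lambda>(x,s). F (x + s *\<^sub>R w)) \<in> borel_measurable (lborel \<Otimes>\<^sub>M lborel)"
    by measurable
  have [measurable]: "(\<lambda>(x,s). indicator {0..1} (l x) * F (x + s *\<^sub>R w)) \<in> borel_measurable (lborel \<Otimes>\<^sub>M lborel)"
    by measurable
  have "(\<integral>\<^sup>+s. F (x - l x *\<^sub>R w + s *\<^sub>R w) \<partial>lborel) = (\<integral>\<^sup>+s. F (x + s *\<^sub>R w) \<partial>lborel)" for x
    using nn_integral_translation[of "\<lambda>s. F (x + s *\<^sub>R w)" "- l x"] by (simp add: algebra_simps)
  then have "(\<integral>\<^sup>+x. indicator {0..1} (l x) * (\<integral>\<^sup>+s. F (x - l x *\<^sub>R w + s *\<^sub>R w) \<partial>lborel) \<partial>lborel) =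
     (\<integral>\<^sup>+x. (\<integral>\<^sup>+s. indicator {0..1} (l x) * F (x + s *\<^sub>R w) \<partial>lborel) \<partial>lborel)"
    by (simp add: nn_integral_cmult)
  also have "\<dots> = (\<integral>\<^sup>+s. (\<integral>\<^sup>+x. indicator {0..1} (l x) * F (x + s *\<^sub>R w) \<partial>lborel) \<partial>lborel)"
    by (rule lborel_pair.Fubini'[symmetric]) measurable
  also have "\<dots> = (\<integral>\<^sup>+s. (\<integral>\<^sup>+x. indicator {0..1} (l x - s) * F x \<partial>lborel) \<partial>lborel)"
  proof (rule nn_integral_cong)
    fix s
    have "l (x + s *\<^sub>R w) - s = l x" for x using lw by simp
    then show "(\<integral>\<^sup>+x. indicator {0..1} (l x) * F (x + s *\<^sub>R w) \<partial>lborel) = (\<integral>\<^sup>+x. indicator {0..1} (l x - s) * F x \<partial>lborel)"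
      using nn_integral_translation[of "\<lambda>x. indicator {0..1} (l x - s) * F x" "s *\<^sub>R w"] by simp
  qed
  also have "\<dots> = (\<integral>\<^sup>+x. (\<integral>\<^sup>+s. indicator {0..1} (l x - s) * F x \<partial>lborel) \<partial>lborel)"
    by (rule lborel_pair.Fubini') measurable
  also have "\<dots> = (\<integral>\<^sup>+x. F x \<partial>lborel)"
  proof (rule nn_integral_cong)
    fix x
    \<comment> \<open>For fixed x the admissible s fill an interval of length one, so averaging over
      s returns F x.\<close>
    have "(\<integral>\<^sup>+s. indicator {0..1} (l x - s) * F x \<partial>lborel) = (\<integral>\<^sup>+s. indicator {l x - 1..l x} s \<partial>lborel) * F x"
      by (subst nn_integral_multc[symmetric]) (auto intro!: nn_integral_cong simp: indicator_def)
    then show "(\<integral>\<^sup>+s. indicator {0..1} (l x - s) * F x \<partial>lborel) = F x" by simp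
  qed
  finally show ?thesis by simp
qed

text \<open>G is constant along w and both heights grow at unit rate along w, so a slab contributes
  in proportion to the length of its window, whichever height measures it. Both sides are one double
  integral over x and s, evaluated in the two orders.\<close>

lemma nn_integral_window:
  fixes G :: "'a::euclidean_space \<Rightarrow> ennreal" and l l' :: "'a \<Rightarrow> real"
  assumes [measurable]: "G \<in> borel_measurable borel" "l \<in> borel_measurable borel" "l' \<in> borel_measurable borel"
    and lw: "\<And>x s. l (x + s *\<^sub>R w) = l x + s" "\<And>x s. l' (x + s *\<^sub>R w) = l' x + s"
    and Gw: "\<And>x s. G (x + s *\<^sub>R w) = G x"
    and I [measurable]: "I \<in> sets borel" "J \<in> sets borel"
  shows "emeasure lborel J * (\<integral>\<^sup>+x. indicator I (l x) * G x \<partial>lborel) = emeasure lborel I * (\<integral>\<^sup>+x. indicator J (l' x) * G x \<partial>lborel)"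
proof -
  have shift: "(\<integral>\<^sup>+s. indicator J (a + s) \<partial>lborel) = emeasure lborel J" if [measurable]: "J \<in> sets borel" for a :: real and J
    using nn_integral_translation[of "indicator J" a] by (simp add: add.commute)
  have flip: "(\<integral>\<^sup>+s. indicator I (a - s) \<partial>lborel) = emeasure lborel I" for a :: real
    using nn_integral_real_affine[of "indicator I" "-1" a] by simp
  have "emeasure lborel J * (\<integral>\<^sup>+x. indicator I (l x) * G x \<partial>lborel) =
    (\<integral>\<^sup>+x. (\<integral>\<^sup>+s. indicator J (l' x + s) * (indicator I (l x) * G x) \<partial>lborel) \<partial>lborel)"
    by (simp add: shift nn_integral_multc flip: nn_integral_cmult)
  also have "\<dots> = (\<integral>\<^sup>+s. (\<integral>\<^sup>+x. indicator J (l' x + s) * (indicator I (l x) * G x) \<partial>lborel) \<partial>lborel)"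
    by (rule lborel_pair.Fubini'[symmetric]) measurable
  also have "\<dots> = (\<integral>\<^sup>+s. (\<integral>\<^sup>+x. indicator J (l' x) * (indicator I (l x - s) * G x) \<partial>lborel) \<partial>lborel)"
  proof (rule nn_integral_cong)
    fix s
    have e: "l (x + s *\<^sub>R w) - s = l x" for x using lw by simp
    show "(\<integral>\<^sup>+x. indicator J (l' x + s) * (indicator I (l x) * G x) \<partial>lborel) =
          (\<integral>\<^sup>+x. indicator J (l' x) * (indicator I (l x - s) * G x) \<partial>lborel)"
      using nn_integral_translation[of "\<lambda>x. indicator J (l' x) * (indicator I (l x - s) * G x)" "s *\<^sub>R w"]
      by (simp add: e lw(2) Gw)
  qed
  also have "\<dots> = (\<integral>\<^sup>+x. (\<integral>\<^sup>+s. indicator J (l' x) * (indicator I (l x - s) * G x) \<partial>lborel) \<partial>lborel)"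
    by (rule lborel_pair.Fubini') measurable
  also have "\<dots> = (\<integral>\<^sup>+x. emeasure lborel I * (indicator J (l' x) * G x) \<partial>lborel)"
  proof (rule nn_integral_cong)
    fix x
    have "(\<integral>\<^sup>+s. indicator J (l' x) * (indicator I (l x - s) * G x) \<partial>lborel) =
      (\<integral>\<^sup>+s. indicator I (l x - s) * (indicator J (l' x) * G x) \<partial>lborel)"
      by (simp add: mult_ac)
    also have "\<dots> = (\<integral>\<^sup>+s. indicator I (l x - s) \<partial>lborel) * (indicator J (l' x) * G x)"
      by (rule nn_integral_multc) measurable
    finally show "(\<integral>\<^sup>+s. indicator J (l' x) * (indicator I (l x - s) * G x) \<partial>lborel) = emeasure lborel I * (indicator J (l' x) * G x)"
      by (simp add: flip)
  qed
  finally show ?thesis by (simp add: nn_integral_cmult)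
qed

text \<open>Replacing the direction n of projection onto the plane l = 0 by w only shears the slab.\<close>
lemma nn_integral_oblique:
  fixes h :: "'a::euclidean_space \<Rightarrow> ennreal" and l :: "'a \<Rightarrow> real"
  assumes [measurable]: "h \<in> borel_measurable borel" "l \<in> borel_measurable borel"
    and ln: "\<And>x s. l (x + s *\<^sub>R n) = l x + s" and lw: "\<And>x s. l (x + s *\<^sub>R w) = l x + s"
  shows "(\<integral>\<^sup>+x. indicator {0..1} (l x) * h (x - l x *\<^sub>R n) \<partial>lborel) =
         (\<integral>\<^sup>+x. indicator {0..1} (l x) * h (x - l x *\<^sub>R w) \<partial>lborel)"
proof -
  let ?F = "\<lambda>x. indicator {0..1} (l x) * h (x - l x *\<^sub>R n)"
  have l0: "l (x - l x *\<^sub>R w + s *\<^sub>R w) = s" for x s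
    using lw[of x "s - l x"] by (simp add: algebra_simps)
  have "integral\<^sup>N lborel ?F = (\<integral>\<^sup>+x. indicator {0..1} (l x) * (\<integral>\<^sup>+s. ?F (x - l x *\<^sub>R w + s *\<^sub>R w) \<partial>lborel) \<partial>lborel)"
    by (rule nn_integral_along) (measurable, rule lw)
  also have "\<dots> = (\<integral>\<^sup>+x. (\<integral>\<^sup>+s. indicator {0..1} s * (indicator {0..1} (l x) * h (x - l x *\<^sub>R w + s *\<^sub>R (w - n))) \<partial>lborel) \<partial>lborel)"
    unfolding l0 by (simp add: algebra_simps flip: nn_integral_cmult)
  also have "\<dots> = (\<integral>\<^sup>+s. (\<integral>\<^sup>+x. indicator {0..1} s * (indicator {0..1} (l x) * h (x - l x *\<^sub>R w + s *\<^sub>R (w - n))) \<partial>lborel) \<partial>lborel)"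
    by (rule lborel_pair.Fubini'[symmetric]) measurable
  also have "\<dots> = (\<integral>\<^sup>+s. indicator {0..1} s * (\<integral>\<^sup>+x. indicator {0..1} (l x) * h (x - l x *\<^sub>R w) \<partial>lborel) \<partial>(lborel::real measure))"
  proof (rule nn_integral_cong)
    fix s :: real
    \<comment> \<open>The vector w - n is parallel to the plane l = 0, so translation by s (w - n)
      stays in the slab and removes the dependence on s.\<close>
    have lx: "l (x + s *\<^sub>R (w - n)) = l x" for x
      using lw[of "x + (-s) *\<^sub>R n" s] ln[of x "-s"] by (simp add: algebra_simps)
    have px: "x + s *\<^sub>R (w - n) - l x *\<^sub>R w = x - l x *\<^sub>R w + s *\<^sub>R (w - n)" for x by simp
    have "(\<integral>\<^sup>+x. indicator {0..1} (l x) * h (x - l x *\<^sub>R w + s *\<^sub>R (w - n)) \<partial>lborel) =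
        (\<integral>\<^sup>+x. indicator {0..1} (l x) * h (x - l x *\<^sub>R w) \<partial>lborel)"
      using nn_integral_translation[of "\<lambda>x. indicator {0..1} (l x) * h (x - l x *\<^sub>R w)" "s *\<^sub>R (w - n)"]
      unfolding lx px by simp
    then show "(\<integral>\<^sup>+x. indicator {0..1} s * (indicator {0..1} (l x) * h (x - l x *\<^sub>R w + s *\<^sub>R (w - n))) \<partial>lborel) =
       indicator {0..1} s * (\<integral>\<^sup>+x. indicator {0..1} (l x) * h (x - l x *\<^sub>R w) \<partial>lborel)"
      by (subst nn_integral_cmult) auto
  qed
  also have "\<dots> = (\<integral>\<^sup>+x. indicator {0..1} (l x) * h (x - l x *\<^sub>R w) \<partial>lborel)"
    by (subst nn_integral_multc) auto
  finally show ?thesis .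
qed

definition prism :: "(real^'n::finite) set \<Rightarrow> (real^'n) set \<Rightarrow> (real^'n) set" where
  "prism V e = {y + t *\<^sub>R onormal V e | y t. y \<in> convex hull e \<and> t \<in> {0..1}}"

definition fproj :: "(real^'n::finite) set \<Rightarrow> (real^'n) set \<Rightarrow> real^'n \<Rightarrow> real^'n" where
  "fproj V e x = x - ((x - (SOME p. p \<in> e)) \<bullet> onormal V e) *\<^sub>R onormal V e"

lemma fint_eq: "fint V e f = integral (prism V e) (\<lambda>x. f (fproj V e x))"
  by (simp add: fint_def prism_def fproj_def Let_def)

lemma continuous_integrable_compact:
  fixes f :: "'a::euclidean_space \<Rightarrow> 'b::euclidean_space"
  assumes "compact S" "continuous_on S f"
  shows "f integrable_on S"
  using set_borel_integral_eq_integral(1)[of S f] borel_integrable_compact[OF assms]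
  by (simp add: set_integrable_def)

lemma compact_hull_simplex: "simplex_verts V \<Longrightarrow> U \<subseteq> V \<Longrightarrow> compact (convex hull U)"
  using simplex_vertsD(1) finite_subset by (blast intro: compact_convex_hull finite_imp_compact)

lemma eint_integrable:
  fixes f :: "real^'n::finite \<Rightarrow> 'b::euclidean_space"
  assumes "simplex_verts V" "continuous_on (convex hull V) f"
  shows "f integrable_on (convex hull V)"
  by (rule continuous_integrable_compact[OF compact_hull_simplex[OF assms(1) order_refl] assms(2)])

lemma eint_add:
  fixes f g :: "real^'n::finite \<Rightarrow> real"
  assumes "simplex_verts V" "continuous_on (convex hull V) f" "continuous_on (convex hull V) g"
  shows "eint V (\<lambda>x. f x + g x) = eint V f + eint V g"
  unfolding eint_def by (intro integral_add eint_integrable assms)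

lemma eint_cmult: "eint V (\<lambda>x. c * f x) = c * eint V f" for c :: real
  unfolding eint_def by simp

lemma compact_prism:
  assumes "simplex_verts V" "q \<in> V"
  shows "compact (prism V (V - {q}))"
proof -
  have "prism V (V - {q}) = (\<lambda>(y,t). y + t *\<^sub>R fnormal V q) ` ((fhull V q) \<times> {0..1})"
    unfolding prism_def by (auto simp: image_iff) blast
  also have "compact \<dots>"
    unfolding case_prod_unfold
    using compact_hull_simplex[OF assms(1), of "V - {q}"]
    by (intro compact_continuous_image continuous_intros compact_Times) auto
  finally show ?thesis .
qed

context
  fixes V :: "(real^'n::finite) set" and q :: "real^'n"
  assumes V: "simplex_verts V" and q: "q \<in> V"
begin

lemma fproj_eq:
  assumes p: "p \<in> V - {q}"
  shows "fproj V (V - {q}) x = x - (fnormal V q \<bullet> (x - p)) *\<^sub>R fnormal V q"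
proof -
  have p': "(SOME p. p \<in> V - {q}) \<in> V - {q}" using p by (rule someI)
  show ?thesis
    unfolding fproj_def using onormal_orth[OF V q p p']
    by (simp add: inner_diff_right inner_diff_left inner_commute del: Diff_iff)
qed

text \<open>In terms of height and foot point, the indicator of the prism factors into one of a slab
  and one of the face.\<close>

lemma prism_eq:
  assumes p: "p \<in> V - {q}"
  shows "prism V (V - {q}) = {x. fnormal V q \<bullet> (x - p) \<in> {0..1} \<and> fproj V (V - {q}) x \<in> fhull V q}"
    (is "_ = ?R")
proof (intro equalityI subsetI)
  let ?n = "fnormal V q"
  have nn: "?n \<bullet> ?n = 1" using norm_onormal[OF V q] by (simp add: norm_eq_1)
  fix x
  {
    assume "x \<in> prism V (V - {q})"
    then obtain y t where yt: "x = y + t *\<^sub>R ?n" "y \<in> fhull V q" "t \<in> {0..1}" by (auto simp: prism_def)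
    have "?n \<bullet> (y - p) = 0" by (rule face_hull_inner[OF V q p yt(2)])
    then have "?n \<bullet> (x - p) = t" using nn by (simp add: yt(1) inner_diff_right inner_add_right)
    then show "x \<in> ?R" using yt by (simp add: fproj_eq[OF p])
  next
    assume "x \<in> ?R"
    then show "x \<in> prism V (V - {q})"
      unfolding prism_def fproj_eq[OF p]
      by (intro CollectI exI[of _ "x - (?n \<bullet> (x - p)) *\<^sub>R ?n"] exI[of _ "?n \<bullet> (x - p)"]) auto
  }
qed

lemma fproj_prism: "x \<in> prism V (V - {q}) \<Longrightarrow> fproj V (V - {q}) x \<in> fhull V q"
  using simplex_face_nonempty[OF V q] prism_eq by blast

lemma fint_cong:
  assumes "\<And>x. x \<in> fhull V q \<Longrightarrow> f x = g x"
  shows "fintq V q f = fintq V q g"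
  unfolding fint_eq by (rule integral_cong) (simp add: assms fproj_prism)

lemma fint_integrable:
  fixes f :: "real^'n \<Rightarrow> real"
  assumes "continuous_on (fhull V q) f"
  shows "(\<lambda>x. f (fproj V (V - {q}) x)) integrable_on (prism V (V - {q}))"
proof -
  have "continuous_on (prism V (V - {q})) (\<lambda>x. f (fproj V (V - {q}) x))"
  proof (rule continuous_on_compose2[OF assms])
    show "continuous_on (prism V (V - {q})) (fproj V (V - {q}))"
      unfolding fproj_def by (intro continuous_intros)
  qed (use fproj_prism in auto)
  then show ?thesis by (rule continuous_integrable_compact[OF compact_prism[OF V q]])
qed

lemma fint_add:
  fixes f g :: "real^'n \<Rightarrow> real"
  assumes "continuous_on (fhull V q) f" "continuous_on (fhull V q) g"
  shows "fintq V q (\<lambda>x. f x + g x) = fintq V q f + fintq V q g"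
  unfolding fint_eq by (intro integral_add fint_integrable assms)

lemma fint_cmult: "fintq V q (\<lambda>x. c * f x) = c * fintq V q f"
  unfolding fint_eq by simp

lemma fint_diff:
  fixes f g :: "real^'n \<Rightarrow> real"
  assumes "continuous_on (fhull V q) f" "continuous_on (fhull V q) g"
  shows "fintq V q (\<lambda>x. f x - g x) = fintq V q f - fintq V q g"
  unfolding fint_eq by (intro integral_diff fint_integrable assms)

lemma fint_nonneg:
  fixes f :: "real^'n \<Rightarrow> real"
  assumes "continuous_on (fhull V q) f" "\<And>x. x \<in> fhull V q \<Longrightarrow> f x \<ge> 0"
  shows "fintq V q f \<ge> 0"
  unfolding fint_eq by (intro integral_nonneg fint_integrable assms fproj_prism)

lemma fint_nn_integral:
  fixes f :: "real^'n \<Rightarrow> real"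
  assumes f: "continuous_on UNIV f" "\<And>x. x \<in> fhull V q \<Longrightarrow> f x \<ge> 0" and p: "p \<in> V - {q}"
  defines "n \<equiv> fnormal V q"
  shows "ennreal (fintq V q f) =
    (\<integral>\<^sup>+x. indicator {0..1} (n \<bullet> (x - p)) * (indicator (fhull V q) (x - (n \<bullet> (x - p)) *\<^sub>R n) * ennreal (f (x - (n \<bullet> (x - p)) *\<^sub>R n))) \<partial>lborel)"
proof -
  have "((\<lambda>x. f (fproj V (V - {q}) x)) has_integral fintq V q f) (prism V (V - {q}))"
    unfolding fint_eq using fint_integrable[of f] continuous_on_subset[OF f(1)]
    by (intro integrable_integral) auto
  then have "ennreal (fintq V q f) = (\<integral>\<^sup>+x. ennreal (f (fproj V (V - {q}) x)) * indicator (prism V (V - {q})) x \<partial>lborel)"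
    by (intro nn_integral_has_integral_lebesgue'[symmetric] f(2) fproj_prism)
  also have "\<dots> = (\<integral>\<^sup>+x. indicator {0..1} (n \<bullet> (x - p)) * (indicator (fhull V q) (x - (n \<bullet> (x - p)) *\<^sub>R n) * ennreal (f (x - (n \<bullet> (x - p)) *\<^sub>R n))) \<partial>lborel)"
    by (intro nn_integral_cong) (auto simp: indicator_def prism_eq[OF p] fproj_eq[OF p] n_def)
  finally show ?thesis .
qed

text \<open>The prism over the face may be built with edge v instead of the unit normal: the shear
  preserves the integral, and changing the height of the slab from 1 to the height of v multiplies
  it by |n . v|. This expresses face integrals along an edge of the simplex, the direction in which
  the fundamental theorem of calculus will be applied.\<close>

lemma fint_oblique:
  fixes f :: "real^'n \<Rightarrow> real"
  assumes f: "continuous_on UNIV f" "\<And>x. x \<in> fhull V q \<Longrightarrow> f x \<ge> 0" and p: "p \<in> V - {q}"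
  defines "n \<equiv> fnormal V q"
  assumes v: "n \<bullet> v \<noteq> 0"
  defines "l \<equiv> \<lambda>x. (n \<bullet> (x - p)) / (n \<bullet> v)"
  shows "ennreal (\<bar>n \<bullet> v\<bar> * fintq V q f) =
    (\<integral>\<^sup>+x. indicator {0..1} (l x) * (indicator (fhull V q) (x - l x *\<^sub>R v) * ennreal (f (x - l x *\<^sub>R v))) \<partial>lborel)"
proof -
  define h where "h y = (indicator (fhull V q) y * ennreal (f y) :: ennreal)" for y
  have [measurable]: "f \<in> borel_measurable borel" using f(1) by (rule borel_measurable_continuous_onI)
  have [measurable]: "fhull V q \<in> sets borel"
    using compact_hull_simplex[OF V, of "V - {q}"] by (intro borel_closed compact_imp_closed) auto
  have hm [measurable]: "h \<in> borel_measurable borel" unfolding h_def by measurable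
  have nn: "n \<bullet> n = 1" using norm_onormal[OF V q] by (simp add: norm_eq_1 n_def)
  define L where "L x = n \<bullet> (x - p)" for x
  have Lm [measurable]: "L \<in> borel_measurable borel"
    unfolding L_def by (intro borel_measurable_continuous_onI continuous_intros)
  \<comment> \<open>Rescaled so that the height L grows at unit rate along w, as it does along
    n.\<close>
  define w where "w = (1 / (n \<bullet> v)) *\<^sub>R v"
  have Ln: "L (x + s *\<^sub>R n) = L x + s" for x s
    using nn by (simp add: L_def inner_diff_right inner_add_right)
  have Lw: "L (x + s *\<^sub>R w) = L x + s" for x s
    using v by (simp add: L_def w_def inner_diff_right inner_add_right)
  have "ennreal (fintq V q f) = (\<integral>\<^sup>+x. indicator {0..1} (L x) * h (x - L x *\<^sub>R n) \<partial>lborel)"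
    using fint_nn_integral[OF f p] unfolding n_def L_def h_def by simp
  also have "\<dots> = (\<integral>\<^sup>+x. indicator {0..1} (L x) * h (x - L x *\<^sub>R w) \<partial>lborel)"
    by (rule nn_integral_oblique[OF hm Lm Ln Lw])
  finally have 1: "ennreal (fintq V q f) = (\<integral>\<^sup>+x. indicator {0..1} (L x) * h (x - L x *\<^sub>R w) \<partial>lborel)" .
  \<comment> \<open>The range of L over the slab where l lies in [0,1]; its orientation follows the
    sign of n . v.\<close>
  define J where "J = (if n \<bullet> v > 0 then {0..n \<bullet> v} else {n \<bullet> v..0})"
  have J: "emeasure lborel J = ennreal \<bar>n \<bullet> v\<bar>" by (simp add: J_def)
  have [measurable]: "J \<in> sets borel" by (simp add: J_def)
  have "emeasure lborel J * (\<integral>\<^sup>+x. indicator {0..1} (L x) * h (x - L x *\<^sub>R w) \<partial>lborel) =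
     emeasure lborel {0..1::real} * (\<integral>\<^sup>+x. indicator J (L x) * h (x - L x *\<^sub>R w) \<partial>lborel)"
    by (rule nn_integral_window[of _ L L w]) (measurable, auto simp: Lw algebra_simps)
  also have "\<dots> = (\<integral>\<^sup>+x. indicator {0..1} (l x) * h (x - l x *\<^sub>R v) \<partial>lborel)"
  proof -
    have "indicator J (L x) = (indicator {0..1} (l x) :: ennreal)" for x
      using v by (auto simp: J_def l_def L_def[symmetric] indicator_def field_simps)
    moreover have "L x *\<^sub>R w = l x *\<^sub>R v" for x by (simp add: w_def l_def L_def)
    ultimately show ?thesis by simp
  qed
  finally have "ennreal \<bar>n \<bullet> v\<bar> * ennreal (fintq V q f) = (\<integral>\<^sup>+x. indicator {0..1} (l x) * h (x - l x *\<^sub>R v) \<partial>lborel)"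
    unfolding J 1 .
  then show ?thesis by (simp add: ennreal_mult' h_def)
qed

end

section \<open>The divergence theorem on a simplex\<close>

lemma bary_has_derivative:
  "(bary V q has_derivative (\<lambda>h. ((1 / (fnormal V q \<bullet> (q - (SOME p. p \<in> V - {q})))) *\<^sub>R fnormal V q) \<bullet> h)) (at x)"
proof -
  have "bary V q = (\<lambda>x. ((1 / (fnormal V q \<bullet> (q - (SOME p. p \<in> V - {q})))) *\<^sub>R fnormal V q) \<bullet> (x - (SOME p. p \<in> V - {q})))"
    by (simp add: bary_def Let_def fun_eq_iff)
  then show ?thesis by (simp only:) (rule derivative_eq_intros refl | simp)+
qed

text \<open>A line in direction a - b enters the simplex through the face opposite a and leaves
  through the face opposite b, and integrating the derivative of f over the chord gives the
  difference of the two boundary values. Integrating over all such lines yields the identity.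
  Nonnegativity of f and of the derivative keeps everything in \<open>ennreal\<close>, where
  Tonelli's theorem needs no integrability.\<close>

lemma divergence_edge_nonneg:
  fixes f :: "real^'n::finite \<Rightarrow> real" and G :: "real^'n \<Rightarrow> real^'n"
  assumes V: "simplex_verts V" and a: "a \<in> V" and b: "b \<in> V" and ab: "a \<noteq> b"
    and f': "\<And>x. (f has_derivative (\<lambda>h. G x \<bullet> h)) (at x)" and G: "continuous_on UNIV G"
    and fpos: "\<And>x. x \<in> convex hull V \<Longrightarrow> f x \<ge> 0"
    and gpos: "\<And>x. x \<in> convex hull V \<Longrightarrow> G x \<bullet> (a - b) \<ge> 0"
  shows "eint V (\<lambda>x. G x \<bullet> (a - b)) =
    (fnormal V a \<bullet> (a - b)) * fintq V a f + (fnormal V b \<bullet> (a - b)) * fintq V b f"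
proof -
  define v where "v = a - b"
  define F where "F x = ennreal (G x \<bullet> v) * indicator (convex hull V) x" for x
  define la where "la = bary V a"
  define lb where "lb = bary V b"
  define ha where "ha y = (indicator (fhull V a) y * ennreal (f y) :: ennreal)" for y
  define hb where "hb y = (indicator (fhull V b) y * ennreal (f y) :: ennreal)" for y
  have fc: "continuous_on UNIV f"
    using f' has_derivative_continuous by (blast intro: continuous_at_imp_continuous_on)
  have [measurable]: "f \<in> borel_measurable borel" "(\<lambda>x. G x \<bullet> v) \<in> borel_measurable borel"
    by (intro borel_measurable_continuous_onI continuous_intros fc G)+
  have [measurable]: "convex hull U \<in> sets borel" if "U \<subseteq> V" for U
    using compact_hull_simplex[OF V that] by (intro borel_closed compact_imp_closed) auto
  have [measurable]: "convex hull V \<in> sets borel" "fhull V a \<in> sets borel" "fhull V b \<in> sets borel"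
    by auto
  have [measurable]: "F \<in> borel_measurable borel" "ha \<in> borel_measurable borel" "hb \<in> borel_measurable borel"
    unfolding F_def ha_def hb_def by measurable
  have [measurable]: "la \<in> borel_measurable borel" "lb \<in> borel_measurable borel"
    unfolding la_def lb_def by (auto intro: borel_measurable_bary V)
  have la: "la (x + s *\<^sub>R v) = la x + s" and lb: "lb (x + s *\<^sub>R v) = lb x - s" for x s
    using ab a b by (simp_all add: la_def lb_def v_def bary_shift[OF V] bary_vertex[OF V])
  have lp: "bary V p (x + s *\<^sub>R v) = bary V p x" if "p \<in> V - {a,b}" for p x s
    using that a b by (auto simp add: v_def bary_shift[OF V] bary_vertex[OF V])
  have na: "fnormal V a \<bullet> v < 0" using onormal_neg[OF V a, of b] b ab by (simp add: v_def)
  have nb: "fnormal V b \<bullet> v > 0"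
    using onormal_neg[OF V b, of a] a ab by (simp add: v_def inner_diff_right)
  \<comment> \<open>The identity on one line. The entry value is added on the left, not subtracted
    on the right, because of \<open>ennreal\<close>. The line is parametrized from its point in the
    plane la = 0.\<close>
  have inner: "(\<integral>\<^sup>+s. F (y + s *\<^sub>R v) \<partial>lborel) + ha y = hb (y + lb y *\<^sub>R v)" if y: "la y = 0" for y
  proof (cases "y \<in> fhull V a")
    case True
    then have yp: "bary V p y \<ge> 0" if "p \<in> V" for p
      using that by (cases "p = a") (auto simp: face_hull[OF V a])
    have in_iff: "y + s *\<^sub>R v \<in> convex hull V \<longleftrightarrow> s \<in> {0..lb y}" for s
    proof -
      have "(\<forall>p\<in>V. bary V p (y + s *\<^sub>R v) \<ge> 0) \<longleftrightarrow> bary V a (y + s *\<^sub>R v) \<ge> 0 \<and> bary V b (y + s *\<^sub>R v) \<ge> 0"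
        using a b lp yp by (metis DiffI insertE singletonD)
      then show ?thesis using la[of y s] lb[of y s] y by (simp add: simplex_hull[OF V] la_def lb_def)
    qed
    have zb: "y + lb y *\<^sub>R v \<in> fhull V b"
      using in_iff[of "lb y"] yp[OF b] lb[of y "lb y"] unfolding face_hull[OF V b] simplex_hull[OF V] lb_def by auto
    have fd: "((\<lambda>s. f (y + s *\<^sub>R v)) has_real_derivative G (y + s *\<^sub>R v) \<bullet> v) (at s)" for s
    proof -
      have "((\<lambda>s. f (y + s *\<^sub>R v)) has_derivative (\<lambda>h. G (y + s *\<^sub>R v) \<bullet> (h *\<^sub>R v))) (at s)"
        by (rule has_derivative_compose[OF _ f']) (auto intro!: derivative_eq_intros)
      then show ?thesis by (rule has_derivative_imp_has_field_derivative) simp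
    qed
    have "(\<integral>\<^sup>+s. F (y + s *\<^sub>R v) \<partial>lborel) = (\<integral>\<^sup>+s. ennreal (G (y + s *\<^sub>R v) \<bullet> v) * indicator {0..lb y} s \<partial>lborel)"
      unfolding F_def using in_iff by (intro nn_integral_cong) (simp add: indicator_def)
    also have "\<dots> = ennreal (f (y + lb y *\<^sub>R v) - f (y + 0 *\<^sub>R v))"
    proof (rule nn_integral_FTC_Icc)
      show "(\<lambda>s. G (y + s *\<^sub>R v) \<bullet> v) \<in> borel_measurable borel"
        by (intro borel_measurable_continuous_onI continuous_intros continuous_on_compose2[OF G]) auto
      show "G (y + s *\<^sub>R v) \<bullet> v \<ge> 0" if "s \<in> {0..lb y}" for s
        using gpos in_iff that v_def by blast
      show "((\<lambda>s. f (y + s *\<^sub>R v)) has_real_derivative G (y + s *\<^sub>R v) \<bullet> v) (at s)" for s by (rule fd)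
      show "0 \<le> lb y" using yp[OF b] by (simp add: lb_def)
    qed
    finally have I: "(\<integral>\<^sup>+s. F (y + s *\<^sub>R v) \<partial>lborel) = ennreal (f (y + lb y *\<^sub>R v) - f y)" by simp
    have fy: "f y \<ge> 0" using fpos in_iff[of 0] yp[OF b] by (simp add: lb_def)
    have "f (y + 0 *\<^sub>R v) \<le> f (y + lb y *\<^sub>R v)"
      using fd yp[OF b] gpos in_iff unfolding v_def[symmetric]
      by (intro DERIV_nonneg_imp_nondecreasing[of 0 "lb y" "\<lambda>s. f (y + s *\<^sub>R v)"]) (auto simp: lb_def)
    then show ?thesis
      unfolding I ha_def hb_def using True zb fy by (simp flip: ennreal_plus)
  next
    \<comment> \<open>The line misses the simplex, so all three terms vanish. A negative coordinate
      other than that of b is unchanged along the line; if that of b is negative, la + lb is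
      constant and negative, so la and lb are never both nonnegative.\<close>
    case False
    then obtain p where p: "p \<in> V - {a}" "bary V p y < 0" using y by (auto simp: face_hull[OF V a] la_def not_le)
    have "y + s *\<^sub>R v \<notin> convex hull V" for s
    proof
      assume "y + s *\<^sub>R v \<in> convex hull V"
      then have *: "bary V r (y + s *\<^sub>R v) \<ge> 0" if "r \<in> V" for r using that by (simp add: simplex_hull[OF V])
      show False
      proof (cases "p = b")
        case True
        then show False using *[OF a] *[OF b] p la[of y s] lb[of y s] y by (simp add: la_def lb_def)
      next
        case False
        then show False using *[of p] lp[of p y s] p by auto
      qed
    qed
    then have "(\<integral>\<^sup>+s. F (y + s *\<^sub>R v) \<partial>lborel) = 0" by (simp add: F_def)
    moreover have "y + lb y *\<^sub>R v \<notin> fhull V b"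
    proof
      assume "y + lb y *\<^sub>R v \<in> fhull V b"
      then have *: "bary V r (y + lb y *\<^sub>R v) \<ge> 0" if "r \<in> V - {b}" for r using that by (simp add: face_hull[OF V b])
      show False
      proof (cases "p = b")
        case True
        then show False using *[of a] a ab p la[of y "lb y"] y by (simp add: la_def lb_def)
      next
        case False
        then show False using *[of p] lp[of p y "lb y"] p by auto
      qed
    qed
    ultimately show ?thesis using False by (simp add: ha_def hb_def)
  qed
  have la0: "la (x - la x *\<^sub>R v) = 0" for x using la[of x "- la x"] by simp
  \<comment> \<open>The exit point is the projection of x along v onto the plane lb = 0; the height
    over this plane that grows along v is - lb.\<close>
  have lb0: "x - la x *\<^sub>R v + lb (x - la x *\<^sub>R v) *\<^sub>R v = x - (- lb x) *\<^sub>R v" for x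
    using lb[of x "- la x"] by (simp add: algebra_simps)
  have E: "ennreal (eint V (\<lambda>x. G x \<bullet> v)) = (\<integral>\<^sup>+x. F x \<partial>lborel)"
    unfolding F_def eint_def
  proof (rule nn_integral_has_integral_lebesgue'[symmetric])
    show "((\<lambda>x. G x \<bullet> v) has_integral integral (convex hull V) (\<lambda>x. G x \<bullet> v)) (convex hull V)"
      by (intro integrable_integral eint_integrable[OF V] continuous_intros continuous_on_subset[OF G]) auto
  qed (use gpos v_def in auto)
  have fp: "f x \<ge> 0" if "x \<in> fhull V c" for x c
    using that hull_mono[of "V - {c}" V convex] fpos by auto
  have A: "ennreal (\<bar>fnormal V a \<bullet> v\<bar> * fintq V a f) = (\<integral>\<^sup>+x. indicator {0..1} (la x) * ha (x - la x *\<^sub>R v) \<partial>lborel)"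
  proof -
    have "la x = (fnormal V a \<bullet> (x - b)) / (fnormal V a \<bullet> v)" for x
      unfolding la_def v_def using b ab by (intro bary_eq[OF V a]) auto
    then show ?thesis
      unfolding ha_def using na b ab fp by (simp only:) (rule fint_oblique[OF V a fc], auto)
  qed
  have B: "ennreal (\<bar>fnormal V b \<bullet> v\<bar> * fintq V b f) = (\<integral>\<^sup>+x. indicator {0..1} (- lb x) * hb (x - (- lb x) *\<^sub>R v) \<partial>lborel)"
  proof -
    have "- lb x = (fnormal V b \<bullet> (x - a)) / (fnormal V b \<bullet> v)" for x
    proof -
      have "lb x = (fnormal V b \<bullet> (x - a)) / (fnormal V b \<bullet> (b - a))"
        unfolding lb_def using a ab by (intro bary_eq[OF V b]) auto
      moreover have "fnormal V b \<bullet> (b - a) = - (fnormal V b \<bullet> v)" by (simp add: v_def inner_diff_right)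
      ultimately show ?thesis by simp
    qed
    then show ?thesis
      unfolding hb_def using nb a ab fp by (simp only:) (rule fint_oblique[OF V b fc], auto)
  qed
  have "ennreal (eint V (\<lambda>x. G x \<bullet> v)) + ennreal (\<bar>fnormal V a \<bullet> v\<bar> * fintq V a f) =
      (\<integral>\<^sup>+x. indicator {0..1} (la x) * (\<integral>\<^sup>+s. F (x - la x *\<^sub>R v + s *\<^sub>R v) \<partial>lborel) \<partial>lborel) +
      (\<integral>\<^sup>+x. indicator {0..1} (la x) * ha (x - la x *\<^sub>R v) \<partial>lborel)"
    unfolding E A using nn_integral_along[of F la v] la by simp
  also have "\<dots> = (\<integral>\<^sup>+x. indicator {0..1} (la x) * ((\<integral>\<^sup>+s. F (x - la x *\<^sub>R v + s *\<^sub>R v) \<partial>lborel) + ha (x - la x *\<^sub>R v)) \<partial>lborel)"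
    by (subst nn_integral_add[symmetric]) (auto simp: distrib_left)
  also have "\<dots> = (\<integral>\<^sup>+x. indicator {0..1} (la x) * hb (x - (- lb x) *\<^sub>R v) \<partial>lborel)"
    unfolding inner[OF la0] lb0 ..
  \<comment> \<open>The exit term is constant along v, so the slab measured by la may be exchanged
    for the one measured by - lb, which belongs to the face opposite b.\<close>
  also have "\<dots> = (\<integral>\<^sup>+x. indicator {0..1} (- lb x) * hb (x - (- lb x) *\<^sub>R v) \<partial>lborel)"
    using nn_integral_window[of "\<lambda>x. hb (x - (- lb x) *\<^sub>R v)" la "\<lambda>x. - lb x" v "{0..1}" "{0..1}"] la lb
    by (simp add: algebra_simps)
  also have "\<dots> = ennreal (\<bar>fnormal V b \<bullet> v\<bar> * fintq V b f)" using B by simp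
  finally have "eint V (\<lambda>x. G x \<bullet> v) + \<bar>fnormal V a \<bullet> v\<bar> * fintq V a f = \<bar>fnormal V b \<bullet> v\<bar> * fintq V b f"
  proof -
    have "eint V (\<lambda>x. G x \<bullet> v) \<ge> 0"
      unfolding eint_def using gpos unfolding v_def
      by (intro integral_nonneg eint_integrable[OF V] continuous_intros continuous_on_subset[OF G]) auto
    moreover have "fintq V c f \<ge> 0" if "c \<in> V" for c
    proof -
      have "fhull V c \<subseteq> convex hull V" by (rule hull_mono) auto
      then show ?thesis
        using fpos continuous_on_subset[OF fc] by (intro fint_nonneg[OF V that]) auto
    qed
    note this[OF a] this[OF b]
    moreover assume "ennreal (eint V (\<lambda>x. G x \<bullet> v)) + ennreal (\<bar>fnormal V a \<bullet> v\<bar> * fintq V a f)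
       = ennreal (\<bar>fnormal V b \<bullet> v\<bar> * fintq V b f)"
    ultimately show ?thesis
      by (simp flip: ennreal_plus)
  qed
  then show ?thesis using na nb unfolding v_def by simp
qed


text \<open>Both sides are linear in f and its gradient, so the nonnegative case is applied to f + h
  and to h, and the results are subtracted.\<close>

lemma divergence_edge:
  fixes f :: "real^'n::finite \<Rightarrow> real" and G :: "real^'n \<Rightarrow> real^'n"
  assumes V: "simplex_verts V" and a: "a \<in> V" and b: "b \<in> V" and ab: "a \<noteq> b"
    and f': "\<And>x. (f has_derivative (\<lambda>h. G x \<bullet> h)) (at x)" and G: "continuous_on UNIV G"
  shows "eint V (\<lambda>x. G x \<bullet> (a - b)) =
    (fnormal V a \<bullet> (a - b)) * fintq V a f + (fnormal V b \<bullet> (a - b)) * fintq V b f"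
proof -
  have fc: "continuous_on UNIV f"
    using f' has_derivative_continuous by (blast intro: continuous_at_imp_continuous_on)
  have Vc: "compact (convex hull V)" by (rule compact_hull_simplex[OF V order_refl])
  have bound: "\<exists>M\<ge>0. \<forall>x\<in>convex hull V. \<bar>h x\<bar> \<le> M" if "continuous_on UNIV h" for h :: "real^'n \<Rightarrow> real"
  proof -
    have "bounded (h ` (convex hull V))"
      using that Vc continuous_on_subset compact_continuous_image compact_imp_bounded by blast
    then obtain M where "\<And>x. x \<in> convex hull V \<Longrightarrow> \<bar>h x\<bar> \<le> M" by (auto simp: bounded_iff)
    then show ?thesis by (intro exI[of _ "max M 0"]) (auto simp: le_max_iff_disj)
  qed
  obtain M where M: "M \<ge> 0" "\<And>x. x \<in> convex hull V \<Longrightarrow> \<bar>G x \<bullet> (a - b)\<bar> \<le> M"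
    using bound[of "\<lambda>x. G x \<bullet> (a - b)"] continuous_on_inner[OF G continuous_on_const] by blast
  obtain N where N: "N \<ge> 0" "\<And>x. x \<in> convex hull V \<Longrightarrow> \<bar>f x\<bar> \<le> N"
    using bound[OF fc] by blast
  define k where "k = (1 / (fnormal V a \<bullet> (a - (SOME p. p \<in> V - {a})))) *\<^sub>R fnormal V a"
  have bd: "(bary V a has_derivative (\<lambda>h. k \<bullet> h)) (at x)" for x
    unfolding k_def by (rule bary_has_derivative)
  have kab: "k \<bullet> (a - b) = 1"
  proof -
    have "bary V a x = k \<bullet> (x - (SOME p. p \<in> V - {a}))" for x by (simp add: k_def bary_def Let_def)
    then have "bary V a a - bary V a b = k \<bullet> (a - b)" by (simp add: inner_diff_right)
    then show ?thesis using a b ab by (simp add: bary_vertex[OF V])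
  qed
  (* Adding h makes both the function and its derivative along a - b nonnegative on the simplex. *)
  define h where "h x = M * bary V a x + N" for x
  have hc: "continuous_on UNIV h"
    unfolding h_def by (intro continuous_intros continuous_bary[OF V])
  have hd: "(h has_derivative (\<lambda>y. (M *\<^sub>R k) \<bullet> y)) (at x)" for x
    unfolding h_def by (rule derivative_eq_intros bd refl | simp)+
  have hN: "h x \<ge> N" if "x \<in> convex hull V" for x
    using that a M(1) by (simp add: h_def simplex_hull[OF V])
  have fhd: "((\<lambda>x. f x + h x) has_derivative (\<lambda>y. (G x + M *\<^sub>R k) \<bullet> y)) (at x)" for x
    by (rule derivative_eq_intros f' hd refl | simp add: inner_add_left)+
  let ?P = "\<lambda>G f. eint V (\<lambda>x. G x \<bullet> (a - b)) =
    (fnormal V a \<bullet> (a - b)) * fintq V a f + (fnormal V b \<bullet> (a - b)) * fintq V b f"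
  have 1: "?P (\<lambda>x. G x + M *\<^sub>R k) (\<lambda>x. f x + h x)"
  proof (rule divergence_edge_nonneg[OF V a b ab fhd])
    show "f x + h x \<ge> 0" if "x \<in> convex hull V" for x using hN[OF that] N(2)[OF that] by linarith
    show "(G x + M *\<^sub>R k) \<bullet> (a - b) \<ge> 0" if "x \<in> convex hull V" for x
      using M(2)[OF that] kab by (simp add: inner_add_left)
  qed (intro continuous_intros G)
  have 2: "?P (\<lambda>x. M *\<^sub>R k) h"
  proof (rule divergence_edge_nonneg[OF V a b ab hd])
    show "h x \<ge> 0" if "x \<in> convex hull V" for x using hN[OF that] N(1) by linarith
    show "(M *\<^sub>R k) \<bullet> (a - b) \<ge> 0" for x using M(1) kab by simp
  qed (intro continuous_intros)
  have "eint V (\<lambda>x. (G x + M *\<^sub>R k) \<bullet> (a - b)) = eint V (\<lambda>x. G x \<bullet> (a - b)) + eint V (\<lambda>x. (M *\<^sub>R k) \<bullet> (a - b))"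
    unfolding inner_add_left
    by (intro eint_add[OF V] continuous_intros continuous_on_subset[OF G]) auto
  moreover have "fintq V c (\<lambda>x. f x + h x) = fintq V c f + fintq V c h" if "c \<in> V" for c
    by (intro fint_add[OF V that] continuous_on_subset[OF fc] continuous_on_subset[OF hc]) auto
  note this[OF a] this[OF b]
  ultimately show ?thesis using 1 2 by (simp add: algebra_simps)
qed

text \<open>Both sides are linear in v, and the edges issuing from one vertex b span the space, so
  the identity along edges is enough.\<close>

theorem simplex_divergence:
  fixes f :: "real^'n::finite \<Rightarrow> real" and G :: "real^'n \<Rightarrow> real^'n"
  assumes V: "simplex_verts V"
    and f': "\<And>x. (f has_derivative (\<lambda>h. G x \<bullet> h)) (at x)" and G: "continuous_on UNIV G"
  shows "eint V (\<lambda>x. G x \<bullet> v) = (\<Sum>e\<in>faces V. (onormal V e \<bullet> v) * fint V e f)"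
proof -
  have fV: "finite V" using simplex_vertsD[OF V] by simp
  obtain b where b: "b \<in> V" using simplex_vertsD[OF V] by fastforce
  define R where "R v = (\<Sum>q\<in>V. (fnormal V q \<bullet> v) * fintq V q f)" for v
  define E where "E v = eint V (\<lambda>x. G x \<bullet> v)" for v
  have Eadd: "E (x + y) = E x + E y" for x y
    unfolding E_def inner_add_right
    by (intro eint_add[OF V] continuous_intros continuous_on_subset[OF G]) auto
  have Escale: "E (c *\<^sub>R x) = c * E x" for c x
    unfolding E_def by (simp add: eint_cmult)
  have edge: "E (a - b) = R (a - b)" if a: "a \<in> V" for a
  proof (cases "a = b")
    case True then show ?thesis by (simp add: E_def R_def eint_def)
  next
    case False
    \<comment> \<open>Every face that contains both a and b is parallel to this edge, so only the
      faces opposite a and b contribute.\<close>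
    have z: "fnormal V q \<bullet> (a - b) = 0" if "q \<in> V - {a,b}" for q
      using that a b False by (intro onormal_orth[OF V]) auto
    have "R (a - b) = (\<Sum>q\<in>{a,b}. (fnormal V q \<bullet> (a - b)) * fintq V q f)"
      unfolding R_def using a b z fV by (intro sum.mono_neutral_right) auto
    then show ?thesis using divergence_edge[OF V a b False f' G] False by (simp add: E_def)
  qed
  have Esum: "E (\<Sum>q\<in>I. c q *\<^sub>R g q) = (\<Sum>q\<in>I. c q * E (g q))" for I :: "(real^'n) set" and c g
    using Escale[of 0 0] by (induction I rule: infinite_finite_induct) (auto simp: Eadd Escale)
  have Rsum: "R (\<Sum>q\<in>I. c q *\<^sub>R g q) = (\<Sum>q\<in>I. c q * R (g q))" for I :: "(real^'n) set" and c g
    unfolding R_def by (simp add: inner_sum_right sum_distrib_left sum_distrib_right mult_ac) (rule sum.swap)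
  \<comment> \<open>Differences of barycentric coordinates sum to zero, so b can be subtracted from
    each vertex and v becomes a combination of edges.\<close>
  define c where "c q = bary V q v - bary V q 0" for q
  have "v = (\<Sum>q\<in>V. c q *\<^sub>R (q - b))"
  proof -
    have "(\<Sum>q\<in>V. c q) = 0" unfolding c_def by (simp add: sum_subtractf bary_sum[OF V])
    moreover have "(\<Sum>q\<in>V. c q *\<^sub>R q) = v"
      unfolding c_def by (simp add: scaleR_diff_left sum_subtractf bary_repr[OF V])
    ultimately show ?thesis by (simp add: scaleR_diff_right sum_subtractf flip: scaleR_sum_left)
  qed
  then have "E v = R v" using Esum[of c "\<lambda>q. q - b" V] Rsum[of c "\<lambda>q. q - b" V] edge by (simp cong: sum.cong)
  then show ?thesis unfolding E_def R_def sum_faces .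
qed

section \<open>Polynomial spaces\<close>

lemma finite_multi_indices: "finite (multi_indices r :: ('n::finite \<Rightarrow> nat) set)"
proof -
  have "multi_indices r \<subseteq> {\<alpha>::'n \<Rightarrow> nat. \<forall>i. (i \<in> UNIV \<longrightarrow> \<alpha> i \<in> {..r}) \<and> (i \<notin> UNIV \<longrightarrow> \<alpha> i = 0)}"
  proof
    fix \<alpha> :: "'n \<Rightarrow> nat" assume a: "\<alpha> \<in> multi_indices r"
    have "\<alpha> i \<le> sum \<alpha> UNIV" for i by (rule member_le_sum) auto
    then have "\<alpha> i \<le> r" for i using a by (simp add: multi_indices_def) (metis order_trans)
    then show "\<alpha> \<in> {\<alpha>. \<forall>i. (i \<in> UNIV \<longrightarrow> \<alpha> i \<in> {..r}) \<and> (i \<notin> UNIV \<longrightarrow> \<alpha> i = 0)}" by simp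
  qed
  moreover have "finite \<dots>" by (rule finite_set_of_finite_funs) auto
  ultimately show ?thesis by (rule finite_subset)
qed

lemma subspace_polys: "subspace (polys r :: (real^'n::finite \<Rightarrow> real) set)"
proof (rule subspaceI)
  show "0 \<in> polys r" unfolding polys_def by (intro CollectI exI[of _ "\<lambda>_. 0"]) (simp add: fun_eq_iff)
next
  fix x y :: "real^'n \<Rightarrow> real" assume "x \<in> polys r" "y \<in> polys r"
  then obtain c d where "x = (\<lambda>x. \<Sum>\<alpha>\<in>multi_indices r. c \<alpha> * monomial \<alpha> x)" "y = (\<lambda>x. \<Sum>\<alpha>\<in>multi_indices r. d \<alpha> * monomial \<alpha> x)"
    by (auto simp: polys_def)
  then show "x + y \<in> polys r" unfolding polys_def
    by (intro CollectI exI[of _ "\<lambda>\<alpha>. c \<alpha> + d \<alpha>"]) (simp add: fun_eq_iff distrib_right sum.distrib)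
next
  fix a :: real and x :: "real^'n \<Rightarrow> real" assume "x \<in> polys r"
  then obtain c where "x = (\<lambda>x. \<Sum>\<alpha>\<in>multi_indices r. c \<alpha> * monomial \<alpha> x)" by (auto simp: polys_def)
  then show "a *\<^sub>R x \<in> polys r" unfolding polys_def
    by (intro CollectI exI[of _ "\<lambda>\<alpha>. a * c \<alpha>"]) (simp add: fun_eq_iff sum_distrib_left mult.assoc)
qed

lemma monomial_in_polys:
  assumes "\<alpha> \<in> multi_indices r"
  shows "monomial \<alpha> \<in> polys r"
proof -
  have "(\<Sum>\<beta>\<in>multi_indices r. (if \<beta> = \<alpha> then 1 else 0) * monomial \<beta> x) =
      (\<Sum>\<beta>\<in>multi_indices r. if \<beta> = \<alpha> then monomial \<beta> x else 0)" for x
    by (intro sum.cong) auto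
  then have "(\<Sum>\<beta>\<in>multi_indices r. (if \<beta> = \<alpha> then 1 else 0) * monomial \<beta> x) = monomial \<alpha> x" for x
    using assms by (simp add: finite_multi_indices)
  then show ?thesis
    unfolding polys_def by (intro CollectI exI[of _ "\<lambda>\<beta>. if \<beta> = \<alpha> then 1 else 0"] ext) (rule sym)
qed

lemma polys_eq_span: "polys r = span (monomial ` multi_indices r)"
proof
  show "span (monomial ` multi_indices r) \<subseteq> polys r"
    by (intro span_minimal subspace_polys) (auto intro: monomial_in_polys)
  show "polys r \<subseteq> span (monomial ` multi_indices r)"
  proof
    fix p assume "p \<in> polys r"
    then obtain c where "p = (\<lambda>x. \<Sum>\<alpha>\<in>multi_indices r. c \<alpha> * monomial \<alpha> x)" by (auto simp: polys_def)
    then have "p = (\<Sum>\<alpha>\<in>multi_indices r. c \<alpha> *\<^sub>R monomial \<alpha>)" by (simp add: fun_eq_iff sum_fun_apply)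
    then show "p \<in> span (monomial ` multi_indices r)" by (simp only:) (intro span_sum span_scale span_base imageI)
  qed
qed

lemma polys_mono: "r \<le> s \<Longrightarrow> polys r \<subseteq> polys s"
  unfolding polys_eq_span by (intro span_mono image_mono) (auto simp: multi_indices_def)

lemma polys_fun:
  fixes p q :: "real^'n::finite \<Rightarrow> real" and P :: "'i \<Rightarrow> real^'n \<Rightarrow> real"
  shows polys_add: "p \<in> polys r \<Longrightarrow> q \<in> polys r \<Longrightarrow> (\<lambda>x. p x + q x) \<in> polys r"
    and polys_cmult: "p \<in> polys r \<Longrightarrow> (\<lambda>x. c * p x) \<in> polys r"
    and polys_const: "(\<lambda>x::real^'n. c) \<in> polys r"
    and polys_sum: "(\<And>i. i \<in> I \<Longrightarrow> P i \<in> polys r) \<Longrightarrow> (\<lambda>x. \<Sum>i\<in>I. P i x) \<in> polys r"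
proof -
  show "p \<in> polys r \<Longrightarrow> q \<in> polys r \<Longrightarrow> (\<lambda>x. p x + q x) \<in> polys r"
    using subspace_add[OF subspace_polys, of p r q] by (simp add: plus_fun_def)
  show s: "p \<in> polys r \<Longrightarrow> (\<lambda>x. c * p x) \<in> polys r" for p :: "real^'n \<Rightarrow> real" and c
    using subspace_scale[OF subspace_polys, of p r c] by (simp add: scaleR_fun_def)
  have "monomial (\<lambda>_. 0) = (\<lambda>_::real^'n. 1)" by (simp add: monomial_def fun_eq_iff)
  then show "(\<lambda>x::real^'n. c) \<in> polys r"
    using s[of "monomial (\<lambda>_. 0)" c] monomial_in_polys[of "\<lambda>_::'n. 0" r] by (simp add: multi_indices_def)
  show "(\<And>i. i \<in> I \<Longrightarrow> P i \<in> polys r) \<Longrightarrow> (\<lambda>x. \<Sum>i\<in>I. P i x) \<in> polys r"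
    using subspace_sum[OF subspace_polys, of I P r] by (simp add: sum_fun_apply[abs_def])
qed

text \<open>Natural subtraction makes the exponent \<open>\<alpha> i - 1\<close> wrong for
  \<open>\<alpha> i = 0\<close>, but the factor \<open>real (\<alpha> i)\<close> is then
  zero.\<close>

lemma monomial_has_derivative:
  fixes x :: "real^'n::finite"
  shows "(monomial \<alpha> has_derivative (\<lambda>h. (\<chi> i. real (\<alpha> i) * monomial (\<alpha>(i := \<alpha> i - 1)) x) \<bullet> h)) (at x)"
proof -
  have "((\<lambda>x::real^'n. \<Prod>i\<in>UNIV. (x $ i) ^ (\<alpha> i)) has_derivative
    (\<lambda>h. \<Sum>i\<in>UNIV. (real (\<alpha> i) * (x $ i) ^ (\<alpha> i - 1) * h $ i) * (\<Prod>j\<in>UNIV - {i}. (x $ j) ^ (\<alpha> j)))) (at x)"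
  proof (rule has_derivative_prod)
    fix i
    have "((\<lambda>x. x $ i) has_derivative (\<lambda>h. h $ i)) (at x)"
      by (rule bounded_linear_imp_has_derivative[OF bounded_linear_vec_nth])
    from has_derivative_power[OF this, of "\<alpha> i"]
    show "((\<lambda>x. (x $ i) ^ \<alpha> i) has_derivative (\<lambda>h. real (\<alpha> i) * (x $ i) ^ (\<alpha> i - 1) * h $ i)) (at x)"
      by (simp add: mult_ac)
  qed
  moreover have "(real (\<alpha> i) * (x $ i) ^ (\<alpha> i - 1) * h $ i) * (\<Prod>j\<in>UNIV - {i}. (x $ j) ^ (\<alpha> j)) =
      (real (\<alpha> i) * monomial (\<alpha>(i := \<alpha> i - 1)) x) * h $ i" for i h
  proof -
    have "monomial (\<alpha>(i := \<alpha> i - 1)) x = (x $ i) ^ (\<alpha> i - 1) * (\<Prod>j\<in>UNIV - {i}. (x $ j) ^ (\<alpha> j))"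
      unfolding monomial_def by (subst prod.remove[of UNIV i]) auto
    then show ?thesis by simp
  qed
  moreover have "monomial \<alpha> = (\<lambda>x::real^'n. \<Prod>i\<in>UNIV. (x $ i) ^ (\<alpha> i))" by (simp add: fun_eq_iff monomial_def)
  ultimately show ?thesis by (simp only: inner_vec_def vec_lambda_beta inner_real_def)
qed

lemma partial_eq:
  assumes "(f has_derivative (\<lambda>h. G \<bullet> h)) (at x)"
  shows "partial i f x = G $ i"
proof -
  have "((\<lambda>t. f (x + t *\<^sub>R axis i 1)) has_derivative (\<lambda>h. G \<bullet> (h *\<^sub>R axis i 1))) (at 0)"
    by (rule has_derivative_compose[of _ _ _ _ f]) (auto intro!: derivative_eq_intros assms)
  then have "((\<lambda>t. f (x + t *\<^sub>R axis i 1)) has_real_derivative G $ i) (at 0)"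
    by (rule has_derivative_imp_has_field_derivative) (simp add: inner_axis mult.commute)
  then show ?thesis unfolding partial_def by (rule DERIV_imp_deriv)
qed

lemma grad_eq: "(f has_derivative (\<lambda>h. G \<bullet> h)) (at x) \<Longrightarrow> grad f x = G"
  by (simp add: grad_def partial_eq vec_eq_iff)

lemma
  assumes "p \<in> polys r"
  shows polys_has_derivative: "(p has_derivative (\<lambda>h. grad p x \<bullet> h)) (at x)"
    and partial_in_polys: "partial i p \<in> polys (r - 1)"
proof -
  obtain c where p: "p = (\<lambda>x. \<Sum>\<alpha>\<in>multi_indices r. c \<alpha> * monomial \<alpha> x)" using assms by (auto simp: polys_def)
  define G where "G x = (\<Sum>\<alpha>\<in>multi_indices r. c \<alpha> *\<^sub>R (\<chi> i. real (\<alpha> i) * monomial (\<alpha>(i := \<alpha> i - 1)) x))" for x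
  have d: "(p has_derivative (\<lambda>h. G x \<bullet> h)) (at x)" for x
    unfolding p G_def
    by (rule derivative_eq_intros monomial_has_derivative refl | simp add: inner_sum_left)+
  then show "(p has_derivative (\<lambda>h. grad p x \<bullet> h)) (at x)" using grad_eq[OF d] by simp
  have "partial i p x = (\<Sum>\<alpha>\<in>multi_indices r. c \<alpha> * (real (\<alpha> i) * monomial (\<alpha>(i := \<alpha> i - 1)) x))" for x
    using partial_eq[OF d] by (simp add: G_def)
  moreover have "(\<lambda>x. \<Sum>\<alpha>\<in>multi_indices r. c \<alpha> * (real (\<alpha> i) * monomial (\<alpha>(i := \<alpha> i - 1)) x)) \<in> polys (r - 1)"
  proof (rule polys_sum)
    fix \<alpha> :: "'a \<Rightarrow> nat" assume \<alpha>: "\<alpha> \<in> multi_indices r"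
    show "(\<lambda>x. c \<alpha> * (real (\<alpha> i) * monomial (\<alpha>(i := \<alpha> i - 1)) x)) \<in> polys (r - 1)"
    proof (cases "\<alpha> i = 0")
      case True then show ?thesis using polys_const[of 0] by simp
    next
      case False
      have "sum \<alpha> UNIV = \<alpha> i + sum \<alpha> (UNIV - {i})" by (rule sum.remove) auto
      moreover have "sum (\<alpha>(i := \<alpha> i - 1)) UNIV = (\<alpha> i - 1) + sum \<alpha> (UNIV - {i})"
        by (subst sum.remove[of UNIV i]) auto
      ultimately have "\<alpha>(i := \<alpha> i - 1) \<in> multi_indices (r - 1)" using False \<alpha> by (simp add: multi_indices_def)
      then show ?thesis by (intro polys_cmult monomial_in_polys)
    qed
  qed
  ultimately show "partial i p \<in> polys (r - 1)" by presburger
qed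

lemma continuous_polys: "p \<in> polys r \<Longrightarrow> continuous_on S p"
  using polys_has_derivative has_derivative_continuous by (blast intro: continuous_at_imp_continuous_on)

lemma grad_in_vpolys: "p \<in> polys r \<Longrightarrow> grad p \<in> vpolys (r - 1)"
  using partial_in_polys[of p r] by (simp add: vpolys_def grad_def)

lemma continuous_vpolys: "p \<in> vpolys r \<Longrightarrow> continuous_on S p"
  using continuous_on_vec_lambda[of S "\<lambda>i x. p x $ i"] continuous_polys by (auto simp: vpolys_def)


section \<open>Restriction of polynomials to lines\<close>

lemma polys_along_line:
  fixes p :: "real^'n::finite \<Rightarrow> real"
  assumes "p \<in> polys r"
  shows "\<exists>Q :: real poly. \<forall>t. p (x + t *\<^sub>R d) = poly Q t"
proof -
  obtain c where p: "p = (\<lambda>x. \<Sum>\<alpha>\<in>multi_indices r. c \<alpha> * monomial \<alpha> x)" using assms by (auto simp: polys_def)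
  have "p (x + t *\<^sub>R d) = poly (\<Sum>\<alpha>\<in>multi_indices r. Polynomial.smult (c \<alpha>) (\<Prod>i\<in>UNIV. [:x $ i, d $ i:] ^ \<alpha> i)) t" for t
    unfolding p by (simp add: poly_sum poly_prod monomial_def)
  then show ?thesis by blast
qed

text \<open>On the line from a point of S to any y the polynomial has infinitely many roots near
  that point, so it vanishes along the whole line, in particular at parameter 1.\<close>

lemma polys_zero_on_open:
  fixes p :: "real^'n::finite \<Rightarrow> real"
  assumes p: "p \<in> polys r" and S: "open S" "S \<noteq> {}" and z: "\<And>x. x \<in> S \<Longrightarrow> p x = 0"
  shows "p = (\<lambda>_. 0)"
proof
  fix y
  obtain x where "x \<in> S" using S by blast
  obtain Q where Q: "\<And>t. p (x + t *\<^sub>R (y - x)) = poly Q t" using polys_along_line[OF p] by blast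
  have "open ((\<lambda>t. x + t *\<^sub>R (y - x)) -` S)"
    by (intro open_vimage S(1) continuous_intros)
  moreover have "0 \<in> (\<lambda>t. x + t *\<^sub>R (y - x)) -` S" using \<open>x \<in> S\<close> by simp
  ultimately have "infinite ((\<lambda>t. x + t *\<^sub>R (y - x)) -` S)"
    using finite_imp_not_open by blast
  moreover have "(\<lambda>t. x + t *\<^sub>R (y - x)) -` S \<subseteq> {t. poly Q t = 0}" using z by (auto simp: Q[symmetric])
  ultimately have "Q = 0" using poly_roots_finite finite_subset by blast
  then show "p y = 0" using Q[of 1] by simp
qed

lemma subspace_vpolys: "subspace (vpolys r)"
  unfolding vpolys_def
  by (intro subspaceI) (auto simp: polys_add polys_cmult intro: polys_const[of 0])

lemma fin_gen_polys: "\<exists>S. finite S \<and> polys r \<subseteq> span S"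
  unfolding polys_eq_span using finite_multi_indices by blast

lemma fin_gen_vpolys: "\<exists>S. finite S \<and> (vpolys r :: (real^'n::finite \<Rightarrow> real^'n) set) \<subseteq> span S"
proof -
  obtain S :: "(real^'n \<Rightarrow> real) set" where S: "finite S" "polys r \<subseteq> span S" using fin_gen_polys by blast
  define T where "T = (\<lambda>(p,i::'n) x. p x *\<^sub>R axis i (1::real)) ` (S \<times> UNIV)"
  have *: "(\<lambda>x. p x *\<^sub>R axis i (1::real)) \<in> span T" if "p \<in> span S" for p i
    using that
  proof (induction p rule: span_induct_alt)
    case base
    then show ?case using span_zero[of T] by (simp add: zero_fun_def)
  next
    case (step c p q)
    have "(\<lambda>x. p x *\<^sub>R axis i (1::real)) \<in> span T"
      using step(1) by (intro span_base) (auto simp: T_def)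
    then have "c *\<^sub>R (\<lambda>x. p x *\<^sub>R axis i (1::real)) + (\<lambda>x. q x *\<^sub>R axis i (1::real)) \<in> span T"
      using step by (intro span_add span_scale)
    then show ?case by (simp add: plus_fun_def scaleR_fun_def scaleR_left_distrib)
  qed
  have "vpolys r \<subseteq> span T"
  proof
    fix p :: "real^'n \<Rightarrow> real^'n" assume p: "p \<in> vpolys r"
    have "p = (\<Sum>i\<in>UNIV. (\<lambda>x. (p x $ i) *\<^sub>R axis i (1::real)))"
      by (simp add: fun_eq_iff sum_fun_apply vec_eq_iff axis_def if_distrib[of "(*) _"] sum.delta cong: if_cong)
    also have "\<dots> \<in> span T" using p S(2) by (intro span_sum *) (auto simp: vpolys_def)
    finally show "p \<in> span T" .
  qed
  moreover have "finite T" using S(1) by (simp add: T_def)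
  ultimately show ?thesis by blast
qed

lemma continuous_divg: "\<tau> \<in> vpolys r \<Longrightarrow> continuous_on S (divg \<tau>)"
  unfolding divg_def[abs_def]
  by (intro continuous_intros continuous_polys[OF partial_in_polys]) (auto simp: vpolys_def)

lemma continuous_grad: "p \<in> polys r \<Longrightarrow> continuous_on S (grad p)"
  by (rule continuous_vpolys[OF grad_in_vpolys])

lemma divg_eq:
  assumes "\<tau> \<in> vpolys r"
  shows "divg \<tau> x = (\<Sum>i\<in>UNIV. grad (\<lambda>y. \<tau> y $ i) x $ i)"
  by (simp add: divg_def grad_def)

text \<open>\<open>deriv\<close> need not be additive without differentiability; polynomial
  components provide it.\<close>

lemma divg_add: "\<sigma> \<in> vpolys r \<Longrightarrow> \<tau> \<in> vpolys r \<Longrightarrow> divg (\<sigma> + \<tau>) x = divg \<sigma> x + divg \<tau> x"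
  and divg_scale: "\<tau> \<in> vpolys r \<Longrightarrow> divg (c *\<^sub>R \<tau>) x = c * divg \<tau> x"
proof -
  have d: "((\<lambda>y. \<tau> y $ i) has_derivative (\<lambda>h. grad (\<lambda>y. \<tau> y $ i) x \<bullet> h)) (at x)" if "\<tau> \<in> vpolys r" for i and \<tau> :: "real^'a \<Rightarrow> real^'a"
    using that by (intro polys_has_derivative[of _ r]) (auto simp: vpolys_def)
  show "divg (\<sigma> + \<tau>) x = divg \<sigma> x + divg \<tau> x" if "\<sigma> \<in> vpolys r" "\<tau> \<in> vpolys r"
  proof -
    have *: "((\<lambda>y. (\<sigma> + \<tau>) y $ i) has_derivative (\<lambda>h. (grad (\<lambda>y. \<sigma> y $ i) x + grad (\<lambda>y. \<tau> y $ i) x) \<bullet> h)) (at x)" for i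
      using has_derivative_add[OF d[OF that(1), of i] d[OF that(2), of i]] by (simp add: inner_add_left)
    then show ?thesis
      unfolding divg_def partial_eq[OF *] partial_eq[OF d[OF that(1)]] partial_eq[OF d[OF that(2)]]
      by (simp add: sum.distrib)
  qed
  show "divg (c *\<^sub>R \<tau>) x = c * divg \<tau> x" if "\<tau> \<in> vpolys r"
  proof -
    have *: "((\<lambda>y. (c *\<^sub>R \<tau>) y $ i) has_derivative (\<lambda>h. (c *\<^sub>R grad (\<lambda>y. \<tau> y $ i) x) \<bullet> h)) (at x)" for i
      using has_derivative_mult_right[OF d[OF that, of i], of c] by simp
    then show ?thesis
      unfolding divg_def partial_eq[OF *] partial_eq[OF d[OF that]] by (simp add: sum_distrib_left)
  qed
qed

lemma grad_add: "p \<in> polys r \<Longrightarrow> q \<in> polys r \<Longrightarrow> grad (p + q) x = grad p x + grad q x"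
  using has_derivative_add[OF polys_has_derivative[of p r x] polys_has_derivative[of q r x]]
  by (intro grad_eq) (simp add: inner_add_left plus_fun_def)

lemma grad_scale: "p \<in> polys r \<Longrightarrow> grad (c *\<^sub>R p) x = c *\<^sub>R grad p x"
  using has_derivative_mult_right[OF polys_has_derivative[of p r x], of c]
  by (intro grad_eq) (simp add: scaleR_fun_def)

section \<open>Definiteness of the element and face inner products\<close>

text \<open>A positive value would persist on a small ball and make the integral positive. The
  second condition on S guarantees such a ball inside S even near a boundary point.\<close>

lemma integral_zero_imp_zero:
  fixes f :: "'a::euclidean_space \<Rightarrow> real"
  assumes S: "compact S" "S \<subseteq> closure (interior S)" and f: "continuous_on S f"
    and nonneg: "\<And>x. x \<in> S \<Longrightarrow> f x \<ge> 0" and z: "integral S f = 0" and x: "x \<in> S"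
  shows "f x = 0"
proof (rule ccontr)
  assume "f x \<noteq> 0"
  then have fx: "f x > 0" using nonneg[OF x] by simp
  then obtain d where d: "d > 0" "\<And>y. y \<in> S \<Longrightarrow> dist y x < d \<Longrightarrow> dist (f y) (f x) < f x / 2"
    using f x unfolding continuous_on_iff by (metis half_gt_zero)
  \<comment> \<open>x may lie on the boundary of S; a nearby interior point still has f above half
    of f x.\<close>
  obtain y where y: "y \<in> interior S" "dist y x < d"
    using S(2) x d(1) closure_approachable by blast
  have "open (interior S \<inter> ball x d)" by auto
  moreover have "y \<in> interior S \<inter> ball x d" using y by (simp add: dist_commute)
  ultimately obtain e where e: "e > 0" "ball y e \<subseteq> interior S \<inter> ball x d" using openE by blast
  then have eS: "ball y e \<subseteq> S" using interior_subset by blast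
  have fi: "f integrable_on S" by (rule continuous_integrable_compact[OF S(1) f])
  have lb: "f x / 2 \<le> f u" if "u \<in> ball y e" for u
  proof -
    have "u \<in> S" "u \<in> ball x d" using that e(2) eS by blast+
    then have "u \<in> S" "dist u x < d" by (simp_all add: dist_commute)
    from d(2)[OF this] show ?thesis by (simp add: dist_real_def abs_if split: if_splits)
  qed
  have "0 < f x / 2 * measure lebesgue (ball y e)" using fx e(1) content_ball_pos[of e y] by simp
  also have "\<dots> = integral UNIV (\<lambda>u. if u \<in> ball y e then f x / 2 else 0)"
    unfolding integral_restrict_UNIV
    using lmeasure_integral[of "ball y e"] integral_cmul[of "ball y e" "f x / 2" "\<lambda>_. 1::real"] by simp
  also have "\<dots> \<le> integral UNIV (\<lambda>u. if u \<in> S then f u else 0)"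
  proof (rule integral_le)
    show "(\<lambda>u. if u \<in> ball y e then f x / 2 else 0) integrable_on UNIV"
      unfolding integrable_restrict_UNIV by (rule integrable_on_const) simp
    show "(\<lambda>u. if u \<in> S then f u else 0) integrable_on UNIV"
      unfolding integrable_restrict_UNIV by (rule fi)
  qed (use lb eS nonneg in auto)
  also have "\<dots> = 0" using z by (simp add: integral_restrict_UNIV)
  finally show False by simp
qed

lemma simplex_interior_nonempty: 
  assumes "simplex_verts V"
  shows "interior (convex hull V) \<noteq> {}"
  using interior_convex_hull_eq_empty[of V] simplex_vertsD[OF assms] by simp

lemma eint_zero_imp_zero:
  fixes f :: "real^'n::finite \<Rightarrow> real"
  assumes V: "simplex_verts V" and f: "continuous_on (convex hull V) f"
    and "\<And>x. x \<in> convex hull V \<Longrightarrow> f x \<ge> 0" "eint V f = 0" "x \<in> convex hull V"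
  shows "f x = 0"
proof (rule integral_zero_imp_zero[OF _ _ f])
  show c: "compact (convex hull V)" by (rule compact_hull_simplex[OF V order_refl])
  show "convex hull V \<subseteq> closure (interior (convex hull V))"
    using convex_closure_interior[OF convex_convex_hull simplex_interior_nonempty[OF V]]
    by (simp add: closure_subset)
qed (use assms in \<open>auto simp: eint_def\<close>)

text \<open>The strict versions of the conditions in \<open>prism_eq\<close> define an open set,
  which contains the centroid of the face lifted by half the height. For a convex set, nonempty
  interior gives density of the interior.\<close>

lemma prism_interior_nonempty:
  fixes V :: "(real^'n::finite) set"
  assumes V: "simplex_verts V" and q: "q \<in> V"
  shows "interior (prism V (V - {q})) \<noteq> {}"
proof -
  let ?n = "fnormal V q" and ?e = "V - {q}"
  obtain p where p: "p \<in> ?e" using simplex_face_nonempty[OF V q] by blast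
  have nn: "?n \<bullet> ?n = 1" using norm_onormal[OF V q] by (simp add: norm_eq_1)
  define U where "U = {x. 0 < ?n \<bullet> (x - p)} \<inter> {x. ?n \<bullet> (x - p) < 1} \<inter> (\<Inter>r\<in>?e. {x. 0 < bary V r (fproj V ?e x)})"
  have "open U" unfolding U_def fproj_def using simplex_vertsD(1)[OF V]
    by (intro open_Int open_INT ballI open_Collect_less continuous_intros continuous_bary[OF V]) auto
  moreover have "U \<subseteq> prism V ?e"
  proof
    fix x assume x: "x \<in> U"
    have "?n \<bullet> (fproj V ?e x - p) = 0"
      unfolding fproj_eq[OF V q p] using nn by (simp add: inner_diff_right)
    then have "bary V q (fproj V ?e x) = 0" by (simp add: bary_eq[OF V q p])
    then show "x \<in> prism V ?e"
      using x unfolding prism_eq[OF V q p] face_hull[OF V q] U_def by (auto intro: less_imp_le)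
  qed
  moreover have "U \<noteq> {}"
  proof -
    obtain x where x: "bary V q x = 0" "\<And>r. r \<in> V - {q} \<Longrightarrow> bary V r x = 1 / real CARD('n)"
      by (rule face_centroid[OF V q]) blast
    then have nx: "?n \<bullet> (x - p) = 0" using onormal_neg[OF V q p] by (simp add: bary_eq[OF V q p])
    have nx2: "?n \<bullet> (x + (1/2) *\<^sub>R ?n - p) = 1/2" using nx nn by (simp add: inner_diff_right inner_add_right)
    have "fproj V ?e (x + (1/2) *\<^sub>R ?n) = x" unfolding fproj_eq[OF V q p] nx2 by simp
    then have "x + (1/2) *\<^sub>R ?n \<in> U" unfolding U_def using nx2 x(2) by auto
    then show ?thesis by blast
  qed
  ultimately show ?thesis using interior_maximal by blast
qed

lemma convex_prism: "convex (prism V e)"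
proof -
  have "prism V e = (\<lambda>(y,t). y + t *\<^sub>R onormal V e) ` ((convex hull e) \<times> {0..1})"
    unfolding prism_def by (auto simp: image_iff) blast
  moreover have "linear (\<lambda>(y,t). y + t *\<^sub>R onormal V e)"
    by (intro linearI) (auto simp: algebra_simps)
  ultimately show ?thesis by (simp add: convex_linear_image convex_Times)
qed

lemma fint_zero_imp_zero:
  fixes f :: "real^'n::finite \<Rightarrow> real"
  assumes V: "simplex_verts V" and q: "q \<in> V" and f: "continuous_on (fhull V q) f"
    and nonneg: "\<And>x. x \<in> fhull V q \<Longrightarrow> f x \<ge> 0" and z: "fintq V q f = 0"
    and x: "x \<in> fhull V q"
  shows "f x = 0"
proof -
  let ?P = "prism V (V - {q})" and ?pr = "fproj V (V - {q})"
  obtain p where p: "p \<in> V - {q}" using simplex_face_nonempty[OF V q] by blast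
  have xx: "?pr x = x" unfolding fproj_eq[OF V q p] using face_hull_inner[OF V q p x] by simp
  have "f (?pr x) = 0"
  proof (rule integral_zero_imp_zero[of ?P "\<lambda>x. f (?pr x)"])
    show "?P \<subseteq> closure (interior ?P)"
      using convex_closure_interior[OF convex_prism prism_interior_nonempty[OF V q]] by (simp add: closure_subset)
    show "continuous_on ?P (\<lambda>x. f (?pr x))"
    proof (rule continuous_on_compose2[OF f])
      show "continuous_on ?P ?pr" unfolding fproj_def by (intro continuous_intros)
    qed (use fproj_prism[OF V q] in auto)
    show "x \<in> ?P" unfolding prism_eq[OF V q p] using xx x face_hull_inner[OF V q p x] by simp
  qed (use compact_prism[OF V q] nonneg fproj_prism[OF V q] z in \<open>auto simp: fint_eq\<close>)
  then show ?thesis using xx by simp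
qed

section \<open>The local weak operators\<close>

lemma eint_lin:
  fixes V :: "(real^'n::finite) set" and h :: "'a::real_vector \<Rightarrow> real^'n \<Rightarrow> real"
  assumes V: "simplex_verts V" and "\<And>x. lin_on W (\<lambda>s. h s x)" "\<And>s. s \<in> W \<Longrightarrow> h s integrable_on (convex hull V)"
  shows "lin_on W (\<lambda>s. eint V (h s))"
proof (rule lin_onI)
  show "eint V (h (s + t)) = eint V (h s) + eint V (h t)" if "s \<in> W" "t \<in> W" for s t
  proof -
    have "h (s + t) = (\<lambda>x. h s x + h t x)" using lin_onD(1)[OF assms(2) that] by auto
    then show ?thesis unfolding eint_def using assms(3) that by (simp add: integral_add)
  qed
  show "eint V (h (c *\<^sub>R s)) = c *\<^sub>R eint V (h s)" if "s \<in> W" for s c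
  proof -
    have "h (c *\<^sub>R s) = (\<lambda>x. c * h s x)" using lin_onD(2)[OF assms(2) that] by auto
    then show ?thesis by (simp add: eint_cmult)
  qed
qed

lemma eint_lin_continuous:
  fixes V :: "(real^'n::finite) set" and h :: "'a::real_vector \<Rightarrow> real^'n \<Rightarrow> real"
  assumes V: "simplex_verts V" and "\<And>x. lin_on W (\<lambda>s. h s x)" "\<And>s. s \<in> W \<Longrightarrow> continuous_on (convex hull V) (h s)"
  shows "lin_on W (\<lambda>s. eint V (h s))"
  by (intro eint_lin[OF V assms(2)] eint_integrable[OF V] assms(3))

lemma fint_lin:
  fixes V :: "(real^'n::finite) set" and h :: "'a::real_vector \<Rightarrow> real^'n \<Rightarrow> real"
  assumes V: "simplex_verts V" and q: "q \<in> V"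
    and h: "\<And>x. lin_on W (\<lambda>s. h s x)" "\<And>s. s \<in> W \<Longrightarrow> continuous_on (fhull V q) (h s)"
  shows "lin_on W (\<lambda>s. fintq V q (h s))"
proof (rule lin_onI)
  show "fintq V q (h (s + t)) = fintq V q (h s) + fintq V q (h t)" if "s \<in> W" "t \<in> W" for s t
  proof -
    have "h (s + t) = (\<lambda>x. h s x + h t x)" using lin_onD(1)[OF h(1) that] by auto
    then show ?thesis by (simp add: fint_add[OF V q h(2)[OF that(1)] h(2)[OF that(2)]])
  qed
  show "fintq V q (h (c *\<^sub>R s)) = c *\<^sub>R fintq V q (h s)" if "s \<in> W" for s c
  proof -
    have "h (c *\<^sub>R s) = (\<lambda>x. c * h s x)" using lin_onD(2)[OF h(1) that] by auto
    then show ?thesis by (simp add: fint_cmult[OF V q])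
  qed
qed

text \<open>The Riesz representative of L. Weak gradient, weak divergence and face projection are
  all of this form, with different spaces, inner products and functionals.\<close>

definition rep :: "'a::real_vector set \<Rightarrow> ('a \<Rightarrow> 'a \<Rightarrow> real) \<Rightarrow> ('a \<Rightarrow> real) \<Rightarrow> 'a" where
  "rep W a L = (THE u. u \<in> W \<and> (\<forall>y\<in>W. a u y = L y))"

lemma rep_cong: "(\<And>y. y \<in> W \<Longrightarrow> L y = M y) \<Longrightarrow> rep W a L = rep W a M"
  unfolding rep_def by (intro arg_cong[where f=The] ext) auto

locale fin_inner_form = fin_psd_form +
  assumes definite: "\<And>y. y \<in> W \<Longrightarrow> a y y = 0 \<Longrightarrow> y = 0"
begin

lemma
  assumes "lin_on W L"
  shows rep_in: "rep W a L \<in> W" and rep_eq: "y \<in> W \<Longrightarrow> a (rep W a L) y = L y"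
  using theI'[OF riesz[OF assms definite]] unfolding rep_def by blast+

lemma rep_eqI:
  assumes "lin_on W L" "u \<in> W" "\<And>y. y \<in> W \<Longrightarrow> a u y = L y"
  shows "rep W a L = u"
  unfolding rep_def using assms by (intro the1_equality[OF riesz[OF assms(1) definite]]) auto

text \<open>By uniqueness the representative inherits linearity from the data, which is how
  operators defined by description become linear.\<close>

lemma rep_lin:
  assumes "bilin_on X W \<Phi>"
  shows "lin_on X (\<lambda>d. rep W a (\<Phi> d))"
proof (rule lin_onI)
  note L = bilin_onD(2)[OF assms] and d = lin_onD[OF bilin_onD(1)[OF assms]]
  show "rep W a (\<Phi> (x + y)) = rep W a (\<Phi> x) + rep W a (\<Phi> y)" if xy: "x \<in> X" "y \<in> X" for x y
  proof -
    have "rep W a (\<Phi> (x + y)) = rep W a (\<lambda>z. \<Phi> x z + \<Phi> y z)" by (intro rep_cong d(1) xy)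
    also have "\<dots> = rep W a (\<Phi> x) + rep W a (\<Phi> y)"
      using rep_in[OF L[OF xy(1)]] rep_in[OF L[OF xy(2)]] rep_eq[OF L[OF xy(1)]] rep_eq[OF L[OF xy(2)]]
      by (intro rep_eqI lin_on_add L xy) (simp_all add: subspace_add[OF sub] add_l)
    finally show ?thesis .
  qed
  show "rep W a (\<Phi> (c *\<^sub>R x)) = c *\<^sub>R rep W a (\<Phi> x)" if x: "x \<in> X" for c x
  proof -
    have "rep W a (\<Phi> (c *\<^sub>R x)) = rep W a (\<lambda>z. c * \<Phi> x z)" using d(2)[OF _ x, of _ c] by (intro rep_cong) simp
    also have "\<dots> = c *\<^sub>R rep W a (\<Phi> x)"
      using rep_in[OF L[OF x]] rep_eq[OF L[OF x]]
      by (intro rep_eqI lin_on_cmult L x) (simp_all add: subspace_scale[OF sub] scale_l)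
    finally show ?thesis .
  qed
qed

end

lemma fin_inner_form_vpolys:
  fixes V :: "(real^'n::finite) set"
  assumes V: "simplex_verts V"
  shows "fin_inner_form (vpolys r) (\<lambda>\<sigma> \<tau>. eint V (\<lambda>x. \<sigma> x \<bullet> \<tau> x))"
proof
  let ?a = "\<lambda>\<sigma> \<tau>::real^'n \<Rightarrow> real^'n. eint V (\<lambda>x. \<sigma> x \<bullet> \<tau> x)"
  show "subspace (vpolys r :: (real^'n \<Rightarrow> real^'n) set)" by (rule subspace_vpolys)
  show "bilin_on (vpolys r) (vpolys r) ?a"
  proof (rule bilin_on_symI)
    show "lin_on (vpolys r) (\<lambda>x. ?a x y)" if "y \<in> vpolys r" for y
      by (intro eint_lin_continuous[OF V] continuous_on_inner continuous_vpolys[of _ r] that)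
        (simp_all add: lin_on_def inner_add_left)
  qed (simp add: inner_commute)
  show "?a x y = ?a y x" for x y by (simp add: inner_commute)
  show "?a x x \<ge> 0" if "x \<in> vpolys r" for x
    unfolding eint_def by (intro integral_nonneg eint_integrable[OF V] continuous_intros continuous_vpolys[OF that]) auto
  show "\<exists>S. finite S \<and> (vpolys r :: (real^'n \<Rightarrow> real^'n) set) \<subseteq> span S" by (rule fin_gen_vpolys)
  show "y = 0" if y: "y \<in> vpolys r" "?a y y = 0" for y
  proof -
    have z: "y x = 0" if "x \<in> convex hull V" for x
      using eint_zero_imp_zero[OF V _ _ y(2) that] continuous_vpolys[OF y(1)]
      by (auto intro!: continuous_intros)
    have "(\<lambda>x. y x $ i) = (\<lambda>_. 0)" for i
    proof (rule polys_zero_on_open[OF _ open_interior simplex_interior_nonempty[OF V]])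
      show "(\<lambda>x. y x $ i) \<in> polys r" using y by (simp add: vpolys_def)
      show "y x $ i = 0" if "x \<in> interior (convex hull V)" for x
        using z that interior_subset by fastforce
    qed
    then show ?thesis by (simp add: fun_eq_iff vec_eq_iff)
  qed
qed

lemma fin_inner_form_polys:
  fixes V :: "(real^'n::finite) set"
  assumes V: "simplex_verts V"
  shows "fin_inner_form (polys r) (\<lambda>p q. eint V (\<lambda>x. p x * q x))"
proof
  let ?a = "\<lambda>p q::real^'n \<Rightarrow> real. eint V (\<lambda>x. p x * q x)"
  show "subspace (polys r :: (real^'n \<Rightarrow> real) set)" by (rule subspace_polys)
  show "bilin_on (polys r) (polys r) ?a"
  proof (rule bilin_on_symI)
    show "lin_on (polys r) (\<lambda>x. ?a x y)" if "y \<in> polys r" for y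
      by (intro eint_lin_continuous[OF V] continuous_on_mult continuous_polys[of _ r] that)
        (simp_all add: lin_on_def distrib_right)
  qed (simp add: mult.commute)
  show "?a x y = ?a y x" for x y by (simp add: mult.commute)
  show "?a x x \<ge> 0" if "x \<in> polys r" for x
    unfolding eint_def by (intro integral_nonneg eint_integrable[OF V] continuous_intros continuous_polys[OF that]) auto
  show "\<exists>S. finite S \<and> (polys r :: (real^'n \<Rightarrow> real) set) \<subseteq> span S" by (rule fin_gen_polys)
  show "y = 0" if y: "y \<in> polys r" "?a y y = 0" for y
  proof -
    have z: "y x = 0" if "x \<in> convex hull V" for x
      using eint_zero_imp_zero[OF V _ _ y(2) that] continuous_polys[OF y(1)]
      by (auto intro!: continuous_intros)
    have "y = (\<lambda>_. 0)"
    proof (rule polys_zero_on_open[OF y(1) open_interior simplex_interior_nonempty[OF V]])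
      show "y x = 0" if "x \<in> interior (convex hull V)" for x
        using z that interior_subset by blast
    qed
    then show ?thesis by (simp add: fun_eq_iff)
  qed
qed

section \<open>Weak gradient and weak divergence as Riesz representatives\<close>

definition wgradL :: "(real^'n::finite) set \<Rightarrow> (real^'n \<Rightarrow> real) \<Rightarrow> ((real^'n) set \<Rightarrow> real^'n \<Rightarrow> real) \<Rightarrow> (real^'n \<Rightarrow> real^'n) \<Rightarrow> real" where
  "wgradL V v0 vb \<tau> = - eint V (\<lambda>x. v0 x * divg \<tau> x) + (\<Sum>e\<in>faces V. fint V e (\<lambda>x. vb e x * (\<tau> x \<bullet> onormal V e)))"

definition wdivL :: "(real^'n::finite) set \<Rightarrow> (real^'n \<Rightarrow> real^'n) \<Rightarrow> ((real^'n) set \<Rightarrow> real^'n \<Rightarrow> real^'n) \<Rightarrow> (real^'n \<Rightarrow> real) \<Rightarrow> real" where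
  "wdivL V w0 wb \<psi> = - eint V (\<lambda>x. w0 x \<bullet> grad \<psi> x) + (\<Sum>e\<in>faces V. fint V e (\<lambda>x. (wb e x \<bullet> onormal V e) * \<psi> x))"

lemma wgrad_eq: "wgrad r V v0 vb = rep (vpolys r) (\<lambda>\<sigma> \<tau>. eint V (\<lambda>x. \<sigma> x \<bullet> \<tau> x)) (wgradL V v0 vb)"
  by (simp add: wgrad_def rep_def wgradL_def)

lemma wdiv_eq: "wdiv r V w0 wb = rep (polys r) (\<lambda>p q. eint V (\<lambda>x. p x * q x)) (wdivL V w0 wb)"
  by (simp add: wdiv_def rep_def wdivL_def)

abbreviation cont :: "('a::topological_space \<Rightarrow> 'b::topological_space) \<Rightarrow> bool" where
  "cont f \<equiv> continuous_on UNIV f"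

lemma cont_on: "cont f \<Longrightarrow> continuous_on S f"
  by (rule continuous_on_subset) auto

text \<open>A common domain for all operators: it does not depend on degrees or boundary conditions,
  and products of such pairs again have continuous components, so convection terms are covered
  although their degree exceeds k.\<close>

definition scont :: "'n::finite sfun set" where
  "scont = {s. (\<forall>V. cont (fst s V)) \<and> (\<forall>e. cont (snd s e))}"

definition vcont :: "'n::finite vfun set" where
  "vcont = {v. (\<forall>V. cont (fst v V)) \<and> (\<forall>e. cont (snd v e))}"

lemma scontD: "s \<in> scont \<Longrightarrow> cont (fst s V)" "s \<in> scont \<Longrightarrow> cont (snd s e)"
  and vcontD: "v \<in> vcont \<Longrightarrow> cont (fst v V)" "v \<in> vcont \<Longrightarrow> cont (snd v e)"
  by (auto simp: scont_def vcont_def)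

context
  fixes V :: "(real^'n::finite) set"
  assumes V: "simplex_verts V"
begin

lemma wgradL_lin:
  assumes "cont v0" "\<And>e. cont (vb e)"
  shows "lin_on (vpolys r) (wgradL V v0 vb)"
proof -
  have "lin_on (vpolys r) (\<lambda>\<tau>. eint V (\<lambda>x. v0 x * divg \<tau> x))"
    by (intro eint_lin_continuous[OF V] continuous_on_mult cont_on[OF assms(1)] continuous_divg[of _ r])
      (simp_all add: lin_on_def divg_add divg_scale distrib_left)
  moreover have "lin_on (vpolys r) (\<lambda>\<tau>. fintq V q (\<lambda>x. vb (V - {q}) x * (\<tau> x \<bullet> fnormal V q)))" if "q \<in> V" for q
    by (intro fint_lin[OF V that] continuous_on_mult continuous_on_inner continuous_on_const cont_on[OF assms(2)] continuous_vpolys[of _ r])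
      (simp_all add: lin_on_def inner_add_left distrib_left)
  ultimately show ?thesis
    unfolding wgradL_def[abs_def] sum_faces by (intro lin_on_add lin_on_uminus lin_on_sum')
qed

lemma wdivL_lin:
  assumes "cont w0" "\<And>e. cont (wb e)"
  shows "lin_on (polys r) (wdivL V w0 wb)"
proof -
  have "lin_on (polys r) (\<lambda>p. eint V (\<lambda>x. w0 x \<bullet> grad p x))"
    by (intro eint_lin_continuous[OF V] continuous_on_inner cont_on[OF assms(1)] continuous_grad[of _ r])
      (simp_all add: lin_on_def grad_add grad_scale inner_add_right)
  moreover have "lin_on (polys r) (\<lambda>p. fintq V q (\<lambda>x. (wb (V - {q}) x \<bullet> fnormal V q) * p x))" if "q \<in> V" for q
    by (intro fint_lin[OF V that] continuous_on_mult continuous_on_inner continuous_on_const cont_on[OF assms(2)] continuous_polys[of _ r])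
      (simp_all add: lin_on_def distrib_left)
  ultimately show ?thesis
    unfolding wdivL_def[abs_def] sum_faces by (intro lin_on_add lin_on_uminus lin_on_sum')
qed

lemma wgrad_in: "cont v0 \<Longrightarrow> (\<And>e. cont (vb e)) \<Longrightarrow> wgrad r V v0 vb \<in> vpolys r"
  unfolding wgrad_eq by (intro fin_inner_form.rep_in[OF fin_inner_form_vpolys[OF V]] wgradL_lin)

lemma wgrad_char: "cont v0 \<Longrightarrow> (\<And>e. cont (vb e)) \<Longrightarrow> \<tau> \<in> vpolys r \<Longrightarrow>
    eint V (\<lambda>x. wgrad r V v0 vb x \<bullet> \<tau> x) = wgradL V v0 vb \<tau>"
  unfolding wgrad_eq by (intro fin_inner_form.rep_eq[OF fin_inner_form_vpolys[OF V]] wgradL_lin)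

lemma wdiv_in: "cont w0 \<Longrightarrow> (\<And>e. cont (wb e)) \<Longrightarrow> wdiv r V w0 wb \<in> polys r"
  unfolding wdiv_eq by (intro fin_inner_form.rep_in[OF fin_inner_form_polys[OF V]] wdivL_lin)

lemma wgrad_lin: "lin_on scont (\<lambda>s. wgrad r V (fst s V) (snd s))"
  unfolding wgrad_eq
proof (rule fin_inner_form.rep_lin[OF fin_inner_form_vpolys[OF V]])
  have "lin_on scont (\<lambda>s. wgradL V (fst s V) (snd s) \<tau>)" if \<tau>: "\<tau> \<in> vpolys r" for \<tau> :: "real^'n \<Rightarrow> real^'n"
    unfolding wgradL_def sum_faces
    by (intro lin_on_add lin_on_uminus lin_on_sum' eint_lin_continuous[OF V] fint_lin[OF V] continuous_on_mult continuous_on_inner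
        continuous_on_const cont_on[OF scontD(1)] cont_on[OF scontD(2)] continuous_divg[OF \<tau>] continuous_vpolys[OF \<tau>])
      (simp_all add: lin_on_def distrib_right)
  then show "bilin_on scont (vpolys r) (\<lambda>s. wgradL V (fst s V) (snd s))"
    by (auto simp: bilin_on_def intro: wgradL_lin scontD)
qed

lemma swgrad_continuous: "s \<in> scont \<Longrightarrow> cont (wgrad m V (fst s V) (snd s))"
  by (intro continuous_vpolys[OF wgrad_in] scontD)

lemma wdiv_scal_eq: "wdiv_scal k V w s = wdiv k V (\<lambda>y. fst s V y *\<^sub>R fst w V y) (\<lambda>e y. snd s e y *\<^sub>R snd w e y)"
  by (simp add: wdiv_scal_def fun_eq_iff)

lemma wdiv_scal_continuous: "w \<in> vcont \<Longrightarrow> s \<in> scont \<Longrightarrow> cont (wdiv_scal k V w s)"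
  unfolding wdiv_scal_eq by (intro continuous_polys[OF wdiv_in] continuous_on_scaleR scontD vcontD)

lemma
  shows wdiv_scal_lin1: "s \<in> scont \<Longrightarrow> lin_on vcont (\<lambda>w. wdiv_scal k V w s)"
    and wdiv_scal_lin2: "w \<in> vcont \<Longrightarrow> lin_on scont (\<lambda>s. wdiv_scal k V w s)"
proof -
  let ?L = "\<lambda>w s. wdivL V (\<lambda>y. fst s V y *\<^sub>R fst w V y) (\<lambda>e y. snd s e y *\<^sub>R snd w e y)"
  note c = continuous_on_mult continuous_on_inner continuous_on_scaleR continuous_on_const
    cont_on[OF scontD(1)] cont_on[OF scontD(2)] cont_on[OF vcontD(1)] cont_on[OF vcontD(2)]
  have L: "lin_on (polys k) (?L w s)" if "w \<in> vcont" "s \<in> scont" for w s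
    using that by (intro wdivL_lin continuous_on_scaleR scontD vcontD)
  show "lin_on vcont (\<lambda>w. wdiv_scal k V w s)" if s: "s \<in> scont"
    unfolding wdiv_scal_eq wdiv_eq
  proof (rule fin_inner_form.rep_lin[OF fin_inner_form_polys[OF V]])
    have "lin_on vcont (\<lambda>w. ?L w s p)" if p: "p \<in> polys k" for p
      unfolding wdivL_def sum_faces
      by (intro lin_on_add lin_on_uminus lin_on_sum' eint_lin_continuous[OF V] fint_lin[OF V] c s continuous_grad[OF p] continuous_polys[OF p])
        (simp_all add: lin_on_def inner_add_left distrib_left distrib_right)
    then show "bilin_on vcont (polys k) (\<lambda>w. ?L w s)" by (auto simp: bilin_on_def intro: L s)
  qed
  show "lin_on scont (\<lambda>s. wdiv_scal k V w s)" if w: "w \<in> vcont"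
    unfolding wdiv_scal_eq wdiv_eq
  proof (rule fin_inner_form.rep_lin[OF fin_inner_form_polys[OF V]])
    have "lin_on scont (\<lambda>s. ?L w s p)" if p: "p \<in> polys k" for p
      unfolding wdivL_def sum_faces
      by (intro lin_on_add lin_on_uminus lin_on_sum' eint_lin_continuous[OF V] fint_lin[OF V] c w continuous_grad[OF p] continuous_polys[OF p])
        (simp_all add: lin_on_def distrib_right)
    then show "bilin_on scont (polys k) (\<lambda>s. ?L w s)" by (auto simp: bilin_on_def intro: L w)
  qed
qed

lemma eint_cong: "(\<And>x. x \<in> convex hull V \<Longrightarrow> f x = g x) \<Longrightarrow> eint V f = eint V g"
  unfolding eint_def by (rule integral_cong)

text \<open>Only values on the closed element and its faces enter; this is the origin of the kernel
  of the energy.\<close>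

lemma wgrad_cong:
  assumes "\<And>x. x \<in> convex hull V \<Longrightarrow> v0 x = w0 x"
    and "\<And>e x. e \<in> faces V \<Longrightarrow> x \<in> convex hull e \<Longrightarrow> vb e x = wb e x"
  shows "wgrad r V v0 vb = wgrad r V w0 wb"
proof -
  have "wgradL V v0 vb = wgradL V w0 wb"
    unfolding wgradL_def fun_eq_iff sum_faces using assms
    by (intro allI arg_cong2[where f="(+)"] arg_cong[where f=uminus] sum.cong refl eint_cong fint_cong[OF V])
      (auto simp: faces_eq)
  then show ?thesis by (simp add: wgrad_eq)
qed

lemma wdiv_cong:
  assumes "\<And>x. x \<in> convex hull V \<Longrightarrow> v0 x = w0 x"
    and "\<And>e x. e \<in> faces V \<Longrightarrow> x \<in> convex hull e \<Longrightarrow> vb e x = wb e x"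
  shows "wdiv r V v0 vb = wdiv r V w0 wb"
proof -
  have "wdivL V v0 vb = wdivL V w0 wb"
    unfolding wdivL_def fun_eq_iff sum_faces using assms
    by (intro allI arg_cong2[where f="(+)"] arg_cong[where f=uminus] sum.cong refl eint_cong fint_cong[OF V])
      (auto simp: faces_eq)
  then show ?thesis by (simp add: wdiv_eq)
qed

end

text \<open>Different polynomials may coincide on a face, so the face inner product is definite only
  on restrictions. Extension by 0 selects one function per restriction and matches the normalization
  in \<open>qproj\<close>.\<close>

definition fpolys :: "nat \<Rightarrow> (real^'n::finite) set \<Rightarrow> (real^'n \<Rightarrow> real) set" where
  "fpolys l e = {g. (\<exists>p\<in>polys l. \<forall>x\<in>convex hull e. g x = p x) \<and> (\<forall>x. x \<notin> convex hull e \<longrightarrow> g x = 0)}"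

lemma fpolys_eq: "fpolys l e = (\<lambda>p x. if x \<in> convex hull e then p x else 0) ` polys l"
  by (auto simp: fpolys_def image_iff fun_eq_iff)

lemma continuous_fpolys:
  assumes "g \<in> fpolys l e"
  shows "continuous_on (convex hull e) g"
proof -
  obtain p where "p \<in> polys l" "\<And>x. x \<in> convex hull e \<Longrightarrow> g x = p x" using assms by (auto simp: fpolys_def)
  then show ?thesis using continuous_polys[of p l] by (simp cong: continuous_on_cong)
qed

lemma fin_inner_form_fpolys:
  fixes V :: "(real^'n::finite) set"
  assumes V: "simplex_verts V" and q: "q \<in> V"
  shows "fin_inner_form (fpolys l (V - {q})) (\<lambda>g h. fintq V q (\<lambda>x. g x * h x))"
proof
  let ?e = "V - {q}"
  let ?a = "\<lambda>p q::real^'n \<Rightarrow> real. fint V ?e (\<lambda>x. p x * q x)"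
  let ?R = "\<lambda>(p::real^'n \<Rightarrow> real) x. if x \<in> convex hull ?e then p x else 0"
  have lR: "linear ?R" by (intro linearI) (auto simp: fun_eq_iff)
  show "subspace (fpolys l ?e)"
    unfolding fpolys_eq by (rule linear_subspace_image[OF lR subspace_polys])
  show "bilin_on (fpolys l ?e) (fpolys l ?e) ?a"
  proof (rule bilin_on_symI)
    show "lin_on (fpolys l ?e) (\<lambda>x. ?a x y)" if "y \<in> fpolys l ?e" for y
      by (intro fint_lin[OF V q] continuous_on_mult continuous_fpolys[of _ l] that)
        (simp_all add: lin_on_def distrib_right)
  qed (simp add: mult.commute)
  show "?a x y = ?a y x" for x y by (simp add: mult.commute)
  show "?a x x \<ge> 0" if "x \<in> fpolys l ?e" for x
    by (intro fint_nonneg[OF V q] continuous_intros continuous_fpolys[OF that]) auto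
  obtain S :: "(real^'n \<Rightarrow> real) set" where S: "finite S" "polys l \<subseteq> span S" using fin_gen_polys by blast
  then show "\<exists>S. finite S \<and> fpolys l ?e \<subseteq> span S"
    unfolding fpolys_eq by (intro exI[of _ "?R ` S"]) (use linear_span_image[OF lR, of S] in auto)
  show "y = 0" if y: "y \<in> fpolys l ?e" "?a y y = 0" for y
  proof -
    have "y x = 0" if "x \<in> convex hull ?e" for x
      using fint_zero_imp_zero[OF V q _ _ y(2) that] continuous_fpolys[OF y(1)]
      by (auto intro!: continuous_intros)
    then show ?thesis using y(1) by (auto simp: fpolys_def fun_eq_iff)
  qed
qed

lemma qproj_eq:
  assumes V: "simplex_verts V" and q: "q \<in> V" and f: "cont f"
  shows "qproj l V (V - {q}) f = rep (fpolys l (V - {q})) (\<lambda>g h. fintq V q (\<lambda>x. g x * h x)) (\<lambda>h. fintq V q (\<lambda>x. f x * h x))"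
  unfolding qproj_def rep_def
proof (intro arg_cong[where f=The] ext)
  let ?e = "V - {q}"
  fix g
  have "(\<forall>p\<in>polys l. fint V ?e (\<lambda>x. (f x - g x) * p x) = 0) \<longleftrightarrow>
        (\<forall>h\<in>fpolys l ?e. fint V ?e (\<lambda>x. g x * h x) = fint V ?e (\<lambda>x. f x * h x))" if g: "g \<in> fpolys l ?e"
  proof -
    have "fint V ?e (\<lambda>x. (f x - g x) * p x) = 0 \<longleftrightarrow>
      fint V ?e (\<lambda>x. g x * (if x \<in> convex hull ?e then p x else 0)) = fint V ?e (\<lambda>x. f x * (if x \<in> convex hull ?e then p x else 0))"
      if p: "p \<in> polys l" for p
    proof -
      have "fint V ?e (\<lambda>x. (f x - g x) * p x) = fint V ?e (\<lambda>x. f x * p x) - fint V ?e (\<lambda>x. g x * p x)"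
        unfolding left_diff_distrib
        by (intro fint_diff[OF V q] continuous_intros cont_on[OF f] continuous_fpolys[OF g] continuous_polys[OF p])
      moreover have "fint V ?e (\<lambda>x. h x * (if x \<in> convex hull ?e then p x else 0)) = fint V ?e (\<lambda>x. h x * p x)" for h
        by (rule fint_cong[OF V q]) simp
      ultimately show ?thesis by auto
    qed
    then show ?thesis unfolding fpolys_eq by simp
  qed
  then show "((\<exists>q\<in>polys l. \<forall>x\<in>convex hull ?e. g x = q x) \<and> (\<forall>x. x \<notin> convex hull ?e \<longrightarrow> g x = 0) \<and>
      (\<forall>p\<in>polys l. fint V ?e (\<lambda>x. (f x - g x) * p x) = 0)) =
    (g \<in> fpolys l ?e \<and> (\<forall>y\<in>fpolys l ?e. fint V ?e (\<lambda>x. g x * y x) = fint V ?e (\<lambda>x. f x * y x)))"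
    unfolding fpolys_def by blast
qed

context
  fixes V :: "(real^'n::finite) set" and q :: "real^'n"
  assumes V: "simplex_verts V" and q: "q \<in> V"
begin

lemma qprojL_lin:
  assumes "cont f"
  shows "lin_on (fpolys l (V - {q})) (\<lambda>h. fintq V q (\<lambda>x. f x * h x))"
  by (intro fint_lin[OF V q] continuous_on_mult cont_on[OF assms] continuous_fpolys[of _ l])
    (simp_all add: lin_on_def distrib_left)

lemma qproj_in: "cont f \<Longrightarrow> qproj l V (V - {q}) f \<in> fpolys l (V - {q})"
  unfolding qproj_eq[OF V q] by (intro fin_inner_form.rep_in[OF fin_inner_form_fpolys[OF V q]] qprojL_lin)

lemma qproj_char:
  assumes "cont f" "p \<in> polys l"
  shows "fintq V q (\<lambda>x. qproj l V (V - {q}) f x * p x) = fintq V q (\<lambda>x. f x * p x)"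
proof -
  let ?h = "\<lambda>x. if x \<in> fhull V q then p x else 0"
  have "?h \<in> fpolys l (V - {q})" using assms(2) by (auto simp: fpolys_eq)
  then have "fintq V q (\<lambda>x. qproj l V (V - {q}) f x * ?h x) = fintq V q (\<lambda>x. f x * ?h x)"
    unfolding qproj_eq[OF V q assms(1)] by (intro fin_inner_form.rep_eq[OF fin_inner_form_fpolys[OF V q]] qprojL_lin assms)
  moreover have "fintq V q (\<lambda>x. g x * ?h x) = fintq V q (\<lambda>x. g x * p x)" for g
    by (rule fint_cong[OF V q]) simp
  ultimately show ?thesis by simp
qed

lemma qproj_lin: "lin_on {f. cont f} (\<lambda>f. qproj l V (V - {q}) f)"
proof -
  let ?r = "\<lambda>f. rep (fpolys l (V - {q})) (\<lambda>g h. fintq V q (\<lambda>x. g x * h x)) (\<lambda>h. fintq V q (\<lambda>x. f x * h x))"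
  have "lin_on {f. cont f} (\<lambda>f. fintq V q (\<lambda>x. f x * h x))" if h: "h \<in> fpolys l (V - {q})" for h
  proof (rule fint_lin[OF V q])
    show "continuous_on (fhull V q) (\<lambda>x. f x * h x)" if "f \<in> {f. cont f}" for f
      using that continuous_on_mult[OF cont_on continuous_fpolys[OF h]] by blast
  qed (simp add: lin_on_def distrib_right)
  then have "lin_on {f. cont f} ?r"
    by (intro fin_inner_form.rep_lin[OF fin_inner_form_fpolys[OF V q]]) (auto simp: bilin_on_def intro: qprojL_lin)
  moreover have "qproj l V (V - {q}) f = ?r f" if "cont f" for f by (rule qproj_eq[OF V q that])
  ultimately show ?thesis
    by (auto simp: lin_on_def plus_fun_def scaleR_fun_def continuous_on_add continuous_on_mult_left)
qed

text \<open>A polynomial of degree at most l represents its own functional. Coercivity uses this for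
  constants, to read off the face value from the element value.\<close>

lemma qproj_poly:
  assumes "p \<in> polys l" "x \<in> fhull V q"
  shows "qproj l V (V - {q}) p x = p x"
proof -
  let ?h = "\<lambda>x. if x \<in> fhull V q then p x else 0"
  have "qproj l V (V - {q}) p = ?h"
    unfolding qproj_eq[OF V q continuous_polys[OF assms(1)]]
  proof (rule fin_inner_form.rep_eqI[OF fin_inner_form_fpolys[OF V q]])
    show "?h \<in> fpolys l (V - {q})" using assms(1) by (auto simp: fpolys_eq)
    show "fintq V q (\<lambda>x. ?h x * y x) = fintq V q (\<lambda>x. p x * y x)" for y
      by (rule fint_cong[OF V q]) simp
  qed (intro qprojL_lin continuous_polys[OF assms(1)])
  then show ?thesis using assms(2) by simp
qed

end

section \<open>Coercivity on a single simplex\<close>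

lemma hK_pos:
  assumes V: "simplex_verts V"
  shows "hK V > 0"
proof -
  obtain q where q: "q \<in> V" using simplex_vertsD(2)[OF V] by fastforce
  obtain p where p: "p \<in> V - {q}" using simplex_face_nonempty[OF V q] by blast
  have "dist p q \<le> diameter (convex hull V)"
    using p q compact_hull_simplex[OF V order_refl]
    by (intro diameter_bounded_bound compact_imp_bounded) (auto intro: hull_inc)
  moreover have "dist p q > 0" using p by auto
  ultimately show ?thesis unfolding hK_def by linarith
qed

text \<open>Vanishing stabilization means that the projection of v0 equals vb on every face.
  Integration by parts then identifies the true gradient with the weak one against all test fields
  of degree m: since m is at most l, normal components of such fields are admissible in the
  projection, so v0 may be exchanged for vb on the boundary. Since m is at least k - 1, grad v0 is
  itself a test field.\<close>

lemma local_coercivity: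
  fixes V :: "(real^'n::finite) set"
  assumes V: "simplex_verts V" and v0: "v0 \<in> polys k" and vb: "\<And>e. cont (vb e)"
    and km: "k - 1 \<le> m" and ml: "m \<le> l"
    and g: "eint V (\<lambda>x. wgrad m V v0 vb x \<bullet> wgrad m V v0 vb x) = 0"
    and s: "stab l V v0 vb v0 vb = 0"
  shows "\<exists>c. v0 = (\<lambda>_. c) \<and> (\<forall>e\<in>faces V. \<forall>x\<in>convex hull e. vb e x = c)"
proof -
  let ?J = "\<lambda>q x. qproj l V (V - {q}) v0 x - vb (V - {q}) x"
  have c0: "cont v0" by (rule continuous_polys[OF v0])
  have sq: "fintq V q (\<lambda>x. ?J q x * ?J q x) \<ge> 0" 
    and cq: "continuous_on (fhull V q) (\<lambda>x. ?J q x * ?J q x)" if "q \<in> V" for q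
  proof -
    show c: "continuous_on (fhull V q) (\<lambda>x. ?J q x * ?J q x)"
      by (intro continuous_intros continuous_fpolys[OF qproj_in[OF V that c0]] cont_on[OF vb])
    show "fintq V q (\<lambda>x. ?J q x * ?J q x) \<ge> 0"
      by (rule fint_nonneg[OF V that c]) simp
  qed
  have Q: "qproj l V (V - {q}) v0 x = vb (V - {q}) x" if q: "q \<in> V" and x: "x \<in> fhull V q" for q x
  proof -
    have "fintq V q (\<lambda>x. ?J q x * ?J q x) = 0"
      using s hK_pos[OF V] q sq simplex_vertsD(1)[OF V] unfolding stab_def sum_faces
      by (subst (asm) sum_nonneg_eq_0_iff) (auto simp: zero_le_mult_iff)
    from fint_zero_imp_zero[OF V q cq[OF q] _ this x] show ?thesis by simp
  qed
  have w: "wgrad m V v0 vb \<in> vpolys m" by (rule wgrad_in[OF V c0 vb])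
  interpret fin_inner_form "vpolys m" "\<lambda>\<sigma> \<tau>. eint V (\<lambda>x. \<sigma> x \<bullet> \<tau> x)" by (rule fin_inner_form_vpolys[OF V])
  have w0: "wgrad m V v0 vb = 0" using definite[OF w] g by blast
  have G: "grad v0 \<in> vpolys m"
  proof -
    have "polys (k - 1) \<subseteq> (polys m :: (real^'n \<Rightarrow> real) set)" by (rule polys_mono[OF km])
    then show ?thesis using grad_in_vpolys[OF v0] by (auto simp: vpolys_def)
  qed
  have ibp: "eint V (\<lambda>x. grad v0 x \<bullet> \<tau> x) = 0" if t: "\<tau> \<in> vpolys m" for \<tau>
  proof -
    have ti: "(\<lambda>x. \<tau> x $ i) \<in> polys m" for i using t by (simp add: vpolys_def)
    have d: "((\<lambda>x. v0 x * \<tau> x $ i) has_derivative (\<lambda>h. (v0 x *\<^sub>R grad (\<lambda>x. \<tau> x $ i) x + (\<tau> x $ i) *\<^sub>R grad v0 x) \<bullet> h)) (at x)" for i x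
      using has_derivative_mult[OF polys_has_derivative[OF v0, of x] polys_has_derivative[OF ti[of i], of x]]
      by (simp add: inner_add_left mult.commute)
    have c: "cont (\<lambda>x. v0 x *\<^sub>R grad (\<lambda>x. \<tau> x $ i) x + (\<tau> x $ i) *\<^sub>R grad v0 x)" for i
      by (intro continuous_intros c0 continuous_grad[OF ti] continuous_grad[OF v0] continuous_polys[OF ti])
    \<comment> \<open>The divergence theorem for v0 times the i-th component of the test field,
      taken in the i-th coordinate direction; the sum over i is integration by parts.\<close>
    have ei: "eint V (\<lambda>x. (v0 x *\<^sub>R grad (\<lambda>x. \<tau> x $ i) x + (\<tau> x $ i) *\<^sub>R grad v0 x) \<bullet> axis i 1) =
      (\<Sum>q\<in>V. fintq V q (\<lambda>x. (fnormal V q $ i) * (v0 x * \<tau> x $ i)))" for i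
      unfolding simplex_divergence[OF V d c] sum_faces
      by (simp add: inner_axis fint_cmult[OF V] cong: sum.cong)
    have "eint V (\<lambda>x. v0 x * divg \<tau> x) + eint V (\<lambda>x. grad v0 x \<bullet> \<tau> x) =
       eint V (\<lambda>x. v0 x * divg \<tau> x + grad v0 x \<bullet> \<tau> x)"
      by (intro eint_add[OF V, symmetric] continuous_intros continuous_polys[OF v0] continuous_divg[OF t] continuous_grad[OF v0] continuous_vpolys[OF t])
    also have "\<dots> = eint V (\<lambda>x. \<Sum>i\<in>UNIV. (v0 x *\<^sub>R grad (\<lambda>x. \<tau> x $ i) x + (\<tau> x $ i) *\<^sub>R grad v0 x) \<bullet> axis i 1)"
    proof -
      have "(v0 x *\<^sub>R grad (\<lambda>x. \<tau> x $ i) x + (\<tau> x $ i) *\<^sub>R grad v0 x) \<bullet> axis i 1 =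
        v0 x * grad (\<lambda>x. \<tau> x $ i) x $ i + grad v0 x $ i * \<tau> x $ i" for x i
        by (simp add: inner_axis mult.commute)
      then show ?thesis
        unfolding divg_eq[OF t] by (simp add: inner_vec_def sum_distrib_left sum.distrib)
    qed
    also have "\<dots> = (\<Sum>i\<in>UNIV. eint V (\<lambda>x. (v0 x *\<^sub>R grad (\<lambda>x. \<tau> x $ i) x + (\<tau> x $ i) *\<^sub>R grad v0 x) \<bullet> axis i 1))"
      unfolding eint_def by (intro integral_sum eint_integrable[OF V] continuous_intros cont_on[OF c]) auto
    also have "\<dots> = (\<Sum>q\<in>V. \<Sum>i\<in>UNIV. fintq V q (\<lambda>x. (fnormal V q $ i) * (v0 x * \<tau> x $ i)))"
      unfolding ei by (rule sum.swap)
    also have "\<dots> = (\<Sum>q\<in>V. fintq V q (\<lambda>x. v0 x * (\<tau> x \<bullet> fnormal V q)))"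
    proof (intro sum.cong refl)
      fix q assume q: "q \<in> V"
      have "(\<Sum>i\<in>UNIV. fintq V q (\<lambda>x. (fnormal V q $ i) * (v0 x * \<tau> x $ i))) =
         fintq V q (\<lambda>x. \<Sum>i\<in>UNIV. (fnormal V q $ i) * (v0 x * \<tau> x $ i))"
        unfolding fint_eq
        by (intro integral_sum[symmetric] fint_integrable[OF V q] continuous_intros continuous_polys[OF v0] continuous_polys[OF ti]) auto
      then show "(\<Sum>i\<in>UNIV. fintq V q (\<lambda>x. (fnormal V q $ i) * (v0 x * \<tau> x $ i))) =
         fintq V q (\<lambda>x. v0 x * (\<tau> x \<bullet> fnormal V q))"
        by (simp add: inner_vec_def sum_distrib_left mult_ac)
    qed
    also have "\<dots> = (\<Sum>q\<in>V. fintq V q (\<lambda>x. vb (V - {q}) x * (\<tau> x \<bullet> fnormal V q)))"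
    proof (intro sum.cong refl)
      fix q assume q: "q \<in> V"
      \<comment> \<open>The normal is constant on the face, so the normal component has degree at
        most m, hence at most l; this is where m \<le> l enters.\<close>
      have tn: "(\<lambda>x. \<tau> x \<bullet> fnormal V q) \<in> polys l"
      proof -
        have "(\<lambda>x. \<Sum>i\<in>UNIV. fnormal V q $ i * \<tau> x $ i) \<in> polys m"
          by (intro polys_sum polys_cmult ti)
        then show ?thesis using polys_mono[OF ml] by (auto simp: inner_vec_def mult.commute)
      qed
      have "fintq V q (\<lambda>x. v0 x * (\<tau> x \<bullet> fnormal V q)) =
            fintq V q (\<lambda>x. qproj l V (V - {q}) v0 x * (\<tau> x \<bullet> fnormal V q))"
        by (rule qproj_char[OF V q c0 tn, symmetric])
      also have "\<dots> = fintq V q (\<lambda>x. vb (V - {q}) x * (\<tau> x \<bullet> fnormal V q))"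
        by (rule fint_cong[OF V q]) (simp add: Q[OF q])
      finally show "fintq V q (\<lambda>x. v0 x * (\<tau> x \<bullet> fnormal V q)) =
        fintq V q (\<lambda>x. vb (V - {q}) x * (\<tau> x \<bullet> fnormal V q))" .
    qed
    finally have "eint V (\<lambda>x. grad v0 x \<bullet> \<tau> x) = wgradL V v0 vb \<tau>"
      unfolding wgradL_def sum_faces by simp
    also have "\<dots> = 0" using wgrad_char[OF V c0, where vb=vb, OF vb t] w0 by (simp add: eint_def)
    finally show ?thesis .
  qed
  \<comment> \<open>The gradient is tested with itself, which is admissible because its degree k - 1
    is at most m.\<close>
  have "grad v0 = 0" using definite[OF G ibp[OF G]] .
  then have "(v0 has_derivative (\<lambda>h. 0)) (at x within UNIV)" for x
    using polys_has_derivative[OF v0, of x] by simp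
  then obtain c where c: "\<And>x. v0 x = c"
    using has_derivative_zero_constant[of UNIV v0] by auto
  then have "v0 = (\<lambda>_. c)" by auto
  moreover have "vb e x = c" if "e \<in> faces V" "x \<in> convex hull e" for e x
    using that Q qproj_poly[OF V _ polys_const] unfolding faces_eq \<open>v0 = _\<close> by fastforce
  ultimately show ?thesis by blast
qed

section \<open>Faces in a triangulation\<close>

lemma triangulationD:
  assumes "simplicial_triangulation T"
  shows "finite T" "V \<in> T \<Longrightarrow> simplex_verts V"
    "V \<in> T \<Longrightarrow> W \<in> T \<Longrightarrow> convex hull V \<inter> convex hull W = convex hull (V \<inter> W)"
  using assms by (auto simp: simplicial_triangulation_def)

lemma triangulation_subset: "simplicial_triangulation T \<Longrightarrow> S \<subseteq> T \<Longrightarrow> simplicial_triangulation S"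
  unfolding simplicial_triangulation_def by (meson finite_subset subsetD)

text \<open>Conformity is what excludes two different elements on the same side of a common face:
  they would overlap near the face, while their intersection must be spanned by common
  vertices.\<close>

lemma adjacent_opposite:
  fixes V W :: "(real^'n::finite) set"
  assumes V: "simplex_verts V" and W: "simplex_verts W"
    and conf: "convex hull V \<inter> convex hull W = convex hull (V \<inter> W)"
    and p: "p \<in> V" and q: "q \<in> W" and e: "V - {p} = W - {q}" and ne: "V \<noteq> W"
  shows "onormal W (V - {p}) = - fnormal V p"
proof -
  let ?e = "V - {p}" and ?n = "fnormal V p"
  have pq: "p \<noteq> q" using e p q ne by blast
  have pW: "p \<notin> W" using e pq by blast
  (* Otherwise a point near the centroid of the common face, but off its plane, lies in both simplices. *)
  have side: "?n \<bullet> (q - r) > 0" if r: "r \<in> ?e" for r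
  proof (rule ccontr)
    assume "\<not> ?n \<bullet> (q - r) > 0"
    moreover have "?n \<bullet> (q - r) \<noteq> 0"
    proof
      assume z: "?n \<bullet> (q - r) = 0"
      have "?n \<bullet> u = ?n \<bullet> r" if "u \<in> W" for u
      proof (cases "u = q")
        case True then show ?thesis using z by (simp add: inner_diff_right)
      next
        case False
        then have "u \<in> ?e" using that e by blast
        then have "?n \<bullet> (u - r) = 0" using r by (rule onormal_orth[OF V p])
        then show ?thesis by (simp add: inner_diff_right)
      qed
      then have "?n = 0" using simplex_inner_eq_imp_zero[OF W] by blast
      then show False using norm_onormal[OF V p] by simp
    qed
    ultimately have "bary V p q > 0"
      using onormal_neg[OF V p r] by (simp add: bary_eq[OF V p r] divide_neg_neg)
    obtain c where c: "bary V p c = 0" "\<And>r. r \<in> ?e \<Longrightarrow> bary V r c = 1 / real CARD('n)" "c \<in> convex hull ?e"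
      by (rule face_centroid[OF V p]) blast
    define d where "d = real CARD('n)"
    have d: "d > 0" by (simp add: d_def)
    define S where "S = (\<Sum>r\<in>V. \<bar>bary V r q\<bar>)"
    have S: "\<bar>bary V r q\<bar> \<le> S" if "r \<in> V" for r
      unfolding S_def using that simplex_vertsD(1)[OF V] by (intro member_le_sum) auto
    have S0: "S \<ge> 0" unfolding S_def by (simp add: sum_nonneg)
    \<comment> \<open>Chosen so that (1 - t)/d = t S: the positive coordinates of the centroid then
      exactly balance the worst negative coordinate of q.\<close>
    define t where "t = 1 / (1 + d * S)"
    have t: "0 < t" "t \<le> 1" using d S0 by (auto simp: t_def divide_le_eq add_pos_nonneg)
    have tS: "(1 - t) / d = t * S" using d S0 by (simp add: t_def field_simps add_pos_nonneg[THEN less_imp_neq, THEN not_sym])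
    define x where "x = c + t *\<^sub>R (q - c)"
    have bx: "bary V r x = (1 - t) * bary V r c + t * bary V r q" if "r \<in> V" for r
      unfolding x_def bary_shift[OF V that] by (simp add: algebra_simps)
    have "bary V r x \<ge> 0" if "r \<in> V" for r
    proof (cases "r = p")
      case True
      then show ?thesis using bx[OF that] c(1) t \<open>bary V p q > 0\<close> by simp
    next
      case False
      then have "bary V r x = t * S + t * bary V r q"
        using bx[OF that] c(2)[of r] that tS by (simp add: d_def)
      also have "\<dots> \<ge> 0" using S[OF that] t by (simp flip: distrib_left)
      finally show ?thesis .
    qed
    then have xV: "x \<in> convex hull V" by (simp add: simplex_hull[OF V])
    have "c \<in> convex hull W" using c(3) e hull_mono[of "W - {q}" W convex] by auto
    moreover have "q \<in> convex hull W" using q by (rule hull_inc)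
    moreover have "x = (1 - t) *\<^sub>R c + t *\<^sub>R q" by (simp add: x_def algebra_simps)
    ultimately have xW: "x \<in> convex hull W" using t convexD_alt[OF convex_convex_hull, of c W q t] by auto
    have "V \<inter> W \<subseteq> ?e" using pW by auto
    then have "x \<in> convex hull ?e" using xV xW conf hull_mono[of "V \<inter> W" ?e convex] by auto
    then have "bary V p x = 0" by (simp add: face_hull[OF V p])
    then show False using bx[OF p] c(1) t \<open>bary V p q > 0\<close> by simp
  qed
  have "fnormal W q = - ?n"
  proof (rule onormal_eqI[OF W q])
    show "norm (- ?n) = 1" using norm_onormal[OF V p] by simp
    show "- ?n \<bullet> (r - s) = 0" if "r \<in> W - {q}" "s \<in> W - {q}" for r s
      using onormal_orth[OF V p, of r s] that e by simp
    show "- ?n \<bullet> (q - r) < 0" if "r \<in> W - {q}" for r using side[of r] that e by simp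
  qed
  then show ?thesis by (simp add: e)
qed

text \<open>The two prisms over a common face are translates of each other, so the area of the face
  is the same seen from either element.\<close>

lemma prism_opposite: "onormal W e = - onormal V e \<Longrightarrow> prism V e = (+) (onormal V e) ` prism W e"
proof -
  assume o: "onormal W e = - onormal V e"
  show ?thesis
  proof (intro equalityI subsetI)
    fix x assume "x \<in> prism V e"
    then obtain y t where "y \<in> convex hull e" "t \<in> {0..1}" "x = y + t *\<^sub>R onormal V e" by (auto simp: prism_def)
    then show "x \<in> (+) (onormal V e) ` prism W e"
      unfolding prism_def o
      by (intro image_eqI[of _ _ "y + (1 - t) *\<^sub>R (- onormal V e)"] CollectI exI[of _ y] exI[of _ "1 - t"])
        (auto simp: algebra_simps)
  next
    fix x assume "x \<in> (+) (onormal V e) ` prism W e"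
    then obtain y t where "y \<in> convex hull e" "t \<in> {0..1}" "x = onormal V e + (y + t *\<^sub>R (- onormal V e))"
      by (auto simp: prism_def o)
    then show "x \<in> prism V e"
      unfolding prism_def by (intro CollectI exI[of _ y] exI[of _ "1 - t"]) (auto simp: algebra_simps)
  qed
qed

lemma fint_one: "simplex_verts V \<Longrightarrow> q \<in> V \<Longrightarrow> fintq V q (\<lambda>_. 1) = measure lebesgue (prism V (V - {q}))"
  unfolding fint_eq by (intro lmeasure_integral[symmetric] lmeasurable_compact compact_prism)

text \<open>The sum is the flux of the field x through the boundary: on a face x . n is constant, so
  any vertex evaluates it, and the measure of the unit-height prism is the area. Applying the
  divergence theorem to each coordinate function gives d times the volume.\<close>

lemma sum_face_flux:
  fixes V :: "(real^'n::finite) set"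
  assumes V: "simplex_verts V"
  shows "(\<Sum>e\<in>faces V. (onormal V e \<bullet> (SOME p. p \<in> e)) * measure lebesgue (prism V e)) > 0"
proof -
  have "eint V (\<lambda>x. (axis i 1 :: real^'n) \<bullet> axis i 1) = (\<Sum>e\<in>faces V. (onormal V e \<bullet> axis i 1) * fint V e (\<lambda>x. x $ i))" for i :: 'n
  proof (rule simplex_divergence[OF V, where f="\<lambda>x. x $ i" and G="\<lambda>_. axis i 1" and v="axis i 1"])
    show "((\<lambda>x. x $ i) has_derivative (\<bullet>) (axis i 1)) (at x)" for x :: "real^'n"
    proof -
      have "(\<bullet>) (axis i 1) = (\<lambda>h::real^'n. h $ i)" by (simp add: inner_axis' fun_eq_iff)
      then show ?thesis by (simp only: bounded_linear_imp_has_derivative bounded_linear_vec_nth)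
    qed
  qed auto
  then have "(\<Sum>i\<in>UNIV. eint V (\<lambda>x. (axis i 1 :: real^'n) \<bullet> axis i 1)) =
      (\<Sum>i\<in>UNIV. \<Sum>e\<in>faces V. (onormal V e \<bullet> axis i 1) * fint V e (\<lambda>x. x $ i))"
    by (rule sum.cong[OF refl])
  also have "\<dots> = (\<Sum>q\<in>V. \<Sum>i\<in>UNIV. fintq V q (\<lambda>x. fnormal V q $ i * x $ i))"
    unfolding sum_faces by (subst sum.swap) (simp add: inner_axis fint_cmult[OF V] cong: sum.cong)
  also have "\<dots> = (\<Sum>q\<in>V. (fnormal V q \<bullet> (SOME p. p \<in> V - {q})) * measure lebesgue (prism V (V - {q})))"
  proof (intro sum.cong refl)
    fix q assume q: "q \<in> V"
    let ?e = "V - {q}" and ?n = "fnormal V q" and ?p = "SOME p. p \<in> V - {q}"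
    have "\<exists>p. p \<in> ?e" using simplex_face_nonempty[OF V q] by blast
    then have p: "?p \<in> ?e" by (rule someI_ex)
    have "(\<Sum>i\<in>UNIV. fint V ?e (\<lambda>x. ?n $ i * x $ i)) = fint V ?e (\<lambda>x. \<Sum>i\<in>UNIV. ?n $ i * x $ i)"
      unfolding fint_eq by (intro integral_sum[symmetric] fint_integrable[OF V q] continuous_intros) auto
    also have "\<dots> = fint V ?e (\<lambda>x. (?n \<bullet> ?p) * 1)"
    proof (rule fint_cong[OF V q])
      show "(\<Sum>i\<in>UNIV. ?n $ i * x $ i) = (?n \<bullet> ?p) * 1" if "x \<in> convex hull ?e" for x
        using face_hull_inner[OF V q p that] by (simp add: inner_diff_right) (simp add: inner_vec_def)
    qed
    also have "\<dots> = (?n \<bullet> ?p) * measure lebesgue (prism V ?e)"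
      unfolding fint_cmult[OF V q] fint_one[OF V q] ..
    finally show "(\<Sum>i\<in>UNIV. fint V ?e (\<lambda>x. ?n $ i * x $ i)) = (?n \<bullet> ?p) * measure lebesgue (prism V ?e)" .
  qed
  also have "\<dots> = (\<Sum>e\<in>faces V. (onormal V e \<bullet> (SOME p. p \<in> e)) * measure lebesgue (prism V e))"
    unfolding sum_faces ..
  finally have "(\<Sum>e\<in>faces V. (onormal V e \<bullet> (SOME p. p \<in> e)) * measure lebesgue (prism V e)) = real CARD('n) * eint V (\<lambda>x. 1)"
    by simp
  moreover have "eint V (\<lambda>x. 1) > 0"
  proof -
    have "eint V (\<lambda>x. 1) \<ge> 0" unfolding eint_def by (intro integral_nonneg eint_integrable[OF V]) auto
    moreover have "eint V (\<lambda>x. 1) \<noteq> 0"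
      using eint_zero_imp_zero[OF V, of "\<lambda>_. 1"] simplex_interior_nonempty[OF V] interior_subset by fastforce
    ultimately show ?thesis by simp
  qed
  ultimately show ?thesis by simp
qed

text \<open>If a relative interior point x of the face were interior to the union, points pushed
  slightly beyond the face would lie in other elements. These form a closed set, so x lies in some
  other W, and conformity forces the whole face into W. Remaining points of the face are limits of
  relative interior ones.\<close>

lemma unshared_face_subset_frontier:
  fixes T :: "(real^'n::finite) set set"
  assumes T: "simplicial_triangulation T" and VT: "V \<in> T" and e: "e \<in> faces V"
    and un: "\<And>W. W \<in> T \<Longrightarrow> e \<in> faces W \<Longrightarrow> W = V"
  shows "convex hull e \<subseteq> frontier (region T)"
proof -
  have V: "simplex_verts V" by (rule triangulationD(2)[OF T VT])
  obtain p where p: "p \<in> V" and ep: "e = V - {p}" using e by (auto simp: faces_eq)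
  define U where "U = (\<Union>V\<in>T. convex hull V)"
  have relint: "x \<in> frontier (region T)" if x: "bary V p x = 0" "\<And>r. r \<in> e \<Longrightarrow> bary V r x > 0" for x
  proof -
    have xV: "x \<in> convex hull V" using x unfolding simplex_hull[OF V] ep by (auto simp: less_imp_le) (metis DiffI order.refl less_imp_le singletonD)
    have "x \<notin> interior U"
    proof
      assume "x \<in> interior U"
      define K where "K = (\<Union>W\<in>T - {V}. convex hull W)"
      have "closed K" unfolding K_def using triangulationD(1)[OF T]
        by (intro closed_UN compact_imp_closed ballI compact_hull_simplex[OF triangulationD(2)[OF T] order_refl]) auto
      have "x \<in> closure K"
        unfolding closure_approachable
      proof (intro allI impI)
        fix \<epsilon> :: real assume "\<epsilon> > 0"
        obtain \<delta> where \<delta>: "\<delta> > 0" "ball x \<delta> \<subseteq> U" using \<open>x \<in> interior U\<close> mem_interior by blast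
        define \<mu> where "\<mu> = min \<epsilon> \<delta>"
        have \<mu>: "\<mu> > 0" "\<mu> \<le> \<epsilon>" "\<mu> \<le> \<delta>" using \<open>\<epsilon> > 0\<close> \<delta>(1) by (auto simp: \<mu>_def)
        define \<nu> where "\<nu> = norm (x - p) + 1"
        define t where "t = \<mu> / (2 * \<nu>)"
        have N: "\<nu> > 0" by (simp add: \<nu>_def add_nonneg_pos)
        have t: "t > 0" unfolding t_def using \<mu> N by simp
        \<comment> \<open>Moving away from p turns its coordinate from 0 into -t, so y leaves V; t
          is small enough that y stays in the given balls.\<close>
        define y where "y = x + t *\<^sub>R (x - p)"
        have "dist y x = t * norm (x - p)" using t by (simp add: y_def dist_norm)
        also have "\<dots> \<le> t * \<nu>" using t by (simp add: \<nu>_def)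
        also have "\<dots> = \<mu> / 2" using N by (simp add: t_def)
        finally have dy: "dist y x < \<epsilon>" "dist y x < \<delta>" using \<mu> by auto
        then have "y \<in> U" using \<delta>(2) by (auto simp: dist_commute)
        moreover have "y \<notin> convex hull V"
        proof -
          have "bary V p y < 0" using bary_shift[OF V p, of x t x p] x(1) t p by (simp add: y_def bary_vertex[OF V])
          then show ?thesis using p unfolding simplex_hull[OF V] by (auto simp: not_le intro!: bexI[of _ p])
        qed
        ultimately have "y \<in> K" by (auto simp: U_def K_def)
        then show "\<exists>y\<in>K. dist y x < \<epsilon>" using dy by blast
      qed
      then have "x \<in> K" using \<open>closed K\<close> by simp
      then obtain W where W: "W \<in> T" "W \<noteq> V" "x \<in> convex hull W" by (auto simp: K_def)
      then have "x \<in> convex hull (V \<inter> W)" using triangulationD(3)[OF T VT W(1)] xV by blast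
      \<comment> \<open>The coordinates of x at the vertices of e are strictly positive, so none of
        these vertices can be missing from W.\<close>
      then have "\<forall>r\<in>V - (V \<inter> W). bary V r x = 0" by (simp add: simplex_subset_hull[OF V])
      then have eW: "e \<subseteq> W" using x(2) ep by force
      have Ws: "simplex_verts W" by (rule triangulationD(2)[OF T W(1)])
      have "card e = CARD('n)" using simplex_vertsD[OF V] p ep by simp
      then have "card (W - e) = 1"
        using simplex_vertsD[OF Ws] eW finite_subset[OF eW] by (simp add: card_Diff_subset)
      then obtain q where "W - e = {q}" by (rule card_1_singletonE)
      then have "q \<in> W" "e = W - {q}" using eW by auto
      then have "e \<in> faces W" by (auto simp: faces_eq)
      then show False using un W by blast
    qed
    moreover have "x \<in> closure (region T)"
    proof -
      have "x \<in> closure (interior (convex hull V))"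
        using xV convex_closure_interior[OF convex_convex_hull simplex_interior_nonempty[OF V]] closure_subset by blast
      moreover have "interior (convex hull V) \<subseteq> region T"
        unfolding region_def using VT by (intro interior_mono) auto
      ultimately show ?thesis using closure_mono by blast
    qed
    ultimately show ?thesis unfolding frontier_def region_def U_def by auto
  qed
  show ?thesis
  proof
    fix y assume y: "y \<in> convex hull e"
    then have yb: "bary V p y = 0" "\<And>r. r \<in> e \<Longrightarrow> bary V r y \<ge> 0" unfolding ep face_hull[OF V p] by auto
    obtain c where c: "bary V p c = 0" "\<And>r. r \<in> V - {p} \<Longrightarrow> bary V r c = 1 / real CARD('n)"
      by (rule face_centroid[OF V p]) blast
    \<comment> \<open>Moving y toward the centroid makes all face coordinates strictly positive; for
      n = 0 it is the centroid itself.\<close>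
    define s where "s n = y + (1 / real (Suc n)) *\<^sub>R (c - y)" for n
    have "s n \<in> frontier (region T)" for n
    proof (rule relint)
      have b: "bary V r (s n) = (1 - 1 / real (Suc n)) * bary V r y + (1 / real (Suc n)) * bary V r c" if "r \<in> V" for r
        unfolding s_def bary_shift[OF V that] by (simp add: algebra_simps)
      show "bary V p (s n) = 0" using b[OF p] yb c by simp
      show "bary V r (s n) > 0" if "r \<in> e" for r
      proof -
        have "(1 - 1 / real (Suc n)) * bary V r y \<ge> 0" using yb(2)[OF that] by (intro mult_nonneg_nonneg) auto
        moreover have "(1 / real (Suc n)) * bary V r c > 0" using c(2)[of r] that ep by simp
        ultimately show ?thesis using b[of r] that ep by simp
      qed
    qed
    moreover have "s \<longlonglongrightarrow> y + 0 *\<^sub>R (c - y)"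
      unfolding s_def by (intro tendsto_intros LIMSEQ_Suc lim_inverse_n')
    ultimately show "y \<in> frontier (region T)"
      using closed_sequentially[OF frontier_closed] by fastforce
  qed
qed

text \<open>The flux balance treats all elements with the same value at once and so avoids following
  a chain of neighbours to the boundary.\<close>

lemma piecewise_constant_zero:
  fixes T :: "(real^'n::finite) set set"
  assumes T: "simplicial_triangulation T"
    and c: "\<And>V e x. V \<in> T \<Longrightarrow> e \<in> faces V \<Longrightarrow> x \<in> convex hull e \<Longrightarrow> sb e x = c V"
    and bd: "\<And>e x. e \<in> mesh_faces T \<Longrightarrow> convex hull e \<subseteq> frontier (region T) \<Longrightarrow> x \<in> convex hull e \<Longrightarrow> sb e x = (0::real)"
    and V: "V \<in> T"
  shows "c V = 0"
proof (rule ccontr)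
  assume nz: "c V \<noteq> 0"
  define A where "A = {W \<in> T. c W = c V}"
  define F where "F W e = (onormal W e \<bullet> (SOME p. p \<in> e)) * measure lebesgue (prism W e)" for W e :: "(real^'n) set"
  have fA: "finite A" using triangulationD(1)[OF T] by (simp add: A_def)
  have ne: "\<exists>x. x \<in> convex hull e" if "W \<in> T" "e \<in> faces W" for W e
  proof -
    obtain q where "q \<in> W" "e = W - {q}" using \<open>e \<in> faces W\<close> by (auto simp: faces_eq)
    then have "e \<noteq> {}" using simplex_face_nonempty[OF triangulationD(2)[OF T \<open>W \<in> T\<close>]] by auto
    then show ?thesis using hull_inc by fast
  qed
  have opp: "onormal X e = - onormal W e" if "W \<in> T" "X \<in> T" "W \<noteq> X" "e \<in> faces W" "e \<in> faces X" for W X e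
  proof -
    obtain p where "p \<in> W" "e = W - {p}" using \<open>e \<in> faces W\<close> by (auto simp: faces_eq)
    moreover obtain q where "q \<in> X" "e = X - {q}" using \<open>e \<in> faces X\<close> by (auto simp: faces_eq)
    ultimately show ?thesis
      using adjacent_opposite[OF triangulationD(2)[OF T that(1)] triangulationD(2)[OF T that(2)] triangulationD(3)[OF T that(1,2)], of p q] that by auto
  qed
  have nn: "onormal W e \<noteq> 0" if "W \<in> T" "e \<in> faces W" for W e
  proof -
    obtain q where "q \<in> W" "e = W - {q}" using \<open>e \<in> faces W\<close> by (auto simp: faces_eq)
    then show ?thesis using norm_onormal[OF triangulationD(2)[OF T \<open>W \<in> T\<close>]] by force
  qed
  have pair: "(\<Sum>W\<in>{W \<in> A. e \<in> faces W}. F W e) = 0" for e :: "(real^'n) set"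
  proof (cases "\<exists>W\<in>A. e \<in> faces W")
    case False
    then have "{W \<in> A. e \<in> faces W} = {}" by blast
    then show ?thesis by (simp only: sum.empty)
  next
    case True
    then obtain W where W: "W \<in> A" "e \<in> faces W" by blast
    then have WT: "W \<in> T" "c W = c V" by (auto simp: A_def)
    obtain x where x: "x \<in> convex hull e" using ne[OF WT(1) W(2)] by blast
    \<comment> \<open>The face value is c V, which is nonzero, so e is not a boundary face and must
      be shared. The neighbour has the same face value and hence belongs to A as well.\<close>
    have "\<exists>X\<in>T. e \<in> faces X \<and> X \<noteq> W"
    proof (rule ccontr)
      assume "\<not> ?thesis"
      then have "convex hull e \<subseteq> frontier (region T)"
        using unshared_face_subset_frontier[OF T WT(1) W(2)] by blast
      then have "sb e x = 0" using bd[of e x] x W(2) WT(1) by (auto simp: mesh_faces_def)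
      then show False using c[OF WT(1) W(2) x] WT(2) nz by simp
    qed
    then obtain X where X: "X \<in> T" "e \<in> faces X" "X \<noteq> W" by blast
    have "c X = c V" using c[OF X(1,2) x] c[OF WT(1) W(2) x] WT(2) by simp
    then have XA: "X \<in> A" using X by (simp add: A_def)
    \<comment> \<open>Three elements cannot share a face: their normals would be pairwise opposite,
      hence zero.\<close>
    have "Y = W \<or> Y = X" if "Y \<in> A" "e \<in> faces Y" for Y
    proof (rule ccontr)
      assume n: "\<not> (Y = W \<or> Y = X)"
      have Y: "Y \<in> T" using that by (simp add: A_def)
      have "onormal Y e = - onormal W e" "onormal Y e = - onormal X e" "onormal X e = - onormal W e"
        using opp[of W Y e] opp[of X Y e] opp[of W X e] n Y that X WT W by auto
      then have "onormal W e = - onormal W e" by simp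
      then have "2 *\<^sub>R onormal W e = 0" by (metis add.right_inverse scaleR_2)
      then show False using nn[OF WT(1) W(2)] by simp
    qed
    then have "{W \<in> A. e \<in> faces W} = {W, X}" using W X XA by blast
    moreover have "F X e = - F W e"
    proof -
      have o: "onormal X e = - onormal W e" using opp[OF WT(1) X(1) _ W(2) X(2)] X(3) by blast
      have "measure lebesgue (prism W e) = measure lebesgue (prism X e)"
        unfolding prism_opposite[OF o] by (rule measure_translation)
      then show ?thesis by (simp add: F_def o)
    qed
    ultimately show ?thesis using X(3) by simp
  qed
  have ff: "finite (faces W)" if "W \<in> A" for W
    using simplex_vertsD(1)[OF triangulationD(2)[OF T]] that by (auto simp: faces_eq A_def)
  define E where "E = (\<Union>W\<in>A. faces W)"
  have fE: "finite E" using fA ff by (simp add: E_def)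
  have "0 < (\<Sum>W\<in>A. \<Sum>e\<in>faces W. F W e)"
    unfolding F_def using fA V triangulationD(2)[OF T]
    by (intro sum_pos sum_face_flux) (auto simp: A_def)
  also have "(\<Sum>W\<in>A. \<Sum>e\<in>faces W. F W e) = (\<Sum>W\<in>A. \<Sum>e\<in>{e \<in> E. e \<in> faces W}. F W e)"
    by (intro sum.cong) (auto simp: E_def)
  also have "\<dots> = (\<Sum>e\<in>E. \<Sum>W\<in>{W \<in> A. e \<in> faces W}. F W e)"
    by (rule sum.swap_restrict[OF fA fE])
  also have "\<dots> = 0" using pair by simp
  finally show False by simp
qed

lemma coercivity:
  fixes T :: "(real^'n::finite) set set"
  assumes T: "simplicial_triangulation T"
    and s0: "\<And>V. V \<in> T \<Longrightarrow> s0 V \<in> polys k" and sb: "\<And>e. cont (sb e)"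
    and bd: "\<And>e x. e \<in> mesh_faces T \<Longrightarrow> convex hull e \<subseteq> frontier (region T) \<Longrightarrow> x \<in> convex hull e \<Longrightarrow> sb e x = 0"
    and km: "k - 1 \<le> m" and ml: "m \<le> l"
    and g: "\<And>V. V \<in> T \<Longrightarrow> eint V (\<lambda>x. wgrad m V (s0 V) sb x \<bullet> wgrad m V (s0 V) sb x) = 0"
    and s: "\<And>V. V \<in> T \<Longrightarrow> stab l V (s0 V) sb (s0 V) sb = 0"
    and V: "V \<in> T"
  shows "s0 V = (\<lambda>_. 0)" and "e \<in> faces V \<Longrightarrow> x \<in> convex hull e \<Longrightarrow> sb e x = 0"
proof -
  have "\<exists>c. \<forall>V\<in>T. s0 V = (\<lambda>_. c V) \<and> (\<forall>e\<in>faces V. \<forall>x\<in>convex hull e. sb e x = c V)"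
    using local_coercivity[OF triangulationD(2)[OF T] s0 sb km ml g s] by (intro bchoice ballI) blast
  then obtain c where c: "\<And>V. V \<in> T \<Longrightarrow> s0 V = (\<lambda>_. c V)"
    "\<And>V e x. V \<in> T \<Longrightarrow> e \<in> faces V \<Longrightarrow> x \<in> convex hull e \<Longrightarrow> sb e x = c V" by blast
  have z: "c V = 0" by (rule piecewise_constant_zero[OF T c(2) bd V])
  then show "s0 V = (\<lambda>_. 0)" using c(1)[OF V] by simp
  show "e \<in> faces V \<Longrightarrow> x \<in> convex hull e \<Longrightarrow> sb e x = 0" using c(2)[OF V] z by simp
qed

section \<open>Linearity of the discrete forms\<close>

lemma lin_on_vcomp: "lin_on W (vcomp i)"
  by (simp add: lin_on_def vcomp_def plus_prod_def scaleR_prod_def plus_fun_def scaleR_fun_def)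

lemma vcomp_scont: "v \<in> vcont \<Longrightarrow> vcomp i v \<in> scont"
  by (auto simp: vcont_def scont_def vcomp_def intro: continuous_intros)

text \<open>The scalar form common to both problems: \<open>abar\<close> is a multiple of it and
  \<open>ah\<close> a multiple of its sum over velocity components, so one coercivity result serves
  both.\<close>

definition energy :: "nat \<Rightarrow> nat \<Rightarrow> (real^'n::finite) set set \<Rightarrow> 'n sfun \<Rightarrow> 'n sfun \<Rightarrow> real" where
  "energy m l T s t =
     (\<Sum>V\<in>T. eint V (\<lambda>x. wgrad m V (fst s V) (snd s) x \<bullet> wgrad m V (fst t V) (snd t) x)) +
     (\<Sum>V\<in>T. stab l V (fst s V) (snd s) (fst t V) (snd t))"

lemma abar_eq: "abar m l \<kappa> T s t = \<kappa> * energy m l T s t"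
  by (simp add: abar_def energy_def algebra_simps)

lemma ah_eq: "ah m l Pr T u v = Pr * (\<Sum>i\<in>UNIV. energy m l T (vcomp i u) (vcomp i v))"
  unfolding ah_def energy_def sum.distrib
  by (subst (1 2) sum.swap) (simp add: algebra_simps)

lemma sqproj_continuous:
  assumes "simplex_verts V" "q \<in> V" "s \<in> scont"
  shows "continuous_on (fhull V q) (\<lambda>x. qproj l V (V - {q}) (fst s V) x - snd s (V - {q}) x)"
  by (intro continuous_intros continuous_fpolys[OF qproj_in[OF assms(1,2) scontD(1)[OF assms(3)]]] cont_on[OF scontD(2)[OF assms(3)]])

lemma energy_sym: "energy m l T s t = energy m l T t s"
  by (simp add: energy_def stab_def inner_commute mult.commute)

lemma energy_bilin:
  assumes T: "\<And>V. V \<in> T \<Longrightarrow> simplex_verts V"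
  shows "bilin_on scont scont (energy m l T)"
proof (rule bilin_on_symI[OF energy_sym])
  fix t :: "'a sfun" assume t: "t \<in> scont"
  have "lin_on scont (\<lambda>s. eint V (\<lambda>x. wgrad m V (fst s V) (snd s) x \<bullet> wgrad m V (fst t V) (snd t) x))" if V: "V \<in> T" for V
    using lin_on_apply[OF wgrad_lin[OF T[OF V], of m]]
    by (intro eint_lin_continuous[OF T[OF V]] continuous_on_inner cont_on[OF swgrad_continuous[OF T[OF V]]] t)
      (simp_all add: lin_on_def inner_add_left)
  moreover have "lin_on scont (\<lambda>s. stab l V (fst s V) (snd s) (fst t V) (snd t))" if V: "V \<in> T" for V
    unfolding stab_def sum_faces
  proof (intro lin_on_sum' lin_on_cmult fint_lin[OF T[OF V]] continuous_on_mult sqproj_continuous[OF T[OF V]] t)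
    fix q x assume q: "q \<in> V"
    show "lin_on scont (\<lambda>s. (qproj l V (V - {q}) (fst s V) x - snd s (V - {q}) x) * (qproj l V (V - {q}) (fst t V) x - snd t (V - {q}) x))"
      using lin_on_apply[OF qproj_lin[OF T[OF V] q, of l], of x] unfolding lin_on_def
      by (simp add: scontD left_diff_distrib distrib_right right_diff_distrib)
  qed
  ultimately show "lin_on scont (\<lambda>s. energy m l T s t)"
    unfolding energy_def by (intro lin_on_add lin_on_sum')
qed

lemma
  assumes T: "\<And>V. V \<in> T \<Longrightarrow> simplex_verts V" and s: "s \<in> scont" and V: "V \<in> T"
  shows wgrad_square_nonneg: "eint V (\<lambda>x. wgrad m V (fst s V) (snd s) x \<bullet> wgrad m V (fst s V) (snd s) x) \<ge> 0"
    and stab_square_nonneg: "stab l V (fst s V) (snd s) (fst s V) (snd s) \<ge> 0"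
proof -
  show "eint V (\<lambda>x. wgrad m V (fst s V) (snd s) x \<bullet> wgrad m V (fst s V) (snd s) x) \<ge> 0"
    unfolding eint_def
    by (intro integral_nonneg eint_integrable[OF T[OF V]] continuous_intros cont_on[OF swgrad_continuous[OF T[OF V] s]]) auto
  show "stab l V (fst s V) (snd s) (fst s V) (snd s) \<ge> 0"
    unfolding stab_def sum_faces
  proof (intro sum_nonneg mult_nonneg_nonneg)
    fix q assume q: "q \<in> V"
    show "fintq V q (\<lambda>x. (qproj l V (V - {q}) (fst s V) x - snd s (V - {q}) x) * (qproj l V (V - {q}) (fst s V) x - snd s (V - {q}) x)) \<ge> 0"
      by (intro fint_nonneg[OF T[OF V] q] continuous_on_mult sqproj_continuous[OF T[OF V] q s]) auto
  qed (use hK_pos[OF T[OF V]] in auto)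
qed

lemma energy_nonneg:
  assumes T: "\<And>V. V \<in> T \<Longrightarrow> simplex_verts V" and s: "s \<in> scont"
  shows "energy m l T s s \<ge> 0"
  unfolding energy_def
  by (intro add_nonneg_nonneg sum_nonneg wgrad_square_nonneg[OF T s] stab_square_nonneg[OF T s])

text \<open>A face component is represented by a function on the whole space, but only its values on the face matter;
  hence the energy is merely semidefinite, with kernel given by agreement with 0.\<close>
definition agree :: "(real^'n::finite) set set \<Rightarrow> 'n sfun \<Rightarrow> 'n sfun \<Rightarrow> bool" where
  "agree T s t \<longleftrightarrow> (\<forall>V\<in>T. fst s V = fst t V \<and> (\<forall>e\<in>faces V. \<forall>x\<in>convex hull e. snd s e x = snd t e x))"

lemma agreeD:
  assumes "agree T s t" "V \<in> T"
  shows "fst s V = fst t V" "e \<in> faces V \<Longrightarrow> x \<in> convex hull e \<Longrightarrow> snd s e x = snd t e x"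
  using assms by (auto simp: agree_def)

lemma energy_zero_imp_agree:
  assumes T: "simplicial_triangulation T" and s: "s \<in> scont" and sk: "\<And>V. V \<in> T \<Longrightarrow> fst s V \<in> polys k"
    and bd: "\<And>e x. e \<in> mesh_faces T \<Longrightarrow> convex hull e \<subseteq> frontier (region T) \<Longrightarrow> x \<in> convex hull e \<Longrightarrow> snd s e x = 0"
    and km: "k - 1 \<le> m" and ml: "m \<le> l" and z: "energy m l T s s = 0"
  shows "agree T s 0"
proof -
  note Ts = triangulationD(2)[OF T]
  let ?g = "\<lambda>V. eint V (\<lambda>x. wgrad m V (fst s V) (snd s) x \<bullet> wgrad m V (fst s V) (snd s) x)"
  let ?s = "\<lambda>V. stab l V (fst s V) (snd s) (fst s V) (snd s)"
  have g: "\<And>V. V \<in> T \<Longrightarrow> 0 \<le> ?g V" by (rule wgrad_square_nonneg[OF Ts s])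
  have t: "\<And>V. V \<in> T \<Longrightarrow> 0 \<le> ?s V" by (rule stab_square_nonneg[OF Ts s])
  have "sum ?g T = 0 \<and> sum ?s T = 0"
    using z unfolding energy_def by (subst (asm) add_nonneg_eq_0_iff) (auto intro!: sum_nonneg g t)
  then have "\<And>V. V \<in> T \<Longrightarrow> ?g V = 0" "\<And>V. V \<in> T \<Longrightarrow> ?s V = 0"
    using sum_nonneg_eq_0_iff[OF triangulationD(1)[OF T] g] sum_nonneg_eq_0_iff[OF triangulationD(1)[OF T] t] by auto
  note * = coercivity[OF T sk scontD(2)[OF s] bd km ml this]
  show ?thesis
    unfolding agree_def using * by (auto simp: zero_fun_def)
qed

text \<open>Lets a test function be changed off the mesh, both to discard kernel vectors and to pass
  from \<open>Sh0\<close> to its cut-off version.\<close>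

lemma energy_cong:
  assumes T: "\<And>V. V \<in> T \<Longrightarrow> simplex_verts V" and a: "agree T s s'"
  shows "energy m l T t s = energy m l T t s'"
proof -
  have "wgrad m V (fst s V) (snd s) = wgrad m V (fst s' V) (snd s')" if "V \<in> T" for V
    using agreeD[OF a that] by (intro wgrad_cong[OF T[OF that]]) auto
  moreover have "stab l V (fst t V) (snd t) (fst s V) (snd s) = stab l V (fst t V) (snd t) (fst s' V) (snd s')" if V: "V \<in> T" for V
    unfolding stab_def sum_faces agreeD(1)[OF a V]
    by (intro sum.cong refl arg_cong2[where f="(*)"] fint_cong[OF T[OF V]])
      (auto simp: agreeD(2)[OF a V] faces_eq)
  ultimately show ?thesis unfolding energy_def by simp
qed

text \<open>The unsymmetrized convection form; \<open>cbar\<close> is its skew part in t and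
  s.\<close>

definition conv :: "nat \<Rightarrow> (real^'n::finite) set set \<Rightarrow> 'n vfun \<Rightarrow> 'n sfun \<Rightarrow> 'n sfun \<Rightarrow> real" where
  "conv k T w t s = (\<Sum>V\<in>T. eint V (\<lambda>x. wdiv_scal k V w t x * fst s V x))"

lemma cbar_eq: "cbar k T w t s = (1/2) * conv k T w t s + (- 1/2) * conv k T w s t"
  by (simp add: cbar_def conv_def)

lemma conv_integrable:
  assumes "simplex_verts V" "w \<in> vcont" "t \<in> scont" "s \<in> scont"
  shows "(\<lambda>x. wdiv_scal k V w t x * fst s V x) integrable_on (convex hull V)"
  by (intro eint_integrable[OF assms(1)] continuous_on_mult cont_on[OF wdiv_scal_continuous[OF assms(1-3)]] cont_on[OF scontD(1)[OF assms(4)]])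

lemma conv_lin:
  assumes T: "\<And>V. V \<in> T \<Longrightarrow> simplex_verts V"
  shows "t \<in> scont \<Longrightarrow> s \<in> scont \<Longrightarrow> lin_on vcont (\<lambda>w. conv k T w t s)"
    and "w \<in> vcont \<Longrightarrow> s \<in> scont \<Longrightarrow> lin_on scont (\<lambda>t. conv k T w t s)"
    and "w \<in> vcont \<Longrightarrow> t \<in> scont \<Longrightarrow> lin_on scont (\<lambda>s. conv k T w t s)"
proof -
  show "lin_on vcont (\<lambda>w. conv k T w t s)" if "t \<in> scont" "s \<in> scont"
    unfolding conv_def
  proof (intro lin_on_sum' eint_lin[OF T])
    show "lin_on vcont (\<lambda>w. wdiv_scal k V w t x * fst s V x)" if "V \<in> T" for V x
      using lin_on_apply[OF wdiv_scal_lin1[OF T[OF that] \<open>t \<in> scont\<close>, of k], of x] by (simp add: lin_on_def algebra_simps)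
    show "(\<lambda>x. wdiv_scal k V w t x * fst s V x) integrable_on (convex hull V)" if "V \<in> T" "w \<in> vcont" for V w
      by (rule conv_integrable[OF T[OF that(1)] that(2) \<open>t \<in> scont\<close> \<open>s \<in> scont\<close>])
  qed
  show "lin_on scont (\<lambda>t. conv k T w t s)" if "w \<in> vcont" "s \<in> scont"
    unfolding conv_def
  proof (intro lin_on_sum' eint_lin[OF T])
    show "lin_on scont (\<lambda>t. wdiv_scal k V w t x * fst s V x)" if "V \<in> T" for V x
      using lin_on_apply[OF wdiv_scal_lin2[OF T[OF that] \<open>w \<in> vcont\<close>, of k], of x] by (simp add: lin_on_def algebra_simps)
    show "(\<lambda>x. wdiv_scal k V w t x * fst s V x) integrable_on (convex hull V)" if "V \<in> T" "t \<in> scont" for V t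
      by (rule conv_integrable[OF T[OF that(1)] \<open>w \<in> vcont\<close> that(2) \<open>s \<in> scont\<close>])
  qed
  show "lin_on scont (\<lambda>s. conv k T w t s)" if "w \<in> vcont" "t \<in> scont"
    unfolding conv_def
  proof (intro lin_on_sum' eint_lin[OF T])
    show "lin_on scont (\<lambda>s. wdiv_scal k V w t x * fst s V x)" for V x
      by (simp add: lin_on_def algebra_simps)
    show "(\<lambda>x. wdiv_scal k V w t x * fst s V x) integrable_on (convex hull V)" if "V \<in> T" "s \<in> scont" for V s
      by (rule conv_integrable[OF T[OF that(1)] \<open>w \<in> vcont\<close> \<open>t \<in> scont\<close> that(2)])
  qed
qed

lemma cbar_lin:
  assumes T: "\<And>V. V \<in> T \<Longrightarrow> simplex_verts V"
  shows cbar_bilin1: "t \<in> scont \<Longrightarrow> bilin_on vcont scont (\<lambda>w s. cbar k T w t s)"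
    and cbar_bilin2: "w \<in> vcont \<Longrightarrow> bilin_on scont scont (\<lambda>t s. cbar k T w t s)"
  unfolding cbar_eq
  by (intro bilin_on_add bilin_on_cmult; simp add: bilin_on_def conv_lin[OF T])+

lemma cbar_skew: "cbar k T w s s = 0"
  by (simp add: cbar_def)

lemma cbar_cong:
  assumes T: "\<And>V. V \<in> T \<Longrightarrow> simplex_verts V" and a: "agree T s s'"
  shows "cbar k T w t s = cbar k T w t s'"
proof -
  have "wdiv_scal k V w s = wdiv_scal k V w s'" if V: "V \<in> T" for V
    unfolding wdiv_scal_def fun_eq_iff agreeD(1)[OF a V]
    by (intro allI fun_cong[OF wdiv_cong[OF T[OF V]]]) (auto simp: agreeD(2)[OF a V])
  then show ?thesis unfolding cbar_def by (simp add: agreeD(1)[OF a])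
qed

text \<open>The weak divergence of a tensor acts row by row, so momentum convection is the scalar
  transport of each velocity component by w.\<close>

lemma ch_eq:
  assumes T: "\<And>V. V \<in> T \<Longrightarrow> simplex_verts V" and w: "w \<in> vcont" and u: "u \<in> vcont" and v: "v \<in> vcont"
  shows "ch k T w u v = (\<Sum>i\<in>UNIV. cbar k T w (vcomp i u) (vcomp i v))"
proof -
  have e: "eint V (\<lambda>x. wdiv_tensor k V u w x \<bullet> fst v V x) = (\<Sum>i\<in>UNIV. eint V (\<lambda>x. wdiv_scal k V w (vcomp i u) x * fst (vcomp i v) V x))"
    if V: "V \<in> T" and u: "u \<in> vcont" and v: "v \<in> vcont" for V u v
  proof -
    have "wdiv_tensor k V u w x \<bullet> fst v V x = (\<Sum>i\<in>UNIV. wdiv_scal k V w (vcomp i u) x * fst (vcomp i v) V x)" for x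
      by (simp add: wdiv_tensor_def wdiv_scal_def vcomp_def inner_vec_def)
    then show ?thesis
      unfolding eint_def using conv_integrable[OF T[OF V] w vcomp_scont[OF u] vcomp_scont[OF v]] by (simp add: integral_sum)
  qed
  have c: "(\<Sum>V\<in>T. eint V (\<lambda>x. wdiv_tensor k V u w x \<bullet> fst v V x)) = (\<Sum>i\<in>UNIV. conv k T w (vcomp i u) (vcomp i v))"
    if "u \<in> vcont" "v \<in> vcont" for u v
    unfolding conv_def by (subst sum.swap) (simp add: e that)
  show ?thesis
    unfolding ch_def cbar_eq c[OF u v] c[OF v u] by (simp add: sum_subtractf sum_distrib_left)
qed

section \<open>Buoyancy and load terms\<close>

lemma dh_lin:
  assumes T: "\<And>V. V \<in> T \<Longrightarrow> simplex_verts V"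
  shows "bilin_on scont vcont (dh j Pr Ra T)"
  unfolding bilin_on_def dh_def
proof (intro conjI ballI lin_on_cmult lin_on_sum' eint_lin[OF T])
  show "(\<lambda>x. fst s V x * fst v V x $ j) integrable_on (convex hull V)" if "V \<in> T" "s \<in> scont" "v \<in> vcont" for V s v
    by (intro eint_integrable[OF T[OF that(1)]] continuous_intros cont_on[OF scontD(1)[OF that(2)]] cont_on[OF vcontD(1)[OF that(3)]])
  then show "(\<lambda>x. fst s V x * fst v V x $ j) integrable_on (convex hull V)" if "V \<in> T" "v \<in> vcont" "s \<in> scont" for V s v
    using that by blast
qed (simp_all add: lin_on_def algebra_simps)

text \<open>The data are square integrable only on the interior of the union, whereas an element is
  closed and may touch its boundary. The product is dominated by the sum of squares on the open
  element, and the frontier of a convex set is negligible.\<close>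

lemma L2_integrable:
  fixes f :: "real^'n::finite \<Rightarrow> 'b::euclidean_space"
  assumes V: "simplex_verts V" "V \<in> T" and f: "L2_on (region T) f" and h: "cont h"
  shows "(\<lambda>x. f x \<bullet> h x) integrable_on (convex hull V)"
proof -
  define S where "S = interior (convex hull V)"
  have SR: "S \<subseteq> region T" unfolding S_def region_def using V(2) by (intro interior_mono) auto
  have Sl: "S \<in> sets lebesgue" "region T \<in> sets lebesgue"
    unfolding S_def region_def by (auto intro: lebesgue_openin)
  have hc: "continuous_on (convex hull V) h" by (rule cont_on[OF h])
  have "(\<lambda>x. f x \<bullet> h x) integrable_on S"
  proof (rule measurable_bounded_by_integrable_imp_integrable[where g="\<lambda>x. norm (f x) ^ 2 + norm (h x) ^ 2", OF _ _ _ Sl(1)])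
    have fm: "f \<in> borel_measurable (lebesgue_on (region T))"
      using f Sl(2) measurable_on_iff_borel_measurable unfolding L2_on_def by blast
    have "f \<in> borel_measurable (lebesgue_on S)" by (rule measurable_restrict_mono[OF fm SR])
    moreover have "h \<in> borel_measurable (lebesgue_on S)"
      by (rule continuous_imp_measurable_on_sets_lebesgue[OF cont_on[OF h] Sl(1)])
    ultimately show "(\<lambda>x. f x \<bullet> h x) \<in> borel_measurable (lebesgue_on S)" by (rule borel_measurable_inner)
    have "(\<lambda>x. norm (f x) ^ 2) absolutely_integrable_on region T"
      using f unfolding L2_on_def by (intro nonnegative_absolutely_integrable_1) auto
    then have 1: "(\<lambda>x. norm (f x) ^ 2) integrable_on S"
      using set_integrable_subset[OF _ Sl(1) SR] by (auto intro: set_lebesgue_integral_eq_integral(1))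
    have "(\<lambda>x. norm (h x) ^ 2) absolutely_integrable_on convex hull V"
      by (intro nonnegative_absolutely_integrable_1 eint_integrable[OF V(1)] continuous_intros hc) auto
    then have 2: "(\<lambda>x. norm (h x) ^ 2) integrable_on S"
      using set_integrable_subset[OF _ Sl(1), of "convex hull V"] interior_subset
      unfolding S_def by (auto intro: set_lebesgue_integral_eq_integral(1))
    show "(\<lambda>x. norm (f x) ^ 2 + norm (h x) ^ 2) integrable_on S" by (rule integrable_add[OF 1 2])
    show "norm (f x \<bullet> h x) \<le> norm (f x) ^ 2 + norm (h x) ^ 2" for x
    proof -
      have "\<bar>f x \<bullet> h x\<bar> \<le> norm (f x) * norm (h x)" by (rule Cauchy_Schwarz_ineq2)
      moreover have "0 \<le> (norm (f x) - norm (h x))\<^sup>2" "0 \<le> norm (f x) ^ 2" "0 \<le> norm (h x) ^ 2" by simp_all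
      ultimately show ?thesis by (simp add: power2_diff)
    qed
  qed
  moreover have "negligible ((S - convex hull V) \<union> (convex hull V - S))"
  proof (rule negligible_subset[OF negligible_convex_frontier[OF convex_convex_hull[of V]]])
    show "S - convex hull V \<union> (convex hull V - S) \<subseteq> frontier (convex hull V)"
      unfolding S_def frontier_def using interior_subset closure_subset by blast
  qed
  ultimately show ?thesis using integrable_spike_set_eq by blast
qed

lemma load_lin:
  fixes h :: "'a::real_vector \<Rightarrow> (real^'n::finite) set \<Rightarrow> real^'n \<Rightarrow> 'b::euclidean_space"
  assumes T: "\<And>V. V \<in> T \<Longrightarrow> simplex_verts V" and f: "L2_on (region T) f"
    and h: "\<And>V x. lin_on W (\<lambda>s. h s V x)" "\<And>s V. s \<in> W \<Longrightarrow> cont (h s V)"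
  shows "lin_on W (\<lambda>s. \<Sum>V\<in>T. eint V (\<lambda>x. f x \<bullet> h s V x))"
proof (intro lin_on_sum' eint_lin[OF T])
  show "lin_on W (\<lambda>s. f x \<bullet> h s V x)" for V x
    using h(1)[of V x] by (simp add: lin_on_def inner_add_right)
  show "(\<lambda>x. f x \<bullet> h s V x) integrable_on (convex hull V)" if "V \<in> T" "s \<in> W" for V s
    by (rule L2_integrable[OF T[OF that(1)] that(1) f h(2)[OF that(2)]])
qed

section \<open>The discrete spaces\<close>

definition finitely_spanned :: "'a::real_vector set \<Rightarrow> bool" where
  "finitely_spanned W \<longleftrightarrow> (\<exists>S. finite S \<and> W \<subseteq> span S)"

lemma finitely_spanned_subset: "finitely_spanned W \<Longrightarrow> U \<subseteq> W \<Longrightarrow> finitely_spanned U"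
  unfolding finitely_spanned_def by blast

lemma finitely_spanned_Times:
  fixes A :: "'a::real_vector set" and B :: "'b::real_vector set"
  assumes "finitely_spanned A" "finitely_spanned B"
  shows "finitely_spanned (A \<times> B)"
proof -
  obtain S R where S: "finite S" "A \<subseteq> span S" and R: "finite R" "B \<subseteq> span R"
    using assms by (auto simp: finitely_spanned_def)
  have l1: "linear (\<lambda>x::'a. (x, 0::'b))" and l2: "linear (\<lambda>x::'b. (0::'a, x))"
    by (auto intro!: linearI)
  define X where "X = (\<lambda>x. (x, 0)) ` S \<union> (\<lambda>x. (0, x)) ` R"
  have "(x, y) \<in> span X" if "x \<in> A" "y \<in> B" for x y
  proof -
    have "(x, 0) \<in> span X"
      using that(1) S(2) linear_span_image[OF l1, of S] span_mono[of "(\<lambda>x. (x, 0)) ` S" X] by (auto simp: X_def)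
    moreover have "(0, y) \<in> span X"
      using that(2) R(2) linear_span_image[OF l2, of R] span_mono[of "(\<lambda>x. (0, x)) ` R" X] by (auto simp: X_def)
    ultimately show ?thesis using span_add[of "(x, 0)" X "(0, y)"] by simp
  qed
  moreover have "finite X" using S R by (simp add: X_def)
  ultimately show ?thesis unfolding finitely_spanned_def by (intro exI[of _ X]) auto
qed

text \<open>Families over elements or faces that vanish off the index set; for finite I and finitely
  spanned P they form a finitely spanned set although the index type is infinite.\<close>

definition supported :: "'i set \<Rightarrow> 'a::zero set \<Rightarrow> ('i \<Rightarrow> 'a) set" where
  "supported I P = {f. (\<forall>i\<in>I. f i \<in> P) \<and> (\<forall>i. i \<notin> I \<longrightarrow> f i = 0)}"

lemma finitely_spanned_supported:
  fixes P :: "'a::real_vector set" and I :: "'i set"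
  assumes I: "finite I" and P: "finitely_spanned P"
  shows "finitely_spanned (supported I P)"
proof -
  obtain S where S: "finite S" "P \<subseteq> span S" using P by (auto simp: finitely_spanned_def)
  define ext where "ext i p = (\<lambda>j. if j = i then p else 0)" for i :: 'i and p :: 'a
  have l: "linear (ext i)" for i by (auto intro!: linearI simp: ext_def fun_eq_iff)
  define X where "X = (\<Union>i\<in>I. ext i ` S)"
  have "f \<in> span X" if f: "f \<in> supported I P" for f
  proof -
    have "f = (\<Sum>i\<in>I. ext i (f i))"
    proof
      fix j
      show "f j = (\<Sum>i\<in>I. ext i (f i)) j"
        using I f by (cases "j \<in> I") (auto simp: sum_fun_apply ext_def supported_def sum.delta)
    qed
    moreover have "ext i (f i) \<in> span X" if "i \<in> I" for i
    proof -
      have "f i \<in> span S" using f that S by (auto simp: supported_def)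
      then have "ext i (f i) \<in> span (ext i ` S)" unfolding linear_span_image[OF l] by simp
      then show ?thesis using span_mono[of "ext i ` S" X] that by (auto simp: X_def)
    qed
    ultimately show ?thesis using span_sum by metis
  qed
  moreover have "finite X" using I S by (simp add: X_def)
  ultimately show ?thesis unfolding finitely_spanned_def by blast
qed

lemma finite_mesh_faces:
  assumes "simplicial_triangulation T"
  shows "finite (mesh_faces T)"
  unfolding mesh_faces_def faces_eq
  using triangulationD(1)[OF assms] simplex_vertsD(1)[OF triangulationD(2)[OF assms]] by auto

lemma Vh0_vcont:
  assumes "v \<in> Vh0 k l T"
  shows "v \<in> vcont"
proof -
  have "cont (fst v V)" for V
    using assms continuous_vpolys[of "fst v V" k] by (cases "V \<in> T") (auto simp: Vh0_def)
  moreover have "cont (snd v e)" for e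
    using assms continuous_vpolys[of "snd v e" l] by (cases "e \<in> mesh_faces T") (auto simp: Vh0_def)
  ultimately show ?thesis by (simp add: vcont_def)
qed

lemma bh_lin:
  assumes T: "\<And>V. V \<in> T \<Longrightarrow> simplex_verts V" and q: "q \<in> Qh0 k T"
  shows "lin_on vcont (\<lambda>v. bh k T v q)"
  unfolding bh_def
proof (intro lin_on_sum' eint_lin[OF T])
  show "lin_on vcont (\<lambda>v. wgrad k V (fst q V) (snd q) x \<bullet> fst v V x)" for V x
    by (simp add: lin_on_def inner_add_right)
  show "(\<lambda>x. wgrad k V (fst q V) (snd q) x \<bullet> fst v V x) integrable_on (convex hull V)"
    if V: "V \<in> T" and v: "v \<in> vcont" for V v
  proof -
    \<comment> \<open>elements of Qh0 are unconstrained off the mesh\<close>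
    define qb where "qb e = (if e \<in> faces V then snd q e else (\<lambda>_. 0))" for e
    have e: "wgrad k V (fst q V) (snd q) = wgrad k V (fst q V) qb"
      by (rule wgrad_cong[OF T[OF V]]) (auto simp: qb_def)
    have "cont (qb e)" for e
      using q V continuous_polys[of "snd q e" k] by (auto simp: qb_def Qh0_def mesh_faces_def)
    moreover have "cont (fst q V)" using q V continuous_polys[of "fst q V" "k - 1"] by (auto simp: Qh0_def)
    ultimately have "wgrad k V (fst q V) qb \<in> vpolys k" by (intro wgrad_in[OF T[OF V]])
    then show ?thesis unfolding e
      by (intro eint_integrable[OF T[OF V]] continuous_on_inner continuous_vpolys[of _ k] cont_on[OF vcontD(1)[OF v]])
  qed
qed

lemma zero_in_polys: "(\<lambda>_. 0) \<in> polys r" "(\<lambda>_. 0) \<in> vpolys r"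
  using subspace_0[OF subspace_polys[of r]] subspace_0[OF subspace_vpolys[of r]] by (simp_all add: zero_fun_def)

lemma finitely_spanned_polys: "finitely_spanned (polys r)" "finitely_spanned (vpolys r)"
  using fin_gen_polys fin_gen_vpolys by (auto simp: finitely_spanned_def)

lemma subspace_Vh0: "subspace (Vh0 k l T)"
proof (rule subspaceI)
  show "0 \<in> Vh0 k l T"
    by (simp add: zero_in_polys Vh0_def zero_prod_def zero_fun_def)
  show "u + v \<in> Vh0 k l T" if "u \<in> Vh0 k l T" "v \<in> Vh0 k l T" for u v
    using that by (auto simp: Vh0_def plus_fun_def subspace_add[OF subspace_vpolys, unfolded plus_fun_def])
  show "c *\<^sub>R u \<in> Vh0 k l T" if "u \<in> Vh0 k l T" for c u
    using that by (auto simp: Vh0_def scaleR_fun_def subspace_scale[OF subspace_vpolys, unfolded scaleR_fun_def])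
qed

lemma subspace_Wh:
  assumes T: "\<And>V. V \<in> T \<Longrightarrow> simplex_verts V"
  shows "subspace (Wh k l T)"
proof -
  have b: "lin_on (Vh0 k l T) (\<lambda>v. bh k T v q)" if "q \<in> Qh0 k T" for q
    using that by (intro lin_on_subset[OF bh_lin[OF T]]) (auto intro: Vh0_vcont)
  show ?thesis
    unfolding Wh_def
    using subspace_Vh0[of k l T] lin_on_zero[OF b subspace_Vh0] lin_onD[OF b]
    by (auto simp: subspace_def)
qed

lemma finitely_spanned_Vh0:
  assumes "simplicial_triangulation T"
  shows "finitely_spanned (Vh0 k l T)"
proof (rule finitely_spanned_subset)
  show "finitely_spanned (supported T (vpolys k) \<times> supported (mesh_faces T) (vpolys l))"
    using triangulationD(1)[OF assms] finite_mesh_faces[OF assms]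
    by (intro finitely_spanned_Times finitely_spanned_supported finitely_spanned_polys)
qed (auto simp: Vh0_def supported_def zero_fun_def)

text \<open>Members of Sh0 are arbitrary off the mesh; cutting them off gives a finite-dimensional space.\<close>
definition Sh0_cut :: "nat \<Rightarrow> nat \<Rightarrow> (real^'n::finite) set set \<Rightarrow> 'n sfun set" where
  "Sh0_cut k l T = {s \<in> Sh0 k l T. (\<forall>V. V \<notin> T \<longrightarrow> fst s V = 0) \<and> (\<forall>e. e \<notin> mesh_faces T \<longrightarrow> snd s e = 0)}"

lemma Sh0_cut_scont:
  assumes "s \<in> Sh0_cut k l T"
  shows "s \<in> scont"
proof -
  have "cont (fst s V)" for V
    using assms continuous_polys[of "fst s V" k] by (cases "V \<in> T") (auto simp: Sh0_cut_def Sh0_def zero_fun_def)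
  moreover have "cont (snd s e)" for e
    using assms continuous_polys[of "snd s e" l] by (cases "e \<in> mesh_faces T") (auto simp: Sh0_cut_def Sh0_def zero_fun_def)
  ultimately show ?thesis by (simp add: scont_def)
qed

lemma subspace_Sh0_cut: "subspace (Sh0_cut k l T)"
proof (rule subspaceI)
  show "0 \<in> Sh0_cut k l T"
    by (simp add: zero_in_polys Sh0_cut_def Sh0_def zero_prod_def zero_fun_def)
  show "u + v \<in> Sh0_cut k l T" if "u \<in> Sh0_cut k l T" "v \<in> Sh0_cut k l T" for u v
    using that by (auto simp: Sh0_cut_def Sh0_def subspace_add[OF subspace_polys])
  show "c *\<^sub>R u \<in> Sh0_cut k l T" if "u \<in> Sh0_cut k l T" for c u
    using that by (auto simp: Sh0_cut_def Sh0_def subspace_scale[OF subspace_polys])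
qed

lemma finitely_spanned_Sh0_cut:
  assumes "simplicial_triangulation T"
  shows "finitely_spanned (Sh0_cut k l T)"
proof (rule finitely_spanned_subset)
  show "finitely_spanned (supported T (polys k) \<times> supported (mesh_faces T) (polys l))"
    using triangulationD(1)[OF assms] finite_mesh_faces[OF assms]
    by (intro finitely_spanned_Times finitely_spanned_supported finitely_spanned_polys)
qed (auto simp: Sh0_cut_def Sh0_def supported_def)

lemma Sh0_cut_agree:
  assumes "s \<in> Sh0 k l T"
  shows "\<exists>s'\<in>Sh0_cut k l T. agree T s s'"
proof (intro bexI)
  let ?s = "(\<lambda>V. if V \<in> T then fst s V else 0, \<lambda>e. if e \<in> mesh_faces T then snd s e else 0)"
  show "?s \<in> Sh0_cut k l T" using assms by (auto simp: Sh0_cut_def Sh0_def)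
  show "agree T s ?s" by (auto simp: agree_def mesh_faces_def)
qed

lemma Vh0_component:
  assumes v: "v \<in> Vh0 k l T" and T: "simplicial_triangulation T" and km: "k - 1 \<le> m" and ml: "m \<le> l"
    and z: "energy m l T (vcomp i v) (vcomp i v) = 0"
  shows "agree T (vcomp i v) 0"
proof (rule energy_zero_imp_agree[OF T vcomp_scont[OF Vh0_vcont[OF v]] _ _ km ml z])
  show "fst (vcomp i v) V \<in> polys k" if "V \<in> T" for V
    using v that by (auto simp: Vh0_def vcomp_def vpolys_def)
  show "snd (vcomp i v) e x = 0"
    if "e \<in> mesh_faces T" "convex hull e \<subseteq> frontier (region T)" "x \<in> convex hull e" for e x
    using v that by (auto simp: Vh0_def vcomp_def)
qed

lemma Sh0_cut_definite:
  assumes s: "s \<in> Sh0_cut k l T" and T: "simplicial_triangulation T" and km: "k - 1 \<le> m" and ml: "m \<le> l"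
    and z: "energy m l T s s = 0"
  shows "agree T s 0"
  using s by (intro energy_zero_imp_agree[OF T Sh0_cut_scont[OF s] _ _ km ml z]) (auto simp: Sh0_cut_def Sh0_def)

section \<open>Existence for the coupled velocity-temperature problem\<close>

theorem theorem3p1:
  fixes Th Tf :: "(real^'n::finite) set set"
    and k l m :: nat and Pr \<kappa> Ra :: real and jd :: 'n
    and f :: "real^'n \<Rightarrow> real^'n" and g :: "real^'n \<Rightarrow> real"
  assumes dim: "CARD('n) = 2 \<or> CARD('n) = 3"
    and tri: "simplicial_triangulation Th"
    and sub: "Tf \<subseteq> Th"
    and dom: "region Th \<noteq> {}" "connected (region Th)"
    and subdom: "region Tf \<noteq> {}" "connected (region Tf)"
    and k: "k \<ge> 1" and l: "l = k - 1 \<or> l = k" and m: "k - 1 \<le> m" "m \<le> l"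
    and pos: "Pr > 0" "\<kappa> > 0" "Ra > 0"
    and f: "L2_on (region Tf) f" and g: "L2_on (region Th) g"
  shows "\<exists>uh Tn. uh \<in> Wh k l Tf \<and> Tn \<in> Sh0 k l Th \<and>
     (\<forall>v\<in>Wh k l Tf. Ah k l m Pr Tf uh uh v - dh jd Pr Ra Tf Tn v
                     = (\<Sum>V\<in>Tf. eint V (\<lambda>x. f x \<bullet> fst v V x))) \<and>
     (\<forall>s\<in>Sh0 k l Th. Abar k l m \<kappa> Th uh Tn s
                     = (\<Sum>V\<in>Th. eint V (\<lambda>x. g x * fst s V x)))"
proof -
  note Ths = triangulationD(2)[OF tri]
  have trif: "simplicial_triangulation Tf" by (rule triangulation_subset[OF tri sub])
  note Tfs = triangulationD(2)[OF trif]
  let ?W1 = "Wh k l Tf" and ?W2 = "Sh0_cut k l Th"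
  let ?A = "ah m l Pr Tf" and ?B = "abar m l \<kappa> Th" and ?d = "dh jd Pr Ra Tf"
  let ?F = "\<lambda>v. \<Sum>V\<in>Tf. eint V (\<lambda>x. f x \<bullet> fst v V x)" and ?G = "\<lambda>s. \<Sum>V\<in>Th. eint V (\<lambda>x. g x * fst s V x)"
  have W1V: "?W1 \<subseteq> Vh0 k l Tf" by (auto simp: Wh_def)
  then have W1c: "?W1 \<subseteq> vcont" using Vh0_vcont by blast
  have W2c: "?W2 \<subseteq> scont" using Sh0_cut_scont by blast
  have sW1: "subspace ?W1" by (rule subspace_Wh[OF Tfs])
  have sW2: "subspace ?W2" by (rule subspace_Sh0_cut)
  have fW1: "finitely_spanned ?W1" by (rule finitely_spanned_subset[OF finitely_spanned_Vh0[OF trif] W1V])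
  have fW2: "finitely_spanned ?W2" by (rule finitely_spanned_Sh0_cut[OF tri])
  have bA: "bilin_on vcont vcont ?A"
    unfolding ah_eq
    by (intro bilin_on_cmult bilin_on_sum bilin_on_compose[OF energy_bilin[OF Tfs] lin_on_vcomp lin_on_vcomp] vcomp_scont)
  have bB: "bilin_on scont scont ?B"
    unfolding abar_eq by (intro bilin_on_cmult energy_bilin[OF Ths])
  have eA: "energy m l Tf (vcomp i v) (vcomp i v) \<ge> 0" if "v \<in> ?W1" for i v
    using that W1c by (intro energy_nonneg[OF Tfs] vcomp_scont) auto
  have pA: "?A v v \<ge> 0" if "v \<in> ?W1" for v
    unfolding ah_eq using pos eA[OF that] by (intro mult_nonneg_nonneg sum_nonneg) auto
  have pB: "?B s s \<ge> 0" if "s \<in> ?W2" for s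
    unfolding abar_eq using pos energy_nonneg[OF Ths, where s=s and m=m and l=l] that W2c by auto
  have nA: "agree Tf (vcomp i v) 0" if v: "v \<in> ?W1" and z: "?A v v = 0" for i v
  proof -
    have "(\<Sum>i\<in>UNIV. energy m l Tf (vcomp i v) (vcomp i v)) = 0" using z pos by (simp add: ah_eq)
    then have "energy m l Tf (vcomp i v) (vcomp i v) = 0"
      using sum_nonneg_eq_0_iff[of UNIV "\<lambda>i. energy m l Tf (vcomp i v) (vcomp i v)"] eA[OF v] by simp
    then show ?thesis using v W1V by (intro Vh0_component[OF _ trif m]) auto
  qed
  \<comment> \<open>A velocity of zero energy vanishes identically on fluid elements, while its face
    functions are only known to vanish on the faces.\<close>
  have nA0: "fst v V = (\<lambda>_. 0)" if "v \<in> ?W1" "?A v v = 0" "V \<in> Tf" for v V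
  proof
    show "fst v V x = 0" for x
      unfolding vec_eq_iff
    proof
      fix i
      have "fst (vcomp i v) V x = 0" using agreeD(1)[OF nA[OF that(1,2), of i] that(3)] by simp
      then show "fst v V x $ i = 0 $ i" by (simp add: vcomp_def)
    qed
  qed
  have nB: "agree Th s 0" if "s \<in> ?W2" "?B s s = 0" for s
    using that pos by (intro Sh0_cut_definite[OF _ tri m]) (auto simp: abar_eq)
  have fA: "fin_psd_form ?W1 ?A"
  proof
    show "?A x y = ?A y x" for x y by (simp add: ah_eq energy_sym)
  qed (use sW1 bilin_on_subset[OF bA W1c W1c] pA fW1 in \<open>auto simp: finitely_spanned_def\<close>)
  have fB: "fin_psd_form ?W2 ?B"
  proof
    show "?B x y = ?B y x" for x y by (simp add: abar_eq energy_sym)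
  qed (use sW2 bilin_on_subset[OF bB W2c W2c] pB fW2 in \<open>auto simp: finitely_spanned_def\<close>)
  have bd: "bilin_on ?W2 ?W1 ?d" by (rule bilin_on_subset[OF dh_lin[OF Tfs] W2c W1c])
  have d1: "?d s v = 0" if "s \<in> ?W2" "?B s s = 0" for s v
    using agreeD(1)[OF nB[OF that]] sub by (simp add: dh_def subset_iff eint_def)
  have d2: "?d s v = 0" if "v \<in> ?W1" "?A v v = 0" for s v
    using nA0[OF that] by (simp add: dh_def eint_def)
  \<comment> \<open>M is measured in the energies themselves, so Pr, Ra and \<kappa> are already
    contained in it.\<close>
  obtain M where M: "\<And>s v. s \<in> ?W2 \<Longrightarrow> v \<in> ?W1 \<Longrightarrow> \<bar>?d s v\<bar> \<le> M * (sqrt (?B s s) * sqrt (?A v v))"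
    using bilinear_form_bound[OF fB fA bd d1 d2] by blast
  \<comment> \<open>Weighting the temperature equation by a large factor absorbs the buoyancy coupling.\<close>
  define \<beta> where "\<beta> = M\<^sup>2 + 1"
  have \<beta>: "\<beta> > 0" by (simp add: \<beta>_def add_nonneg_pos)
  let ?W = "?W1 \<times> ?W2"
  define a where "a z y = ?A (fst z) (fst y) + \<beta> * ?B (snd z) (snd y)" for z y :: "'n vfun \<times> 'n sfun"
  define D where "D z y = (- 1) * ?d (snd z) (fst y)" for z y :: "'n vfun \<times> 'n sfun"
  \<comment> \<open>The temperature part carries the same weight \<beta> as in a and L. Skew
    symmetry holds for each part separately, so the weight does not disturb it.\<close>
  define C where "C w z y = (\<Sum>i\<in>UNIV. cbar k Tf (fst w) (vcomp i (fst z)) (vcomp i (fst y))) + \<beta> * cbar k Th (fst w) (snd z) (snd y)"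
    for w z y :: "'n vfun \<times> 'n sfun"
  define L where "L y = ?F (fst y) + \<beta> * ?G (snd y)" for y :: "'n vfun \<times> 'n sfun"
  have F: "lin_on vcont ?F"
    by (rule load_lin[OF Tfs f]) (auto simp: lin_on_def vcontD)
  have G: "lin_on scont ?G"
    using load_lin[OF Ths g, of scont "\<lambda>s. fst s"] by (auto simp: lin_on_def scontD)
  have "\<exists>z\<in>?W. \<forall>y\<in>?W. a z y + D z y + C z z y = L y"
  proof (rule coercive_trilinear_problem[where C=C])
    have sW: "subspace ?W" using sW1 sW2 by (auto simp: subspace_def zero_prod_def)
    have cW: "fst z \<in> vcont" "snd z \<in> scont" "fst z \<in> ?W1" "snd z \<in> ?W2" if "z \<in> ?W" for z
      using that W1c W2c by auto
    have split: "?A (fst z) (fst z) = 0 \<and> ?B (snd z) (snd z) = 0" if "z \<in> ?W" "a z z = 0" for z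
      using that pA[OF cW(3)[OF that(1)]] pB[OF cW(4)[OF that(1)]] \<beta> unfolding a_def
      by (subst (asm) add_nonneg_eq_0_iff) auto
    show "fin_psd_form ?W a"
    proof
      show "bilin_on ?W ?W a"
        unfolding a_def
        by (intro bilin_on_add bilin_on_cmult bilin_on_compose[OF bA lin_on_fst lin_on_fst]
            bilin_on_compose[OF bB lin_on_snd lin_on_snd] cW)
      show "a x y = a y x" for x y by (simp add: a_def ah_eq abar_eq energy_sym)
      show "a z z \<ge> 0" if "z \<in> ?W" for z
        unfolding a_def using pA[OF cW(3)[OF that]] pB[OF cW(4)[OF that]] \<beta> by simp
      show "\<exists>S. finite S \<and> ?W \<subseteq> span S"
        using finitely_spanned_Times[OF fW1 fW2] by (simp add: finitely_spanned_def)
    qed (rule sW)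
    show "bilin_on ?W ?W D"
      unfolding D_def
      by (intro bilin_on_cmult bilin_on_compose[OF dh_lin[OF Tfs] lin_on_snd lin_on_fst] cW)
    show "lin_on ?W L"
      unfolding L_def
      by (intro lin_on_add lin_on_cmult lin_on_compose[OF F lin_on_fst] lin_on_compose[OF G lin_on_snd] cW)
    have lv: "lin_on ?W (\<lambda>z. vcomp i (fst z))" for i
      by (rule lin_on_compose[OF lin_on_vcomp[of UNIV] lin_on_fst]) auto
    show "bilin_on ?W ?W (\<lambda>w y. C w z y)" if z: "z \<in> ?W" for z
      unfolding C_def
      by (intro bilin_on_add bilin_on_cmult bilin_on_sum
          bilin_on_compose[OF cbar_bilin1[OF Ths cW(2)[OF z]] lin_on_fst lin_on_snd]
          bilin_on_compose[OF cbar_bilin1[OF Tfs vcomp_scont[OF cW(1)[OF z]]] lin_on_fst lv]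
          cW vcomp_scont)
    show "bilin_on ?W ?W (C w)" if w: "w \<in> ?W" for w
      unfolding C_def[abs_def]
      by (intro bilin_on_add bilin_on_cmult bilin_on_sum
          bilin_on_compose[OF cbar_bilin2[OF Ths cW(1)[OF w]] lin_on_snd lin_on_snd]
          bilin_on_compose[OF cbar_bilin2[OF Tfs cW(1)[OF w]] lv lv] cW vcomp_scont)
    show "C w z z = 0" for w z by (simp add: C_def cbar_skew)
    show "a z z + D z z \<ge> a z z / 2" if z: "z \<in> ?W" for z
    proof -
      define p where "p = sqrt (?A (fst z) (fst z))"
      define q where "q = sqrt (?B (snd z) (snd z))"
      have p: "?A (fst z) (fst z) = p\<^sup>2" using pA[OF cW(3)[OF z]] by (simp add: p_def)
      have q: "?B (snd z) (snd z) = q\<^sup>2" using pB[OF cW(4)[OF z]] by (simp add: q_def)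
      have "?d (snd z) (fst z) \<le> M * (q * p)"
        using M[OF cW(4)[OF z] cW(3)[OF z]] by (simp add: p_def q_def)
      \<comment> \<open>Young's inequality from (p - M q)^2 \<ge> 0. As a z z = p^2 + \<beta> q^2
        with \<beta> above M^2, the buoyancy takes at most half of it.\<close>
      moreover have "2 * (M * (q * p)) \<le> p\<^sup>2 + M\<^sup>2 * q\<^sup>2"
        using zero_le_power2[of "p - M * q"] by (simp add: power2_diff power_mult_distrib algebra_simps)
      ultimately have "2 * ?d (snd z) (fst z) \<le> p\<^sup>2 + M\<^sup>2 * q\<^sup>2" by linarith
      also have "\<dots> \<le> p\<^sup>2 + (q\<^sup>2 + M\<^sup>2 * q\<^sup>2)" by simp
      finally show ?thesis
        unfolding a_def D_def p q \<beta>_def by (simp add: field_simps)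
    qed
    show "D z y = 0 \<and> C w z y = 0 \<and> L y = 0" if w: "w \<in> ?W" and z: "z \<in> ?W" and y: "y \<in> ?W" and n: "a y y = 0" for w z y
    proof (intro conjI)
      note n1 = split[OF y n, THEN conjunct1] and n2 = split[OF y n, THEN conjunct2]
      note k1 = nA[OF cW(3)[OF y] n1] and k2 = nB[OF cW(4)[OF y] n2]
      show "D z y = 0" using d2[OF cW(3)[OF y] n1] by (simp add: D_def)
      have z0: "(0::'n sfun) \<in> scont" by (simp add: scont_def zero_fun_def)
      have sc: "subspace (scont :: 'n sfun set)"
        by (auto simp: subspace_def scont_def zero_fun_def plus_fun_def scaleR_fun_def intro!: continuous_intros)
      \<comment> \<open>Congruence replaces s by the literal zero, at which linearity gives the
        value 0.\<close>
      have c: "cbar k T (fst w) t s = 0"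
        if T: "\<And>V. V \<in> T \<Longrightarrow> simplex_verts V" and t: "t \<in> scont" and s: "agree T s 0" for T t s
      proof -
        have "cbar k T (fst w) t s = cbar k T (fst w) t 0" by (rule cbar_cong[OF T s])
        also have "\<dots> = 0" by (rule lin_on_zero[OF bilin_onD(2)[OF cbar_bilin2[OF T cW(1)[OF w]] t] sc])
        finally show ?thesis .
      qed
      show "C w z y = 0"
        unfolding C_def using c[OF Tfs vcomp_scont[OF cW(1)[OF z]] k1] c[OF Ths cW(2)[OF z] k2] by simp
      show "L y = 0"
        using nA0[OF cW(3)[OF y] n1] agreeD(1)[OF k2] by (simp add: L_def eint_def)
    qed
  qed
  then obtain u T where u: "u \<in> ?W1" and T: "T \<in> ?W2"
    and eq: "\<And>v s. v \<in> ?W1 \<Longrightarrow> s \<in> ?W2 \<Longrightarrow> a (u, T) (v, s) + D (u, T) (v, s) + C (u, T) (u, T) (v, s) = L (v, s)"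
    by force
  have uc: "u \<in> vcont" and Tc: "T \<in> scont" using u T W1c W2c by auto
  \<comment> \<open>The combined equation is split by testing with (v, 0) and with (0, s); the facts
    that follow evaluate every term at a zero argument.\<close>
  have z1: "0 \<in> ?W1" and z2: "0 \<in> ?W2" using sW1 sW2 subspace_0 by auto
  have B0: "?B T 0 = 0" by (rule lin_on_zero[OF lin_on_subset[OF bilin_onD(2)[OF bB Tc] W2c] sW2])
  have c0: "cbar k Th u T 0 = 0"
    by (rule lin_on_zero[OF lin_on_subset[OF bilin_onD(2)[OF cbar_bilin2[OF Ths uc] Tc] W2c] sW2])
  have G0: "?G 0 = 0" by (simp add: eint_def)
  have A0: "?A u 0 = 0" by (rule lin_on_zero[OF lin_on_subset[OF bilin_onD(2)[OF bA uc] W1c] sW1])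
  have d0: "?d T 0 = 0" by (rule lin_on_zero[OF lin_on_subset[OF bilin_onD(2)[OF dh_lin[OF Tfs] Tc] W1c] sW1])
  have ch: "ch k Tf u u v = (\<Sum>i\<in>UNIV. cbar k Tf u (vcomp i u) (vcomp i v))" if "v \<in> ?W1" for v
    using ch_eq[OF Tfs uc uc] that W1c by blast
  have vc0: "vcomp i 0 = 0" for i :: 'n by (simp add: vcomp_def zero_prod_def zero_fun_def)
  have cf0: "cbar k Tf u t 0 = 0" if "t \<in> scont" for t
    by (rule lin_on_zero[OF lin_on_subset[OF bilin_onD(2)[OF cbar_bilin2[OF Tfs uc] that] W2c] sW2])
  have F0: "?F 0 = 0" by (simp add: eint_def)
  show ?thesis
  proof (intro exI conjI ballI)
    show "u \<in> ?W1" by (rule u)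
    show "T \<in> Sh0 k l Th" using T by (simp add: Sh0_cut_def)
    show "Ah k l m Pr Tf u u v - ?d T v = ?F v" if v: "v \<in> ?W1" for v
      using eq[OF v z2] B0 c0 G0 ch[OF v] by (simp add: a_def D_def C_def L_def Ah_def)
    show "Abar k l m \<kappa> Th u T s = ?G s" if s: "s \<in> Sh0 k l Th" for s
    proof -
      \<comment> \<open>Test functions range over all of \<open>Sh0\<close>, but the forms and the
        load do not distinguish s from its cut-off version.\<close>
      obtain s' where s': "s' \<in> ?W2" "agree Th s s'" using Sh0_cut_agree[OF s] by blast
      have "\<beta> * ?B T s' + \<beta> * cbar k Th u T s' = \<beta> * ?G s'"
        using eq[OF z1 s'(1)] A0 d0 F0 vcomp_scont[OF uc] by (simp add: a_def D_def C_def L_def vc0 cf0)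
      then have "?B T s' + cbar k Th u T s' = ?G s'"
        using \<beta> by (simp flip: distrib_left)
      moreover have "?G s = ?G s'" using agreeD(1)[OF s'(2)] by simp
      moreover have "energy m l Th T s = energy m l Th T s'" by (rule energy_cong[OF Ths s'(2)])
      moreover have "cbar k Th u T s = cbar k Th u T s'" by (rule cbar_cong[OF Ths s'(2)])
      ultimately show ?thesis by (simp add: Abar_def abar_eq)
    qed
  qed
qed

end
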